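(* Let $N\ge3$ and let $d\mu=\mu(x)\,dx$ be a positive measure (not necessarily a probability measure) on $\mathbb{R}^N$ with density $\mu$. Write $c_0(N):=\left(\frac{N-2}{2}\right)^2$ and $U_\mu:=\frac14\left|\frac{\nabla\mu}{\mu}\right|^2-\frac12\frac{\Delta\mu}{\mu}$. Assume: (1) $\mu\ge 0$, $\mu^{1/2}\in H^1_{loc}(\mathbb{R}^N)$, $\Delta\mu\in L^1_{loc}(\mathbb{R}^N)$; (2) the constant $c_{0,\mu}:=\liminf_{x\to 0}\left(c_0(N)-|x|^2U_\mu(x)\right)$ is finite; (3) for every $R>0$ the function $U:=U_\mu-\frac{1}{|x|^2}\limsup_{x\to0}|x|^2U_\mu$ is bounded from above in $\mathbb{R}^N\setminus B_R$. Then for every $c<c_{0,\mu}$ there exists a constant $C_\mu$ such that for any $\varphi\in H^1_\mu$ $$c\int_{\mathbb{R}^N}\frac{\varphi^2}{|x|^2}\,d\mu\le\int_{\mathbb{R}^N}|\nabla\varphi|^2\,d\mu+C_\mu\int_{\mathbb{R}^N}\varphi^2\,d\mu.$$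
   Context: $B_R$ denotes the open ball of $\mathbb{R}^N$ of radius $R$ centered at $0$. $L^2_\mu:=L^2(\mathbb{R}^N,d\mu)$, and $H^1_\mu$ is the Sobolev space of functions in $L^2_\mu$ whose weak first derivatives belong to $L^2_\mu$; $C_c^\infty(\mathbb{R}^N)$ is dense in $H^1_\mu$ when $\mu^{1/2}\in H^1_{loc}(\mathbb{R}^N)$ (known fact). Functions $\varphi$ are real-valued. *)

theory Defs
  imports "HOL-Analysis.Analysis"
begin

abbreviation pderiv_at :: "'a::euclidean_space \<Rightarrow> ('a \<Rightarrow> real) \<Rightarrow> 'a \<Rightarrow> real" where
  "pderiv_at i f \<equiv> (\<lambda>x. frechet_derivative f (at x) i)"

text \<open>A function is of class \<open>C\<^sup>k\<^sup>+\<^sup>1\<close> iff it is differentiable with partial derivatives of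
  class \<open>C\<^sup>k\<close>.\<close>

primrec C_class :: "nat \<Rightarrow> ('a::euclidean_space \<Rightarrow> real) \<Rightarrow> bool" where
  "C_class 0 f \<longleftrightarrow> continuous_on UNIV f"
| "C_class (Suc k) f \<longleftrightarrow> f differentiable_on UNIV \<and> (\<forall>i\<in>Basis. C_class k (pderiv_at i f))"

definition test_functions :: "('a::euclidean_space \<Rightarrow> real) set" where
  "test_functions = {\<eta>. (\<forall>k. C_class k \<eta>) \<and> compact (closure {x. \<eta> x \<noteq> 0})}"

definition L1_loc :: "('a::euclidean_space \<Rightarrow> 'b::euclidean_space) set" where
  "L1_loc = {f. \<forall>K. compact K \<longrightarrow> f absolutely_integrable_on K}"

definition L2_loc :: "('a::euclidean_space \<Rightarrow> 'b::euclidean_space) set" where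
  "L2_loc = {f \<in> borel_measurable lebesgue.
      \<forall>K. compact K \<longrightarrow> (\<lambda>x. (norm (f x))\<^sup>2) absolutely_integrable_on K}"

definition L2 :: "'a::euclidean_space measure \<Rightarrow> ('a \<Rightarrow> 'b::euclidean_space) set" where
  "L2 M = {f \<in> borel_measurable M. integrable M (\<lambda>x. (norm (f x))\<^sup>2)}"

text \<open>Weak derivatives are distributional derivatives with respect to Lebesgue measure, also in
  the weighted spaces. They are stated as relations, since they are unique only up to null sets.\<close>

definition has_weak_gradient :: "('a::euclidean_space \<Rightarrow> real) \<Rightarrow> ('a \<Rightarrow> 'a) \<Rightarrow> bool" where
  "has_weak_gradient u g \<longleftrightarrow> u \<in> L1_loc \<and> g \<in> L1_loc \<and>
     (\<forall>\<eta>\<in>test_functions. \<forall>i\<in>Basis.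
        (\<integral>x. u x * pderiv_at i \<eta> x \<partial>lebesgue) = - (\<integral>x. (g x \<bullet> i) * \<eta> x \<partial>lebesgue))"

text \<open>The second component is required to be locally integrable, so this relation includes the
  condition that the distributional Laplacian of \<open>u\<close> belongs to \<open>L\<^sup>1\<^sub>l\<^sub>o\<^sub>c\<close>.\<close>

definition has_weak_Laplacian :: "('a::euclidean_space \<Rightarrow> real) \<Rightarrow> ('a \<Rightarrow> real) \<Rightarrow> bool" where
  "has_weak_Laplacian u l \<longleftrightarrow> u \<in> L1_loc \<and> l \<in> L1_loc \<and>
     (\<forall>\<eta>\<in>test_functions.
        (\<integral>x. u x * (\<Sum>i\<in>Basis. pderiv_at i (pderiv_at i \<eta>) x) \<partial>lebesgue)
          = (\<integral>x. l x * \<eta> x \<partial>lebesgue))"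

definition H1_loc :: "('a::euclidean_space \<Rightarrow> real) set" where
  "H1_loc = {u \<in> L2_loc. \<exists>g\<in>L2_loc. has_weak_gradient u g}"

definition H1 :: "'a::euclidean_space measure \<Rightarrow> ('a \<Rightarrow> real) set" where
  "H1 M = {u \<in> L2 M. \<exists>g\<in>L2 M. has_weak_gradient u g}"

definition weighted :: "('a::euclidean_space \<Rightarrow> real) \<Rightarrow> 'a measure" where
  "weighted \<mu> = density lebesgue (\<lambda>x. ennreal (\<mu> x))"

text \<open>\<open>c0 TYPE('a)\<close> is the optimal constant in the unweighted Hardy inequality in dimension
  \<open>N = DIM('a)\<close>.\<close>

definition c0 :: "'a::euclidean_space itself \<Rightarrow> real" where
  "c0 _ = ((real DIM('a) - 2) / 2)\<^sup>2"

text \<open>In the following, \<open>G\<close> and \<open>l\<close> stand for the weak gradient and the weak Laplacian of \<open>\<mu>\<close>.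
  Both are determined only almost everywhere, and the quotients by \<open>\<mu>\<close> are meaningful only
  where \<open>\<mu> > 0\<close>; hence the potential is a function defined almost everywhere with respect to
  \<open>\<mu> dx\<close>. Accordingly, limits inferior and superior at the origin are essential ones with
  respect to that measure, i.e. they are taken along the filter generated by the sets
  \<open>V - {0} - Z\<close> with \<open>V\<close> a neighbourhood of the origin and \<open>Z\<close> a null set of \<open>\<mu> dx\<close>.\<close>

definition U_pot :: "('a::euclidean_space \<Rightarrow> real) \<Rightarrow> ('a \<Rightarrow> 'a) \<Rightarrow> ('a \<Rightarrow> real) \<Rightarrow> 'a \<Rightarrow> real" where
  "U_pot \<mu> G l x = 1/4 * (norm (G x /\<^sub>R \<mu> x))\<^sup>2 - 1/2 * (l x / \<mu> x)"

definition ess_at_0 :: "'a::euclidean_space measure \<Rightarrow> 'a filter" where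
  "ess_at_0 M = inf (at 0) (ae_filter M)"

definition c0_weighted :: "('a::euclidean_space \<Rightarrow> real) \<Rightarrow> ('a \<Rightarrow> 'a) \<Rightarrow> ('a \<Rightarrow> real) \<Rightarrow> ereal" where
  "c0_weighted \<mu> G l =
     Liminf (ess_at_0 (weighted \<mu>)) (\<lambda>x. ereal (c0 TYPE('a) - (norm x)\<^sup>2 * U_pot \<mu> G l x))"

definition U_rem :: "('a::euclidean_space \<Rightarrow> real) \<Rightarrow> ('a \<Rightarrow> 'a) \<Rightarrow> ('a \<Rightarrow> real) \<Rightarrow> 'a \<Rightarrow> ereal" where
  "U_rem \<mu> G l x = ereal (U_pot \<mu> G l x) - ereal (1 / (norm x)\<^sup>2) *
     Limsup (ess_at_0 (weighted \<mu>)) (\<lambda>y. ereal ((norm y)\<^sup>2 * U_pot \<mu> G l y))"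

end

theory Submission
  imports Defs
begin

text \<open>
  Put \<open>w = \<mu>\<^sup>1\<^sup>/\<^sup>2\<close>, \<open>a = (N - 2) / 2\<close> and \<open>Y = a x / (|x|\<^sup>2 + \<delta>)\<close>. Expanding
  \<open>0 \<le> \<integral> \<mu> |\<nabla>\<phi> + \<phi> (Y + \<nabla>\<mu> / (2 \<mu>))|\<^sup>2\<close> and integrating the mixed term by parts gives
  \<open>\<integral> \<phi>\<^sup>2 (div Y - |Y|\<^sup>2) \<mu> \<le> \<integral> |\<nabla>\<phi>|\<^sup>2 \<mu> + \<integral> \<phi>\<^sup>2 U\<^sub>\<mu> \<mu>\<close>, and \<open>div Y - |Y|\<^sup>2 \<ge> a\<^sup>2 / (|x|\<^sup>2 + \<delta>)\<close>. As \<open>\<delta>\<close> tends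
  to \<open>0\<close> this becomes \<open>\<integral> \<phi>\<^sup>2 (c\<^sub>0(N) / |x|\<^sup>2 - U\<^sub>\<mu>) \<mu> \<le> \<integral> |\<nabla>\<phi>|\<^sup>2 \<mu>\<close>, and the hypotheses on \<open>U\<^sub>\<mu>\<close> say exactly that
  \<open>c\<^sub>0(N) / |x|\<^sup>2 - U\<^sub>\<mu> \<ge> c / |x|\<^sup>2 - C\<close> almost everywhere with respect to \<open>\<mu> dx\<close>.

  The integration by parts needs care, since \<open>\<nabla>\<mu>\<close> has only a divergence and no weak derivatives.
  Instead of showing that smooth functions are dense, one first multiplies \<open>\<phi>\<close>, made bounded with
  bounded support, by \<open>w\<^sup>2 / (k + w\<^sup>2)\<close>. This puts its gradient into the unweighted \<open>L\<^sup>2\<close>. Then \<open>\<mu>\<close> is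
  mollified, where the Cauchy-Schwarz bound \<open>|\<nabla>\<mu>\<^sub>\<epsilon>|\<^sup>2 \<le> 4 N \<mu>\<^sub>\<epsilon> (|\<nabla>w|\<^sup>2)\<^sub>\<epsilon>\<close> and the factor \<open>m / (m + \<mu>\<^sub>\<epsilon>)\<close> make
  all terms pass to the limit.\<close>

section \<open>Smooth bump functions\<close>

text \<open>The weak Laplacian admits only smooth test functions, and \<phi>^2 is not one; so one
  side of the pairing has to be made classical, and each limit that undoes this needs an integrable
  majorant. This fixes the order of the limits. Mollification is removed at fixed \<open>m\<close>,
  where the gradient \<open>Q\<close> of the test function must be in unweighted L2. Then
  \<open>m\<close> tends to infinity, with a majorant that contains only w^2 |Q|^2. Next \<delta>
  tends to 0 while the damping is still present, then the damping is removed, and last the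
  truncation and the cut-off.

  Finiteness of the singular integral is never assumed. For the damped function it follows by Fatou
  from a bound that does not depend on \<delta>, and in the later limits the singular term is again
  carried by Fatou, everything else by dominated convergence.

  Since \<mu> may vanish, the estimates are written without dividing by it: |grad w|^2 -
  \<Delta>\<mu> / 2 stands for \<mu> times the potential, and the damped function is 0 wherever w
  is.\<close>

definition flat :: "nat \<Rightarrow> real \<Rightarrow> real" where
  "flat j t = (if t > 0 then exp (- 1 / t) / t ^ j else 0)"

lemma flat_nonneg: "flat j t \<ge> 0"
  by (simp add: flat_def)

lemma flat_tendsto_0: "(flat j \<longlongrightarrow> 0) (at_right 0)"
proof -
  have "((\<lambda>t. inverse t ^ j / exp (inverse t)) \<longlongrightarrow> (0::real)) (at_right 0)"
    by (rule filterlim_compose[OF tendsto_power_div_exp_0 filterlim_inverse_at_top_right])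
  moreover have "\<forall>\<^sub>F t in at_right (0::real). inverse t ^ j / exp (inverse t) = flat j t"
    unfolding eventually_at_right_field
    by (intro exI[of _ 1]) (auto simp: flat_def exp_minus field_simps)
  ultimately show ?thesis
    by (rule Lim_transform_eventually)
qed

text \<open>Division by \<open>t ^ j\<close> closes the family under differentiation. At 0 the right
  difference quotient of \<open>flat j\<close> is \<open>flat (Suc j)\<close>, so the vanishing
  right limit for every index settles differentiability there.\<close>

lemma flat_DERIV: "(flat j has_real_derivative flat (j + 2) t - real j * flat (j + 1) t) (at t)"
proof (cases t "0::real" rule: linorder_cases)
  case less
  have "((\<lambda>t. 0::real) has_real_derivative 0) (at t)" by simp
  then have "(flat j has_real_derivative 0) (at t)"
    by (rule has_field_derivative_transform_within_open[of _ _ _ "{..<0}"])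
      (use less in \<open>auto simp: flat_def\<close>)
  then show ?thesis using less by (simp add: flat_def)
next
  case greater
  \<comment> \<open>The power rule produces \<open>t ^ (j - 1)\<close> with truncated subtraction,
    hence the separate value for \<open>j = 0\<close>.\<close>
  have "t ^ (j - 1) * t = (if j = 0 then t else t ^ j)"
    by (cases j) auto
  then have "((\<lambda>t. exp (- 1 / t) / t ^ j) has_real_derivative
      flat (j + 2) t - real j * flat (j + 1) t) (at t)"
    using greater
    by (auto intro!: derivative_eq_intros simp: flat_def field_simps power2_eq_square split: if_splits)
  then show ?thesis
    by (rule has_field_derivative_transform_within_open[of _ _ _ "{0<..}"])
      (use greater in \<open>auto simp: flat_def\<close>)
next
  case equal
  have "((\<lambda>h. flat j h / h) \<longlongrightarrow> 0) (at 0)"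
  proof (rule filterlim_split_at)
    have "\<forall>\<^sub>F h in at_left (0::real). 0 = flat j h / h"
      unfolding eventually_at_left_field by (intro exI[of _ "-1"]) (auto simp: flat_def)
    then show "((\<lambda>h. flat j h / h) \<longlongrightarrow> 0) (at_left 0)"
      by (rule Lim_transform_eventually[OF tendsto_const])
    have "\<forall>\<^sub>F h in at_right (0::real). flat (Suc j) h = flat j h / h"
      unfolding eventually_at_right_field by (intro exI[of _ 1]) (auto simp: flat_def)
    then show "((\<lambda>h. flat j h / h) \<longlongrightarrow> 0) (at_right 0)"
      by (rule Lim_transform_eventually[OF flat_tendsto_0])
  qed
  then show ?thesis
    using equal by (simp add: DERIV_def flat_def)
qed

text \<open>Partial derivatives of members are members again, so every member is smooth; and \<open>bumps y r\<close>
  contains the kernel below reflected at \<open>y\<close>, so that weak derivatives can be tested against it.\<close>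

inductive_set bumps :: "'a::euclidean_space \<Rightarrow> real \<Rightarrow> ('a \<Rightarrow> real) set" for y :: 'a and r :: real where
  flat: "(\<lambda>x. flat j (r\<^sup>2 - (norm (y - x))\<^sup>2)) \<in> bumps y r"
| add: "f \<in> bumps y r \<Longrightarrow> g \<in> bumps y r \<Longrightarrow> (\<lambda>x. f x + g x) \<in> bumps y r"
| cmult: "f \<in> bumps y r \<Longrightarrow> (\<lambda>x. c * f x) \<in> bumps y r"
| coord: "f \<in> bumps y r \<Longrightarrow> (\<lambda>x. ((y - x) \<bullet> b) * f x) \<in> bumps y r"

text \<open>The gradient of r^2 - |y - x|^2 in x is 2 (y - x); this is why multiplication by
  \<open>(y - x) \<bullet> b\<close> is among the closure rules.\<close>

lemma bumps_GDERIV: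
  assumes "f \<in> bumps y r"
  shows "\<exists>D. (\<forall>x. GDERIV f x :> D x) \<and> (\<forall>b. (\<lambda>x. D x \<bullet> b) \<in> bumps y r)"
  using assms
proof induction
  case (flat j)
  let ?t = "\<lambda>x. r\<^sup>2 - (norm (y - x))\<^sup>2"
  let ?d = "\<lambda>x. flat (j + 2) (?t x) - real j * flat (j + 1) (?t x)"
  have "GDERIV ?t x :> 2 *\<^sub>R (y - x)" for x
    unfolding gderiv_def power2_norm_eq_inner
    by (auto intro!: derivative_eq_intros simp: fun_eq_iff inner_simps inner_commute algebra_simps)
  then have "GDERIV (\<lambda>x. flat j (?t x)) x :> ?d x *\<^sub>R 2 *\<^sub>R (y - x)" for x
    by (rule GDERIV_DERIV_compose) (rule flat_DERIV)
  moreover have "(\<lambda>x. (?d x *\<^sub>R 2 *\<^sub>R (y - x)) \<bullet> b) \<in> bumps y r" for b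
  proof -
    have "(\<lambda>x. (y - x) \<bullet> b * (2 * (flat (j + 2) (?t x) + (- real j) * flat (j + 1) (?t x)))) \<in> bumps y r"
      by (intro bumps.intros)
    then show ?thesis by (simp add: algebra_simps)
  qed
  ultimately show ?case
    by (intro exI[of _ "\<lambda>x. ?d x *\<^sub>R 2 *\<^sub>R (y - x)"]) auto
next
  case (add f g)
  then obtain D E where
    "\<And>x. GDERIV f x :> D x" "\<And>b. (\<lambda>x. D x \<bullet> b) \<in> bumps y r"
    "\<And>x. GDERIV g x :> E x" "\<And>b. (\<lambda>x. E x \<bullet> b) \<in> bumps y r" by blast
  then show ?case
    by (intro exI[of _ "\<lambda>x. D x + E x"]) (auto intro!: GDERIV_add bumps.intros simp: inner_add_left)
next
  case (cmult f c)
  then obtain D where D: "\<And>x. GDERIV f x :> D x" "\<And>b. (\<lambda>x. D x \<bullet> b) \<in> bumps y r" by blast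
  have "GDERIV (\<lambda>x. c * f x) x :> c *\<^sub>R D x" for x
    using GDERIV_mult[OF GDERIV_const D(1), of c x] by simp
  with D show ?case
    by (intro exI[of _ "\<lambda>x. c *\<^sub>R D x"]) (auto intro!: bumps.intros)
next
  case (coord f b)
  then obtain D where D: "\<And>x. GDERIV f x :> D x" "\<And>b. (\<lambda>x. D x \<bullet> b) \<in> bumps y r" by blast
  have "GDERIV (\<lambda>x. (y - x) \<bullet> b) x :> - b" for x
    unfolding gderiv_def by (auto intro!: derivative_eq_intros simp: inner_commute)
  then have "GDERIV (\<lambda>x. (y - x) \<bullet> b * f x) x :> ((y - x) \<bullet> b) *\<^sub>R D x + f x *\<^sub>R (- b)" for x
    by (rule GDERIV_mult[OF _ D(1)])
  moreover have "(\<lambda>x. (((y - x) \<bullet> b) *\<^sub>R D x + f x *\<^sub>R (- b)) \<bullet> b') \<in> bumps y r" for b'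
  proof -
    have "(\<lambda>x. (y - x) \<bullet> b * (D x \<bullet> b') + (- (b \<bullet> b')) * f x) \<in> bumps y r"
      using coord D by (intro bumps.intros)
    then show ?thesis by (simp add: inner_add_left inner_diff_left mult.commute)
  qed
  ultimately show ?case
    by (intro exI[of _ "\<lambda>x. ((y - x) \<bullet> b) *\<^sub>R D x + f x *\<^sub>R (- b)"]) auto
qed

lemma GDERIV_pderiv_at: "GDERIV f x :> D \<Longrightarrow> pderiv_at i f x = D \<bullet> i"
  unfolding gderiv_def by (drule frechet_derivative_at) (metis inner_commute)

lemma GDERIV_continuous: "(\<And>x. GDERIV f x :> D x) \<Longrightarrow> continuous_on S f"
  unfolding gderiv_def
  by (meson continuous_at_imp_continuous_on has_derivative_continuous)

lemma bumps_C_class: "f \<in> bumps y r \<Longrightarrow> C_class k f"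
proof (induction k arbitrary: f)
  case 0
  then show ?case using bumps_GDERIV GDERIV_continuous by (metis C_class.simps(1))
next
  case (Suc k)
  obtain D where D: "\<And>x. GDERIV f x :> D x" "\<And>b. (\<lambda>x. D x \<bullet> b) \<in> bumps y r"
    using bumps_GDERIV[OF Suc.prems] by blast
  have "f differentiable_on UNIV"
    using D(1) unfolding gderiv_def differentiable_on_def differentiable_def
    by (meson has_derivative_at_withinI)
  moreover have "pderiv_at i f = (\<lambda>x. D x \<bullet> i)" for i
    using GDERIV_pderiv_at[OF D(1)] by blast
  ultimately show ?case using Suc.IH D(2) by simp
qed

lemma bumps_eq_0: "f \<in> bumps y r \<Longrightarrow> norm (y - x) \<ge> \<bar>r\<bar> \<Longrightarrow> f x = 0"
proof (induction rule: bumps.induct)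
  case (flat j)
  then have "r\<^sup>2 \<le> (norm (y - x))\<^sup>2" by (metis abs_le_square_iff abs_norm_cancel)
  then show ?case by (simp add: flat_def)
qed auto

lemma bumps_test_function:
  assumes "f \<in> bumps y r" shows "f \<in> test_functions"
proof -
  have "{x. f x \<noteq> 0} \<subseteq> cball y \<bar>r\<bar>"
    using bumps_eq_0[OF assms] by (force simp: dist_norm)
  then have "bounded {x. f x \<noteq> 0}"
    using bounded_cball bounded_subset by blast
  then show ?thesis
    using bumps_C_class[OF assms] by (auto simp: test_functions_def compact_closure)
qed

section \<open>Mollification\<close>

text \<open>As in the completeness proof for L1: along a subsequence with norms below 2^-n the
  series of absolute values is integrable, so its sum is a majorant and its terms tend to 0 almost
  everywhere.\<close>

lemma L1_null_dominated_subseq: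
  fixes D :: "nat \<Rightarrow> 'a \<Rightarrow> real"
  assumes D: "\<And>n. integrable M (D n)"
    and lim: "(\<lambda>n. \<integral>x. \<bar>D n x\<bar> \<partial>M) \<longlonglongrightarrow> 0"
  obtains r G where "strict_mono (r :: nat \<Rightarrow> nat)" "integrable M G"
    "AE x in M. (\<forall>n. \<bar>D (r n) x\<bar> \<le> G x) \<and> (\<lambda>n. D (r n) x) \<longlonglongrightarrow> 0"
proof -
  have [measurable]: "D n \<in> borel_measurable M" for n
    using D by auto
  have ex: "\<exists>m>k. (\<integral>x. \<bar>D m x\<bar> \<partial>M) < (1/2) ^ j" for k j
  proof -
    have "\<forall>\<^sub>F n in sequentially. (\<integral>x. \<bar>D n x\<bar> \<partial>M) < (1/2) ^ j"
      using order_tendstoD(2)[OF lim] by auto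
    with eventually_gt_at_top[of k]
    have "\<forall>\<^sub>F n in sequentially. n > k \<and> (\<integral>x. \<bar>D n x\<bar> \<partial>M) < (1/2) ^ j"
      by eventually_elim simp
    then show ?thesis
      using eventually_happens by fastforce
  qed
  have "\<exists>r. \<forall>n. (\<integral>x. \<bar>D (r n) x\<bar> \<partial>M) < (1/2) ^ n \<and> r n < r (Suc n)"
    by (rule dependent_nat_choice) (use ex in blast)+
  then obtain r where r: "\<And>n. (\<integral>x. \<bar>D (r n) x\<bar> \<partial>M) < (1/2) ^ n" "strict_mono r"
    by (auto simp: strict_mono_Suc_iff)
  define F where "F x = (\<Sum>n. ennreal \<bar>D (r n) x\<bar>)" for x
  have [measurable]: "F \<in> borel_measurable M"
    unfolding F_def by measurable
  have "(\<integral>\<^sup>+x. F x \<partial>M) = (\<Sum>n. \<integral>\<^sup>+x. ennreal \<bar>D (r n) x\<bar> \<partial>M)"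
    unfolding F_def by (rule nn_integral_suminf) measurable
  also have "\<dots> \<le> (\<Sum>n. ennreal ((1/2) ^ n))"
    using r(1) D by (intro suminf_le) (auto simp: nn_integral_eq_integral less_imp_le)
  also have "\<dots> = ennreal (\<Sum>n. (1/2) ^ n)"
    by (intro suminf_ennreal2) auto
  also have "\<dots> < \<infinity>"
    by simp
  finally have fin: "(\<integral>\<^sup>+x. F x \<partial>M) < \<infinity>" .
  then have ae: "AE x in M. F x \<noteq> \<infinity>"
    by (intro nn_integral_PInf_AE) auto
  have "AE x in M. (\<forall>n. \<bar>D (r n) x\<bar> \<le> enn2real (F x)) \<and> (\<lambda>n. D (r n) x) \<longlonglongrightarrow> 0"
    using ae
  proof eventually_elim
    case (elim x)
    have sm: "summable (\<lambda>n. \<bar>D (r n) x\<bar>)"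
      by (rule summable_suminf_not_top) (use elim in \<open>auto simp: F_def\<close>)
    then have "(\<lambda>n. \<bar>D (r n) x\<bar>) \<longlonglongrightarrow> 0"
      by (rule summable_LIMSEQ_zero)
    moreover have "F x = ennreal (\<Sum>n. \<bar>D (r n) x\<bar>)"
      unfolding F_def by (rule suminf_ennreal2[OF _ sm]) simp
    then have "enn2real (F x) = (\<Sum>n. \<bar>D (r n) x\<bar>)"
      by (simp add: suminf_nonneg sm)
    then have "\<bar>D (r n) x\<bar> \<le> enn2real (F x)" for n
      using sum_le_suminf[OF sm, of "{n}"] by simp
    ultimately show ?case
      using tendsto_rabs_zero_iff by blast
  qed
  moreover have "integrable M (\<lambda>x. enn2real (F x))"
  proof (rule integrableI_bounded)
    have "(\<integral>\<^sup>+x. ennreal (norm (enn2real (F x))) \<partial>M) \<le> (\<integral>\<^sup>+x. F x \<partial>M)"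
      by (intro nn_integral_mono) (simp add: ennreal_enn2real_if)
    then show "(\<integral>\<^sup>+x. ennreal (norm (enn2real (F x))) \<partial>M) < \<infinity>"
      using fin by (rule le_less_trans)
  qed measurable
  ultimately show ?thesis
    using that r(2) by blast
qed

section \<open>Convolutions: continuity, differentiability and the L1 bound\<close>

lemma continuous_compact_support_bounded:
  fixes k :: "'a::euclidean_space \<Rightarrow> 'b::real_normed_vector"
  assumes "continuous_on UNIV k" "\<And>z. norm z \<ge> r \<Longrightarrow> k z = 0"
  obtains B where "B > 0" "\<And>z. norm (k z) \<le> B"
proof -
  have "compact (k ` cball 0 r)"
    using assms by (intro compact_continuous_image continuous_on_subset[OF assms(1)]) auto
  then have "bounded (k ` cball 0 r)" by (rule compact_imp_bounded)
  then obtain B where B: "B > 0" "\<And>z. z \<in> cball 0 r \<Longrightarrow> norm (k z) \<le> B"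
    unfolding bounded_pos by auto
  then have "norm (k z) \<le> B" for z
    using assms(2)[of z] by (cases "norm z \<le> r") auto
  then show ?thesis using that B by blast
qed

lemma lebesgue_measurable_continuous:
  fixes f :: "'a::euclidean_space \<Rightarrow> 'b::topological_space"
  assumes "continuous_on UNIV f"
  shows "f \<in> borel_measurable lebesgue"
  using assms by (metis borel_measurable_continuous_onI measurable_completion measurable_lborel2)

lemma integrable_times_bounded:
  fixes f :: "'a \<Rightarrow> real" and k :: "'a \<Rightarrow> 'b::{banach, second_countable_topology}"
  assumes "integrable M f" "k \<in> borel_measurable M" "\<And>x. norm (k x) \<le> B"
  shows "integrable M (\<lambda>x. f x *\<^sub>R k x)"
proof (rule Bochner_Integration.integrable_bound)
  show "integrable M (\<lambda>x. B * f x)" using assms by simp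
  show "(\<lambda>x. f x *\<^sub>R k x) \<in> borel_measurable M"
    using assms by measurable
  show "AE x in M. norm (f x *\<^sub>R k x) \<le> norm (B * f x)"
  proof (rule AE_I2)
    fix x
    have "norm (k x) \<le> \<bar>B\<bar>" using assms(3)[of x] by linarith
    then have "\<bar>f x\<bar> * norm (k x) \<le> \<bar>f x\<bar> * \<bar>B\<bar>"
      by (rule mult_left_mono) simp
    then show "norm (f x *\<^sub>R k x) \<le> norm (B * f x)"
      by (simp add: abs_mult mult.commute)
  qed
qed

text \<open>The kernel may be vector valued, so that the gradient of a convolution is again a
  convolution, with the gradient of the kernel.\<close>

definition conv :: "('a::euclidean_space \<Rightarrow> real) \<Rightarrow> ('a \<Rightarrow> 'b::euclidean_space) \<Rightarrow> 'a \<Rightarrow> 'b" where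
  "conv f k y = (\<integral>x. f x *\<^sub>R k (y - x) \<partial>lebesgue)"

lemma conv_integrable:
  fixes k :: "'a::euclidean_space \<Rightarrow> 'b::euclidean_space"
  assumes "integrable lebesgue f" "continuous_on UNIV k" "\<And>z. norm (k z) \<le> B"
  shows "integrable lebesgue (\<lambda>x. f x *\<^sub>R k (y - x))"
proof (rule integrable_times_bounded[OF assms(1) _ assms(3)])
  have "continuous_on UNIV (\<lambda>x. k (y - x))"
    by (intro continuous_on_compose2[OF assms(2)] continuous_intros) auto
  then show "(\<lambda>x. k (y - x)) \<in> borel_measurable lebesgue"
    by (rule lebesgue_measurable_continuous)
qed

lemma conv_continuous:
  fixes k :: "'a::euclidean_space \<Rightarrow> 'b::euclidean_space"
  assumes "integrable lebesgue f" "continuous_on UNIV k" "\<And>z. norm (k z) \<le> B"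
  shows "continuous_on UNIV (conv f k)"
  unfolding continuous_on_sequentially
proof (intro allI impI ballI, elim conjE)
  fix s and y assume s: "s \<longlonglongrightarrow> (y::'a)"
  have int: "integrable lebesgue (\<lambda>x. f x *\<^sub>R k (y - x))" for y
    by (rule conv_integrable[OF assms])
  have "(\<lambda>n. conv f k (s n)) \<longlonglongrightarrow> conv f k y"
    unfolding conv_def
  proof (rule integral_dominated_convergence[where w="\<lambda>x. B * \<bar>f x\<bar>"])
    show "integrable lebesgue (\<lambda>x. B * \<bar>f x\<bar>)" using assms by simp
    have "(\<lambda>n. k (s n - x)) \<longlonglongrightarrow> k (y - x)" for x
      using assms(2) by (intro isCont_tendsto_compose[of _ k] tendsto_intros s)
        (auto simp: continuous_on_eq_continuous_at)
    then show "AE x in lebesgue. (\<lambda>n. f x *\<^sub>R k (s n - x)) \<longlonglongrightarrow> f x *\<^sub>R k (y - x)"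
      by (intro AE_I2 tendsto_intros)
    show "AE x in lebesgue. norm (f x *\<^sub>R k (s n - x)) \<le> B * \<bar>f x\<bar>" for n
      using mult_left_mono[OF assms(3) abs_ge_zero] by (intro AE_I2) (simp add: mult.commute[of B])
  qed (use int in auto)
  then show "(conv f k \<circ> s) \<longlonglongrightarrow> conv f k y" by (simp add: o_def)
qed

lemma GDERIV_diff_bound:
  assumes "\<And>z. GDERIV k z :> k' z" "\<And>z. norm (k' z) \<le> B"
  shows "\<bar>k x - k y\<bar> \<le> B * norm (x - y)"
proof -
  have "norm (k x - k y) \<le> B * norm (x - y)"
  proof (rule differentiable_bound[of UNIV k "\<lambda>z h. h \<bullet> k' z" B])
    show "(k has_derivative (\<lambda>h. h \<bullet> k' z)) (at z within UNIV)" for z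
      using assms(1) by (simp add: gderiv_def)
    show "onorm (\<lambda>h. h \<bullet> k' z) \<le> B" for z
    proof (rule onorm_bound)
      show "0 \<le> B" using assms(2)[of z] norm_ge_zero order_trans by blast
      fix h
      have "\<bar>h \<bullet> k' z\<bar> \<le> norm h * norm (k' z)"
        by (rule Cauchy_Schwarz_ineq2)
      also have "\<dots> \<le> norm h * B"
        using assms(2) by (rule mult_left_mono) simp
      finally show "norm (h \<bullet> k' z) \<le> B * norm h"
        by (simp add: mult.commute)
    qed
  qed auto
  then show ?thesis by simp
qed

text \<open>Differentiation under the integral: the remainder of the difference quotient of
  \<open>k\<close> is at most \<open>2 * B\<close>, one \<open>B\<close> from the mean value
  inequality and one from the linear part, so \<open>\<bar>f x\<bar> * (2 * B)\<close> dominates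
  along every sequence of increments.\<close>

lemma conv_GDERIV:
  fixes k :: "'a::euclidean_space \<Rightarrow> real"
  assumes f: "integrable lebesgue f"
    and k: "\<And>z. \<bar>k z\<bar> \<le> A" and k': "\<And>z. GDERIV k z :> k' z" "continuous_on UNIV k'" "\<And>z. norm (k' z) \<le> B"
  shows "GDERIV (conv f k) y :> conv f k' y"
  unfolding gderiv_def has_derivative_iff_norm
proof
  show "bounded_linear (\<lambda>h. h \<bullet> conv f k' y)" by (rule bounded_linear_inner_left)
  have kc: "continuous_on UNIV k" by (rule GDERIV_continuous[OF k'(1)])
  have ik': "integrable lebesgue (\<lambda>x. f x *\<^sub>R k' (y - x))" for y
    by (rule conv_integrable[OF f k'(2,3)])
  have ik: "integrable lebesgue (\<lambda>x. f x * k (y - x))" for y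
    using conv_integrable[OF f kc, of A y] k by (simp only: real_norm_def real_scaleR_def)
  show "((\<lambda>z. norm (conv f k z - conv f k y - (z - y) \<bullet> conv f k' y) / norm (z - y)) \<longlongrightarrow> 0) (at y)"
  proof (subst tendsto_at_iff_sequentially, intro allI impI, unfold o_def)
    fix s assume s: "\<forall>n. s n \<in> UNIV - {y}" "s \<longlonglongrightarrow> y"
    define q where "q n x = f x * ((k (s n - x) - k (y - x) - (s n - y) \<bullet> k' (y - x)) / norm (s n - y))" for n x
    have qi: "integrable lebesgue (q n)" for n
    proof -
      have "integrable lebesgue (\<lambda>x. (f x * k (s n - x) - f x * k (y - x) - (s n - y) \<bullet> (f x *\<^sub>R k' (y - x))) / norm (s n - y))"
        using ik ik' by (intro integrable_divide Bochner_Integration.integrable_diff integrable_inner_right)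
      moreover have "(\<lambda>x. (f x * k (s n - x) - f x * k (y - x) - (s n - y) \<bullet> (f x *\<^sub>R k' (y - x))) / norm (s n - y)) = q n"
        unfolding q_def by (simp add: fun_eq_iff right_diff_distrib)
      ultimately show ?thesis by (simp only:)
    qed
    have eq: "(conv f k (s n) - conv f k y - (s n - y) \<bullet> conv f k' y) / norm (s n - y) = (\<integral>x. q n x \<partial>lebesgue)" for n
    proof -
      have "(\<integral>x. q n x \<partial>lebesgue) =
        (\<integral>x. (f x * k (s n - x) - f x * k (y - x) - (s n - y) \<bullet> (f x *\<^sub>R k' (y - x))) / norm (s n - y) \<partial>lebesgue)"
        unfolding q_def by (intro Bochner_Integration.integral_cong refl) (simp add: right_diff_distrib)
      also have "\<dots> = ((\<integral>x. f x * k (s n - x) \<partial>lebesgue) - (\<integral>x. f x * k (y - x) \<partial>lebesgue)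
          - (\<integral>x. (s n - y) \<bullet> (f x *\<^sub>R k' (y - x)) \<partial>lebesgue)) / norm (s n - y)"
        using ik ik' by (subst integral_divide_zero) (simp add: integrable_inner_right del: inner_scaleR_right)
      also have "\<dots> = (conv f k (s n) - conv f k y - (s n - y) \<bullet> conv f k' y) / norm (s n - y)"
        using ik' by (simp add: conv_def integral_inner_right del: inner_scaleR_right)
      finally show ?thesis by simp
    qed
    have "(\<lambda>n. \<integral>x. q n x \<partial>lebesgue) \<longlonglongrightarrow> (\<integral>x. 0 \<partial>(lebesgue :: 'a measure))"
    proof (rule integral_dominated_convergence[where w="\<lambda>x. \<bar>f x\<bar> * (2 * B)"])
      show "integrable lebesgue (\<lambda>x. \<bar>f x\<bar> * (2 * B))" using f by simp
      show "AE x in lebesgue. norm (q n x) \<le> \<bar>f x\<bar> * (2 * B)" for n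
      proof (rule AE_I2)
        fix x
        let ?h = "s n - y"
        have "?h \<noteq> 0" using s(1) by auto
        have "\<bar>k (s n - x) - k (y - x) - ?h \<bullet> k' (y - x)\<bar> \<le> \<bar>k (s n - x) - k (y - x)\<bar> + \<bar>?h \<bullet> k' (y - x)\<bar>"
          by linarith
        also have "\<dots> \<le> B * norm ?h + norm ?h * B"
        proof (rule add_mono)
          show "\<bar>k (s n - x) - k (y - x)\<bar> \<le> B * norm ?h"
            using GDERIV_diff_bound[OF k'(1,3), of "s n - x" "y - x"] by simp
          show "\<bar>?h \<bullet> k' (y - x)\<bar> \<le> norm ?h * B"
            by (rule order_trans[OF Cauchy_Schwarz_ineq2 mult_left_mono[OF k'(3)]]) simp
        qed
        finally have "\<bar>k (s n - x) - k (y - x) - ?h \<bullet> k' (y - x)\<bar> / norm ?h \<le> 2 * B"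
          using \<open>?h \<noteq> 0\<close> by (simp add: divide_le_eq)
        then show "norm (q n x) \<le> \<bar>f x\<bar> * (2 * B)"
          using mult_left_mono[OF _ abs_ge_zero[of "f x"]] unfolding q_def
          by (simp only: real_norm_def abs_mult abs_divide abs_norm_cancel)
      qed
      show "AE x in lebesgue. (\<lambda>n. q n x) \<longlonglongrightarrow> 0"
      proof (rule AE_I2)
        fix x
        have "((\<lambda>z. norm (k z - k (y - x) - (z - (y - x)) \<bullet> k' (y - x)) / norm (z - (y - x))) \<longlongrightarrow> 0) (at (y - x))"
          using k'(1)[of "y - x"] unfolding gderiv_def has_derivative_iff_norm by simp
        moreover have "filterlim (\<lambda>n. s n - x) (at (y - x)) sequentially"
          unfolding filterlim_at using s by (auto intro!: tendsto_intros)
        ultimately have "(\<lambda>n. norm (k (s n - x) - k (y - x) - (s n - x - (y - x)) \<bullet> k' (y - x)) / norm (s n - x - (y - x))) \<longlonglongrightarrow> 0"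
          by (rule filterlim_compose)
        then have "(\<lambda>n. \<bar>(k (s n - x) - k (y - x) - (s n - y) \<bullet> k' (y - x)) / norm (s n - y)\<bar>) \<longlonglongrightarrow> 0"
          by simp
        then have "(\<lambda>n. (k (s n - x) - k (y - x) - (s n - y) \<bullet> k' (y - x)) / norm (s n - y)) \<longlonglongrightarrow> 0"
          by (rule tendsto_rabs_zero_cancel)
        then have "(\<lambda>n. f x * ((k (s n - x) - k (y - x) - (s n - y) \<bullet> k' (y - x)) / norm (s n - y))) \<longlonglongrightarrow> f x * 0"
          by (rule tendsto_mult_left)
        then show "(\<lambda>n. q n x) \<longlonglongrightarrow> 0" by (simp add: q_def)
      qed
    qed (use qi in auto)
    then show "(\<lambda>n. norm (conv f k (s n) - conv f k y - (s n - y) \<bullet> conv f k' y) / norm (s n - y)) \<longlonglongrightarrow> 0"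
      using tendsto_rabs_zero[of "\<lambda>n. \<integral>x. q n x \<partial>lebesgue"] eq[symmetric] by simp
  qed
qed

lemma nn_integral_lborel_translate:
  fixes g :: "'a::euclidean_space \<Rightarrow> ennreal"
  assumes [measurable]: "g \<in> borel_measurable borel"
  shows "(\<integral>\<^sup>+x. g (x - c) \<partial>lborel) = (\<integral>\<^sup>+x. g x \<partial>lborel)"
proof -
  have "(\<integral>\<^sup>+x. g x \<partial>lborel) = (\<integral>\<^sup>+x. g x \<partial>distr lborel borel ((+) (- c)))"
    by (simp add: lborel_distr_plus)
  also have "\<dots> = (\<integral>\<^sup>+x. g (x - c) \<partial>lborel)"
    by (subst nn_integral_distr) auto
  finally show ?thesis by simp
qed

text \<open>Tonelli together with translation invariance. Joint measurability of the integrand on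
  the product of \<open>lborel\<close> with itself calls for a Borel function, hence the
  representative \<open>g\<close> of \<open>f\<close>.\<close>

lemma conv_L1_bound:
  fixes f k :: "'a::euclidean_space \<Rightarrow> real"
  assumes f: "integrable lebesgue f" and k: "continuous_on UNIV k" "\<And>z. \<bar>k z\<bar> \<le> B"
    "\<And>z. k z \<ge> 0" "(\<integral>\<^sup>+z. ennreal (k z) \<partial>lborel) \<le> 1"
  shows "(\<integral>\<^sup>+y. ennreal \<bar>conv f k y\<bar> \<partial>lebesgue) \<le> (\<integral>\<^sup>+x. ennreal \<bar>f x\<bar> \<partial>lebesgue)"
proof -
  obtain g where g[measurable]: "g \<in> borel_measurable borel" and fg: "AE x in lborel. f x = g x"
    using completion_ex_borel_measurable_real[OF borel_measurable_integrable[OF f]] by auto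
  have [measurable]: "k \<in> borel_measurable borel"
    by (rule borel_measurable_continuous_onI[OF k(1)])
  have "ennreal \<bar>conv f k y\<bar> \<le> (\<integral>\<^sup>+x. ennreal (\<bar>g x\<bar> * k (y - x)) \<partial>lborel)" for y
  proof -
    have i: "integrable lebesgue (\<lambda>x. f x * k (y - x))"
      using conv_integrable[OF f k(1), of B y] k(2) by simp
    have "ennreal \<bar>conv f k y\<bar> \<le> (\<integral>\<^sup>+x. ennreal (norm (f x * k (y - x))) \<partial>lebesgue)"
      unfolding conv_def using integral_norm_bound_ennreal[OF i] by simp
    also have "\<dots> = (\<integral>\<^sup>+x. ennreal (norm (f x * k (y - x))) \<partial>lborel)"
      by (rule nn_integral_completion)
    also have "\<dots> = (\<integral>\<^sup>+x. ennreal (\<bar>g x\<bar> * k (y - x)) \<partial>lborel)"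
      using fg by (intro nn_integral_cong_AE) (auto simp: abs_mult k(3))
    finally show ?thesis .
  qed
  then have "(\<integral>\<^sup>+y. ennreal \<bar>conv f k y\<bar> \<partial>lborel) \<le> (\<integral>\<^sup>+y. \<integral>\<^sup>+x. ennreal (\<bar>g x\<bar> * k (y - x)) \<partial>lborel \<partial>lborel)"
    by (intro nn_integral_mono) auto
  also have "\<dots> = (\<integral>\<^sup>+x. \<integral>\<^sup>+y. ennreal (\<bar>g x\<bar> * k (y - x)) \<partial>lborel \<partial>lborel)"
    by (rule lborel_pair.Fubini') measurable
  also have "\<dots> = (\<integral>\<^sup>+x. ennreal \<bar>g x\<bar> * (\<integral>\<^sup>+y. ennreal (k (y - x)) \<partial>lborel) \<partial>lborel)"
    using k(3) by (simp add: ennreal_mult nn_integral_cmult)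
  also have "\<dots> = (\<integral>\<^sup>+x. ennreal \<bar>g x\<bar> * (\<integral>\<^sup>+y. ennreal (k y) \<partial>lborel) \<partial>lborel)"
    by (subst nn_integral_lborel_translate) auto
  also have "\<dots> \<le> (\<integral>\<^sup>+x. ennreal \<bar>g x\<bar> * 1 \<partial>lborel)"
    using k(4) by (intro nn_integral_mono mult_left_mono) auto
  also have "\<dots> = (\<integral>\<^sup>+x. ennreal \<bar>f x\<bar> \<partial>lborel)"
    using fg by (intro nn_integral_cong_AE) auto
  finally show ?thesis by (simp add: nn_integral_completion)
qed

section \<open>Continuous approximation in L1 and approximate identities\<close>

lemma integrable_compact_support:
  fixes k :: "'a::euclidean_space \<Rightarrow> 'b::euclidean_space"
  assumes "continuous_on UNIV k" "\<And>z. norm z \<ge> r \<Longrightarrow> k z = 0"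
  shows "integrable lborel k" "integrable lebesgue k"
proof -
  have "integrable lborel (\<lambda>x. indicator (cball 0 r) x *\<^sub>R k x)"
    by (rule borel_integrable_compact) (auto intro: continuous_on_subset[OF assms(1)])
  moreover have "(\<lambda>x. indicator (cball 0 r) x *\<^sub>R k x) = k"
    using assms(2) by (auto simp: fun_eq_iff indicator_def)
  ultimately show "integrable lborel k" by simp
  then show "integrable lebesgue k"
    by (simp add: borel_measurable_continuous_onI[OF assms(1)] integrable_completion)
qed

definition ramp :: "real \<Rightarrow> 'a::euclidean_space \<Rightarrow> real" where
  "ramp R x = max 0 (min 1 (R + 1 - norm x))"

text \<open>A measurable function is an almost everywhere limit of continuous ones, but without
  domination. Therefore \<open>h k\<close> first cuts off and clips \<open>f\<close>, at an error
  controlled by \<open>2 * \<bar>f x\<bar>\<close>. The same \<open>h k\<close> is then applied to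
  the continuous approximants, which keeps them continuous and bounds them by \<open>k\<close> on a
  fixed ball. For this the value \<open>t\<close> and the point \<open>x\<close> are separate
  arguments of \<open>h\<close>.\<close>

lemma L1_approx_continuous:
  fixes f :: "'a::euclidean_space \<Rightarrow> real"
  assumes f: "integrable lebesgue f" and "e > 0"
  obtains g r where "continuous_on UNIV g" "\<And>z. norm z \<ge> r \<Longrightarrow> g z = 0"
    "(\<integral>x. \<bar>f x - g x\<bar> \<partial>lebesgue) < e"
proof -
  have fm[measurable]: "f \<in> borel_measurable lebesgue" using f by auto
  have "f measurable_on UNIV"
    by (rule lebesgue_measurable_imp_measurable_on[OF fm]) auto
  then obtain N g where N: "negligible N" and g: "\<And>n. continuous_on UNIV (g n)"
    "\<And>x. x \<notin> N \<Longrightarrow> (\<lambda>n. g n x) \<longlonglongrightarrow> f x"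
    by (auto simp: measurable_on_def)
  have ae: "AE x in lebesgue. x \<notin> N"
    using N AE_not_in negligible_iff_null_sets by blast
  define clip where "clip R t = max (- R) (min R t)" for R t :: real
  define h where "h k t x = ramp (real k) x * clip (real k) t" for k t and x :: 'a
  have hf[measurable]: "(\<lambda>x. h k (f x) x) \<in> borel_measurable lebesgue" for k
  proof -
    have [measurable]: "ramp (real k) \<in> borel_measurable lebesgue"
      unfolding ramp_def by (rule lebesgue_measurable_continuous) (intro continuous_intros)
    show ?thesis unfolding h_def clip_def by measurable
  qed
  have hb: "\<bar>h k t x\<bar> \<le> \<bar>t\<bar>" for k t x
  proof -
    have "\<bar>ramp k x\<bar> * \<bar>clip k t\<bar> \<le> 1 * \<bar>t\<bar>"
      by (intro mult_mono) (auto simp: ramp_def clip_def)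
    then show ?thesis by (simp add: h_def abs_mult)
  qed
  have hconv: "(\<lambda>k. h k t x) \<longlonglongrightarrow> t" for t x
  proof -
    obtain K :: nat where K: "real K \<ge> \<bar>t\<bar> + norm x" using real_arch_simple by blast
    have "h k t x = t" if "k \<ge> K" for k
    proof -
      have "real k \<ge> real K" using that by simp
      then have "\<bar>t\<bar> \<le> real k" "norm x \<le> real k"
        using K norm_ge_zero[of x] abs_ge_zero[of t] by linarith+
      then show ?thesis by (auto simp: h_def ramp_def clip_def)
    qed
    then show ?thesis by (intro tendsto_eventually) (auto simp: eventually_sequentially)
  qed
  have "(\<lambda>k. \<integral>x. \<bar>f x - h k (f x) x\<bar> \<partial>lebesgue) \<longlonglongrightarrow> (\<integral>x. 0 \<partial>(lebesgue :: 'a measure))"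
  proof (rule integral_dominated_convergence[where w="\<lambda>x. 2 * \<bar>f x\<bar>"])
    show "AE x in lebesgue. norm \<bar>f x - h k (f x) x\<bar> \<le> 2 * \<bar>f x\<bar>" for k
    proof (rule AE_I2)
      show "norm \<bar>f x - h k (f x) x\<bar> \<le> 2 * \<bar>f x\<bar>" for x
        using hb[of k "f x" x] by auto
    qed
    show "AE x in lebesgue. (\<lambda>k. \<bar>f x - h k (f x) x\<bar>) \<longlonglongrightarrow> 0"
    proof (rule AE_I2)
      show "(\<lambda>k. \<bar>f x - h k (f x) x\<bar>) \<longlonglongrightarrow> 0" for x
        using tendsto_rabs_zero[OF LIM_zero[OF hconv[of "f x" x]]] by (simp add: abs_minus_commute)
    qed
  qed (use f in auto)
  then have "\<forall>\<^sub>F k in sequentially. (\<integral>x. \<bar>f x - h k (f x) x\<bar> \<partial>lebesgue) < e / 2"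
    using \<open>e > 0\<close> by (intro order_tendstoD) auto
  then obtain k where k: "(\<integral>x. \<bar>f x - h k (f x) x\<bar> \<partial>lebesgue) < e / 2"
    by (auto simp: eventually_sequentially)
  have gc: "continuous_on UNIV (\<lambda>x. h k (g n x) x)" for n
    unfolding h_def clip_def ramp_def by (intro continuous_intros g)
  have g0: "h k t x = 0" if "norm x \<ge> real k + 1" for t x
    using that by (simp add: h_def ramp_def)
  have hkb: "\<bar>h k t x\<bar> \<le> real k * indicator (cball 0 (real k + 1)) x" for t x
  proof (cases "norm x \<le> real k + 1")
    case True
    have "\<bar>ramp k x\<bar> * \<bar>clip k t\<bar> \<le> 1 * real k"
      by (intro mult_mono) (auto simp: ramp_def clip_def)
    then show ?thesis using True by (simp add: h_def abs_mult)
  qed (use g0 in simp)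
  have [measurable]: "(\<lambda>x. h k (g n x) x) \<in> borel_measurable lebesgue" for n
    by (rule lebesgue_measurable_continuous[OF gc])
  have "(\<lambda>n. \<integral>x. \<bar>h k (f x) x - h k (g n x) x\<bar> \<partial>lebesgue) \<longlonglongrightarrow> (\<integral>x. 0 \<partial>(lebesgue :: 'a measure))"
  proof (rule integral_dominated_convergence[where w="\<lambda>x. 2 * (real k * indicator (cball 0 (real k + 1)) x)"])
    show "integrable lebesgue (\<lambda>x::'a. 2 * (real k * indicator (cball 0 (real k + 1)) x))"
      by (intro integrable_mult_right integrable_real_indicator)
        (use emeasure_lborel_cball_finite[of 0 "real k + 1"] in auto)
    show "AE x in lebesgue. norm \<bar>h k (f x) x - h k (g n x) x\<bar> \<le> 2 * (real k * indicator (cball 0 (real k + 1)) x)" for n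
    proof (rule AE_I2)
      show "norm \<bar>h k (f x) x - h k (g n x) x\<bar> \<le> 2 * (real k * indicator (cball 0 (real k + 1)) x)" for x
        using hkb[of "f x" x] hkb[of "g n x" x] by auto
    qed
    show "AE x in lebesgue. (\<lambda>n. \<bar>h k (f x) x - h k (g n x) x\<bar>) \<longlonglongrightarrow> 0"
      using ae
    proof eventually_elim
      case (elim x)
      have "(\<lambda>n. h k (g n x) x) \<longlonglongrightarrow> h k (f x) x"
        unfolding h_def clip_def by (intro tendsto_intros g elim)
      then have "(\<lambda>n. \<bar>h k (f x) x - h k (g n x) x\<bar>) \<longlonglongrightarrow> \<bar>h k (f x) x - h k (f x) x\<bar>"
        by (intro tendsto_intros)
      then show ?case by simp
    qed
  qed auto
  then have "\<forall>\<^sub>F n in sequentially. (\<integral>x. \<bar>h k (f x) x - h k (g n x) x\<bar> \<partial>lebesgue) < e / 2"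
    using \<open>e > 0\<close> by (intro order_tendstoD) auto
  then obtain n where n: "(\<integral>x. \<bar>h k (f x) x - h k (g n x) x\<bar> \<partial>lebesgue) < e / 2"
    by (auto simp: eventually_sequentially)
  have i1: "integrable lebesgue (\<lambda>x. h k (f x) x)"
    by (rule Bochner_Integration.integrable_bound[OF f]) (use hb in auto)
  have i2: "integrable lebesgue (\<lambda>x. h k (g n x) x)"
    by (rule integrable_compact_support(2)[OF gc g0])
  have "(\<integral>x. \<bar>f x - h k (g n x) x\<bar> \<partial>lebesgue) \<le>
      (\<integral>x. \<bar>f x - h k (f x) x\<bar> + \<bar>h k (f x) x - h k (g n x) x\<bar> \<partial>lebesgue)"
    using f i1 i2 by (intro integral_mono) auto
  also have "\<dots> < e"
    using k n f i1 i2 by (subst Bochner_Integration.integral_add) auto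
  finally show ?thesis
    using that[OF gc g0] by blast
qed

definition kern :: "real \<Rightarrow> 'a::euclidean_space \<Rightarrow> real" where
  "kern r z = flat 0 (r\<^sup>2 - (norm z)\<^sup>2) / (\<integral>z. flat 0 (r\<^sup>2 - (norm (z::'a))\<^sup>2) \<partial>lborel)"

lemma flat_continuous: "continuous_on S (flat j)"
  by (meson DERIV_continuous_on flat_DERIV has_field_derivative_at_within)

lemma kern_facts:
  assumes r: "r > 0"
  shows kern_continuous: "continuous_on UNIV (kern r :: 'a::euclidean_space \<Rightarrow> real)"
    and kern_nonneg: "\<And>z::'a. kern r z \<ge> 0"
    and kern_eq_0: "\<And>z::'a. norm z \<ge> r \<Longrightarrow> kern r z = 0"
    and kern_nn_integral: "(\<integral>\<^sup>+z. ennreal (kern r (z::'a)) \<partial>lborel) = 1"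
proof -
  let ?k = "\<lambda>z::'a. flat 0 (r\<^sup>2 - (norm z)\<^sup>2)"
  have kc: "continuous_on UNIV ?k"
    by (intro continuous_on_compose2[OF flat_continuous[of UNIV]] continuous_intros) auto
  have k0: "?k z = 0" if "norm z \<ge> r" for z
    using power_mono[OF that less_imp_le[OF r], of 2] unfolding flat_def by (intro if_not_P) linarith
  have i: "integrable lborel ?k"
    by (rule integrable_compact_support(1)[OF kc k0])
  have "(\<integral>z. ?k z \<partial>lborel) \<noteq> 0"
  proof
    assume "(\<integral>z. ?k z \<partial>lborel) = 0"
    then have "AE z in lborel. ?k z = 0"
      by (subst (asm) integral_nonneg_eq_0_iff_AE[OF i]) (auto simp: flat_nonneg)
    moreover have "?k z \<noteq> 0" if "z \<in> ball 0 r" for z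
    proof -
      have "(norm z)\<^sup>2 < r\<^sup>2" using that r by (intro power_strict_mono) auto
      then show ?thesis by (simp add: flat_def)
    qed
    ultimately have "AE z in lborel. z \<notin> ball (0::'a) r" by auto
    then have "emeasure lborel (ball (0::'a) r) = 0"
      by (subst (asm) AE_iff_measurable[of "ball 0 r"]) auto
    then have "emeasure lebesgue (ball (0::'a) r) = 0" by simp
    then have "negligible (ball (0::'a) r)"
      by (simp add: negligible_iff_null_sets null_sets_def)
    then show False
      using open_not_negligible[of "ball (0::'a) r"] r by auto
  qed
  moreover have "(\<integral>z. ?k z \<partial>lborel) \<ge> 0"
    by (intro Bochner_Integration.integral_nonneg) (auto simp: flat_nonneg)
  ultimately have pos: "(\<integral>z. ?k z \<partial>lborel) > 0" by linarith
  show "continuous_on UNIV (kern r :: 'a \<Rightarrow> real)"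
    unfolding kern_def using pos by (intro continuous_intros kc) auto
  show nn: "kern r z \<ge> 0" for z :: 'a
    unfolding kern_def using pos by (intro divide_nonneg_pos flat_nonneg) auto
  show "kern r z = 0" if "norm z \<ge> r" for z :: 'a
    unfolding kern_def using k0[OF that] by simp
  have I: "(\<integral>z. kern r (z::'a) \<partial>lborel) = 1"
    unfolding kern_def using pos by simp
  have "integrable lborel (kern r :: 'a \<Rightarrow> real)"
    unfolding kern_def using i by simp
  then show "(\<integral>\<^sup>+z. ennreal (kern r (z::'a)) \<partial>lborel) = 1"
    using I nn by (subst nn_integral_eq_integral) auto
qed

lemma kern_bounded:
  assumes "r > 0"
  obtains B where "B > 0" "\<And>z::'a::euclidean_space. \<bar>kern r z\<bar> \<le> B"
proof -
  obtain B where "B > 0" "\<And>z::'a. norm (kern r z) \<le> B"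
    using continuous_compact_support_bounded[OF kern_continuous[OF assms] kern_eq_0[OF assms]] by blast
  then show ?thesis using that[of B] by simp
qed


lemma conv_kern_measurable [measurable]:
  assumes "integrable lebesgue f" "r > 0"
  shows "conv f (kern r) \<in> borel_measurable lebesgue"
proof -
  obtain B where "\<And>z::'a. \<bar>kern r z\<bar> \<le> B" using kern_bounded[OF assms(2)] by blast
  then show ?thesis
    by (intro lebesgue_measurable_continuous conv_continuous[OF assms(1) kern_continuous[OF assms(2)]])
      (auto simp: real_norm_def)
qed

lemma conv_kern_integrable:
  assumes "integrable lebesgue f" "r > 0"
  shows "integrable lebesgue (\<lambda>x. f x * kern r (y - x))"
proof -
  obtain B where "\<And>z::'a. \<bar>kern r z\<bar> \<le> B" using kern_bounded[OF assms(2)] by blast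
  then show ?thesis
    using conv_integrable[OF assms(1) kern_continuous[OF assms(2)], of B y] by simp
qed

lemma integrable_conv_kern:
  fixes f :: "'a::euclidean_space \<Rightarrow> real"
  assumes f: "integrable lebesgue f" and r: "r > 0"
  shows "integrable lebesgue (conv f (kern r))"
    and "(\<integral>y. \<bar>conv f (kern r) y\<bar> \<partial>lebesgue) \<le> (\<integral>y. \<bar>f y\<bar> \<partial>lebesgue)"
proof -
  obtain B where "\<And>z::'a. \<bar>kern r z\<bar> \<le> B" using kern_bounded[OF r] by blast
  then have *: "(\<integral>\<^sup>+y. ennreal \<bar>conv f (kern r) y\<bar> \<partial>lebesgue) \<le> (\<integral>\<^sup>+x. ennreal \<bar>f x\<bar> \<partial>lebesgue)"
    by (intro conv_L1_bound[OF f kern_continuous[OF r], of B])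
      (auto simp: kern_nonneg[OF r] kern_nn_integral[OF r])
  also have eq: "\<dots> = ennreal (\<integral>x. \<bar>f x\<bar> \<partial>lebesgue)"
    using f by (intro nn_integral_eq_integral) auto
  also have "\<dots> < \<infinity>" by simp
  finally have fin: "(\<integral>\<^sup>+y. ennreal (norm (conv f (kern r) y)) \<partial>lebesgue) < \<infinity>" by simp
  show i: "integrable lebesgue (conv f (kern r))"
    by (rule integrableI_bounded[OF conv_kern_measurable[OF f r] fin])
  have "ennreal (\<integral>y. \<bar>conv f (kern r) y\<bar> \<partial>lebesgue) = (\<integral>\<^sup>+y. ennreal \<bar>conv f (kern r) y\<bar> \<partial>lebesgue)"
    using i by (intro nn_integral_eq_integral[symmetric]) auto
  with * eq have "ennreal (\<integral>y. \<bar>conv f (kern r) y\<bar> \<partial>lebesgue) \<le> ennreal (\<integral>x. \<bar>f x\<bar> \<partial>lebesgue)"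
    by simp
  then show "(\<integral>y. \<bar>conv f (kern r) y\<bar> \<partial>lebesgue) \<le> (\<integral>y. \<bar>f y\<bar> \<partial>lebesgue)"
    by (subst (asm) ennreal_le_iff) (auto intro: Bochner_Integration.integral_nonneg)
qed

lemma conv_diff:
  assumes "integrable lebesgue f" "integrable lebesgue g" "r > 0"
  shows "conv (\<lambda>x. f x - g x) (kern r) y = conv f (kern r) y - conv g (kern r) y"
  using conv_kern_integrable[OF assms(1,3), of y] conv_kern_integrable[OF assms(2,3), of y]
  by (simp add: conv_def left_diff_distrib)

lemma kern_reflected_integral:
  fixes y :: "'a::euclidean_space"
  assumes r: "r > 0"
  shows "integrable lebesgue (\<lambda>x. kern r (y - x))" "(\<integral>x. kern r (y - x) \<partial>lebesgue) = 1"
proof -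
  have c: "continuous_on UNIV (\<lambda>x. kern r (y - x))"
    by (intro continuous_on_compose2[OF kern_continuous[OF r]] continuous_intros) auto
  have [measurable]: "(kern r :: 'a \<Rightarrow> real) \<in> borel_measurable borel"
    by (rule borel_measurable_continuous_onI[OF kern_continuous[OF r]])
  have z: "kern r (y - x) = 0" if "norm x \<ge> norm y + r" for x
  proof -
    have "norm x - norm y \<le> norm (y - x)" by (metis norm_minus_commute norm_triangle_ineq2)
    then show ?thesis using that by (intro kern_eq_0[OF r]) linarith
  qed
  show i: "integrable lebesgue (\<lambda>x. kern r (y - x))"
    by (rule integrable_compact_support(2)[OF c z])
  have "(\<integral>\<^sup>+x. ennreal (kern r (y - x)) \<partial>lebesgue) = (\<integral>\<^sup>+x. ennreal (kern r (x - y)) \<partial>lborel)"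
    by (simp add: nn_integral_completion kern_def norm_minus_commute)
  also have "\<dots> = 1"
    using kern_nn_integral[OF r] by (subst nn_integral_lborel_translate) auto
  finally have "ennreal (\<integral>x. kern r (y - x) \<partial>lebesgue) = 1"
    using i kern_nonneg[OF r] by (subst (asm) nn_integral_eq_integral) auto
  then show "(\<integral>x. kern r (y - x) \<partial>lebesgue) = 1"
    by simp
qed

lemma conv_kern_L1_continuous:
  fixes g :: "'a::euclidean_space \<Rightarrow> real"
  assumes g: "continuous_on UNIV g" "\<And>z. norm z \<ge> R \<Longrightarrow> g z = 0"
    and s: "\<And>n. 0 < s n" "s \<longlonglongrightarrow> 0" "\<And>n. s n \<le> 1"
  shows "(\<lambda>n. \<integral>x. \<bar>conv g (kern (s n)) x - g x\<bar> \<partial>lebesgue) \<longlonglongrightarrow> 0"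
proof -
  have gi: "integrable lebesgue g" by (rule integrable_compact_support(2)[OF g])
  obtain B where B: "B > 0" "\<And>z. norm (g z) \<le> B"
    using continuous_compact_support_bounded[OF g] by blast
  \<comment> \<open>A local average differs from the value by at most the local oscillation. This is
    used with three values of \<open>e\<close>: \<open>2 * B\<close> for domination,
    \<open>0\<close> away from the support, and half the tolerance for convergence.\<close>
  have diff: "\<bar>conv g (kern r) y - g y\<bar> \<le> e"
    if r: "r > 0" and e: "\<And>x. norm (y - x) < r \<Longrightarrow> \<bar>g x - g y\<bar> \<le> e" for y r e
  proof -
    have i: "integrable lebesgue (\<lambda>x. g x * kern r (y - x))" "integrable lebesgue (\<lambda>x. g y * kern r (y - x))"
      using conv_kern_integrable[OF gi r] kern_reflected_integral(1)[OF r] by auto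
    have "conv g (kern r) y - g y = (\<integral>x. g x * kern r (y - x) \<partial>lebesgue) - (\<integral>x. g y * kern r (y - x) \<partial>lebesgue)"
      using kern_reflected_integral(2)[OF r, of y] by (simp add: conv_def)
    also have "\<dots> = (\<integral>x. g x * kern r (y - x) - g y * kern r (y - x) \<partial>lebesgue)"
      by (rule Bochner_Integration.integral_diff[symmetric, OF i])
    also have "\<bar>\<dots>\<bar> \<le> (\<integral>x. \<bar>g x * kern r (y - x) - g y * kern r (y - x)\<bar> \<partial>lebesgue)"
      unfolding real_norm_def[symmetric] by (rule integral_norm_bound)
    also have "\<dots> \<le> (\<integral>x. e * kern r (y - x) \<partial>lebesgue)"
    proof (rule integral_mono)
      show "integrable lebesgue (\<lambda>x. e * kern r (y - x))"
        using kern_reflected_integral(1)[OF r, of y] by simp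
      show "\<bar>g x * kern r (y - x) - g y * kern r (y - x)\<bar> \<le> e * kern r (y - x)" for x
      proof (cases "norm (y - x) < r")
        case True
        then show ?thesis
          using mult_right_mono[OF e[OF True] kern_nonneg[OF r, of "y - x"]]
          by (simp add: left_diff_distrib[symmetric] abs_mult kern_nonneg[OF r])
      qed (simp add: kern_eq_0[OF r])
    qed (use i in auto)
    also have "\<dots> = e" using kern_reflected_integral(2)[OF r, of y] by simp
    finally show ?thesis .
  qed
  have "(\<lambda>n. \<integral>x. \<bar>conv g (kern (s n)) x - g x\<bar> \<partial>lebesgue) \<longlonglongrightarrow> (\<integral>x. 0 \<partial>(lebesgue :: 'a measure))"
  proof -
    show ?thesis
    proof (rule integral_dominated_convergence[where w="\<lambda>x. 2 * B * indicator (cball 0 (\<bar>R\<bar> + 1)) x"])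
      show "integrable lebesgue (\<lambda>x::'a. 2 * B * indicator (cball 0 (\<bar>R\<bar> + 1)) x)"
        by (intro integrable_mult_right integrable_real_indicator)
          (use emeasure_lborel_cball_finite[of 0 "\<bar>R\<bar> + 1"] in auto)
      show "(\<lambda>x. \<bar>conv g (kern (s n)) x - g x\<bar>) \<in> borel_measurable lebesgue" for n
        using conv_kern_measurable[OF gi s(1)] gi by measurable
      show "AE x in lebesgue. norm \<bar>conv g (kern (s n)) x - g x\<bar> \<le> 2 * B * indicator (cball 0 (\<bar>R\<bar> + 1)) x" for n
      proof (rule AE_I2)
        fix y
        show "norm \<bar>conv g (kern (s n)) y - g y\<bar> \<le> 2 * B * indicator (cball 0 (\<bar>R\<bar> + 1)) y"
        proof (cases "y \<in> cball 0 (\<bar>R\<bar> + 1)")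
          case True
          have "\<bar>conv g (kern (s n)) y - g y\<bar> \<le> 2 * B"
          proof (rule diff[OF s(1)])
            show "\<bar>g x - g y\<bar> \<le> 2 * B" for x using B(2)[of x] B(2)[of y] by simp
          qed
          then show ?thesis using True by simp
        next
          case False
          have "\<bar>conv g (kern (s n)) y - g y\<bar> \<le> 0"
          proof (rule diff[OF s(1)])
            fix x assume "norm (y - x) < s n"
            moreover have "norm y - norm x \<le> norm (y - x)" by (rule norm_triangle_ineq2)
            ultimately have "norm x \<ge> R" "norm y \<ge> R"
              using False s(3)[of n] s(1)[of n] by (auto simp: dist_norm)
            then show "\<bar>g x - g y\<bar> \<le> 0" using g(2) by simp
          qed
          then show ?thesis using False by simp
        qed
      qed
      show "AE x in lebesgue. (\<lambda>n. \<bar>conv g (kern (s n)) x - g x\<bar>) \<longlonglongrightarrow> 0"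
      proof (rule AE_I2)
        fix y
        have "(\<lambda>n. conv g (kern (s n)) y - g y) \<longlonglongrightarrow> 0"
        proof (rule LIMSEQ_I)
          fix e :: real assume "e > 0"
          then obtain d where d: "d > 0" "\<And>x. dist x y < d \<Longrightarrow> dist (g x) (g y) < e / 2"
            using g(1)[unfolded continuous_on_iff, THEN bspec, of y, THEN spec, of "e / 2"] by auto
          obtain N where N: "\<And>n. n \<ge> N \<Longrightarrow> s n < d"
            using order_tendstoD(2)[OF s(2) d(1)] by (auto simp: eventually_sequentially)
          have "norm (conv g (kern (s n)) y - g y - 0) < e" if "n \<ge> N" for n
          proof -
            have "\<bar>conv g (kern (s n)) y - g y\<bar> \<le> e / 2"
            proof (rule diff[OF s(1)])
              fix x assume "norm (y - x) < s n"
              then have "dist x y < d" using N[OF that] by (simp add: dist_norm norm_minus_commute)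
              then show "\<bar>g x - g y\<bar> \<le> e / 2" using d(2)[of x] by (simp add: dist_real_def)
            qed
            then show ?thesis using \<open>e > 0\<close> by simp
          qed
          then show "\<exists>no. \<forall>n\<ge>no. norm (conv g (kern (s n)) y - g y - 0) < e" by blast
        qed
        then show "(\<lambda>n. \<bar>conv g (kern (s n)) y - g y\<bar>) \<longlonglongrightarrow> 0"
          by (rule tendsto_rabs_zero)
      qed
    qed auto
  qed
  then show ?thesis by simp
qed

text \<open>Convolution contracts the L1 norm, so approximating \<open>f\<close> by a continuous
  \<open>g\<close> costs two thirds of the error, and the continuous case the last third.\<close>

lemma conv_kern_L1_tendsto:
  fixes f :: "'a::euclidean_space \<Rightarrow> real"
  assumes f: "integrable lebesgue f" and s: "\<And>n. 0 < s n" "s \<longlonglongrightarrow> 0" "\<And>n. s n \<le> 1"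
  shows "(\<lambda>n. \<integral>x. \<bar>conv f (kern (s n)) x - f x\<bar> \<partial>lebesgue) \<longlonglongrightarrow> 0"
proof (rule LIMSEQ_I)
  fix e :: real assume "e > 0"
  then obtain g R where g: "continuous_on UNIV g" "\<And>z. norm z \<ge> R \<Longrightarrow> g z = 0"
    and fg: "(\<integral>x. \<bar>f x - g x\<bar> \<partial>lebesgue) < e / 3"
    using L1_approx_continuous[OF f, of "e / 3"] by (auto simp: divide_pos_pos)
  have gi: "integrable lebesgue g" by (rule integrable_compact_support(2)[OF g])
  have fgi: "integrable lebesgue (\<lambda>x. f x - g x)" using f gi by simp
  have "\<forall>\<^sub>F n in sequentially. (\<integral>x. \<bar>conv g (kern (s n)) x - g x\<bar> \<partial>lebesgue) < e / 3"
    by (rule order_tendstoD(2)[OF conv_kern_L1_continuous[OF g s]]) (use \<open>e > 0\<close> in auto)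
  then obtain N where N: "\<And>n. n \<ge> N \<Longrightarrow> (\<integral>x. \<bar>conv g (kern (s n)) x - g x\<bar> \<partial>lebesgue) < e / 3"
    by (auto simp: eventually_sequentially)
  have "norm ((\<integral>x. \<bar>conv f (kern (s n)) x - f x\<bar> \<partial>lebesgue) - 0) < e" if "n \<ge> N" for n
  proof -
    note ci = integrable_conv_kern(1)[OF f s(1)] integrable_conv_kern(1)[OF gi s(1)] integrable_conv_kern(1)[OF fgi s(1)]
    have "(\<integral>x. \<bar>conv f (kern (s n)) x - f x\<bar> \<partial>lebesgue) \<le>
      (\<integral>x. \<bar>conv (\<lambda>x. f x - g x) (kern (s n)) x\<bar> + \<bar>conv g (kern (s n)) x - g x\<bar> + \<bar>f x - g x\<bar> \<partial>lebesgue)"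
      using f gi ci by (intro integral_mono) (auto simp: conv_diff[OF f gi s(1)])
    also have "\<dots> = (\<integral>x. \<bar>conv (\<lambda>x. f x - g x) (kern (s n)) x\<bar> \<partial>lebesgue)
        + (\<integral>x. \<bar>conv g (kern (s n)) x - g x\<bar> \<partial>lebesgue) + (\<integral>x. \<bar>f x - g x\<bar> \<partial>lebesgue)"
      using f gi ci by simp
    also have "\<dots> < e"
      using integrable_conv_kern(2)[OF fgi s(1)[of n]] N[OF that] fg by linarith
    finally show ?thesis
      by (simp add: Bochner_Integration.integral_nonneg)
  qed
  then show "\<exists>no. \<forall>n\<ge>no. norm ((\<integral>x. \<bar>conv f (kern (s n)) x - f x\<bar> \<partial>lebesgue) - 0) < e" by blast
qed

text \<open>The maximal function of an L1 function need not be integrable, so a majorant exists only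
  along suitable scales. Extracting the subsequence from the sum of all errors gives one sequence
  and one majorant for the whole family \<open>F\<close>.\<close>

lemma mollifier_sequence:
  fixes F :: "('a::euclidean_space \<Rightarrow> real) set"
  assumes F: "finite F" "\<And>f. f \<in> F \<Longrightarrow> integrable lebesgue f"
  obtains s G where "\<And>n. 0 < s n" "\<And>n. s n \<le> 1" "integrable lebesgue G"
    "AE x in lebesgue. \<forall>f\<in>F. (\<lambda>n. conv f (kern (s n)) x) \<longlonglongrightarrow> f x"
    "AE x in lebesgue. \<forall>f\<in>F. \<forall>n. \<bar>conv f (kern (s n)) x\<bar> \<le> G x"
proof -
  define s where "s n = 1 / real (Suc n)" for n
  have s: "\<And>n. 0 < s n" "s \<longlonglongrightarrow> 0" "\<And>n. s n \<le> 1"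
    unfolding s_def using LIMSEQ_inverse_real_of_nat by (auto simp: inverse_eq_divide)
  define D where "D n x = (\<Sum>f\<in>F. \<bar>conv f (kern (s n)) x - f x\<bar>)" for n x
  note ci = integrable_conv_kern(1)[OF F(2) s(1)]
  have Di: "integrable lebesgue (D n)" for n
    unfolding D_def using ci F(2) by (intro Bochner_Integration.integrable_sum) auto
  have Dnn: "D n x \<ge> 0" for n x
    unfolding D_def by (simp add: sum_nonneg)
  have "(\<lambda>n. \<Sum>f\<in>F. \<integral>x. \<bar>conv f (kern (s n)) x - f x\<bar> \<partial>lebesgue) \<longlonglongrightarrow> (\<Sum>f\<in>F. 0)"
    by (intro tendsto_sum conv_kern_L1_tendsto[OF F(2) s])
  moreover have "(\<Sum>f\<in>F. \<integral>x. \<bar>conv f (kern (s n)) x - f x\<bar> \<partial>lebesgue) = (\<integral>x. \<bar>D n x\<bar> \<partial>lebesgue)" for n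
    using Dnn ci F(2) by (simp add: D_def Bochner_Integration.integral_sum)
  ultimately have "(\<lambda>n. \<integral>x. \<bar>D n x\<bar> \<partial>lebesgue) \<longlonglongrightarrow> 0" by simp
  then obtain r G where r: "strict_mono (r :: nat \<Rightarrow> nat)" "integrable lebesgue G"
    "AE x in lebesgue. (\<forall>n. \<bar>D (r n) x\<bar> \<le> G x) \<and> (\<lambda>n. D (r n) x) \<longlonglongrightarrow> 0"
    using L1_null_dominated_subseq[of lebesgue D, OF Di] by blast
  have le: "\<bar>conv f (kern (s n)) x - f x\<bar> \<le> D n x" if "f \<in> F" for f n x
    unfolding D_def by (rule member_le_sum[OF that]) (auto simp: F)
  have "AE x in lebesgue. \<forall>f\<in>F. (\<lambda>n. conv f (kern (s (r n))) x) \<longlonglongrightarrow> f x"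
    using r(3)
  proof eventually_elim
    case (elim x)
    show ?case
    proof
      fix f assume "f \<in> F"
      have "(\<lambda>n. conv f (kern (s (r n))) x - f x) \<longlonglongrightarrow> 0"
        by (rule tendsto_rabs_zero_cancel, rule tendsto_sandwich[OF _ _ tendsto_const[of 0]])
          (use elim le[OF \<open>f \<in> F\<close>] in auto)
      then show "(\<lambda>n. conv f (kern (s (r n))) x) \<longlonglongrightarrow> f x"
        by (rule LIM_zero_cancel)
    qed
  qed
  moreover have "AE x in lebesgue. \<forall>f\<in>F. \<forall>n. \<bar>conv f (kern (s (r n))) x\<bar> \<le> G x + (\<Sum>f\<in>F. \<bar>f x\<bar>)"
    using r(3)
  proof eventually_elim
    case (elim x)
    show ?case
    proof (intro ballI allI)
      fix f n assume "f \<in> F"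
      have "\<bar>f x\<bar> \<le> (\<Sum>f\<in>F. \<bar>f x\<bar>)"
        by (rule member_le_sum[OF \<open>f \<in> F\<close>]) (auto simp: F)
      moreover have "D (r n) x \<le> G x" using elim abs_le_D1 by blast
      ultimately show "\<bar>conv f (kern (s (r n))) x\<bar> \<le> G x + (\<Sum>f\<in>F. \<bar>f x\<bar>)"
        using le[OF \<open>f \<in> F\<close>, of "r n" x] by linarith
    qed
  qed
  moreover have "integrable lebesgue (\<lambda>x. G x + (\<Sum>f\<in>F. \<bar>f x\<bar>))"
    using r(2) F(2) by (intro Bochner_Integration.integrable_add Bochner_Integration.integrable_sum) auto
  ultimately show ?thesis
    using that[of "\<lambda>n. s (r n)"] s by blast
qed

section \<open>Weak derivatives of mollified functions\<close>

text \<open>The derivative of \<open>flat 0\<close> is \<open>flat 2\<close>, and -2 z is the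
  gradient of r^2 - |z|^2.\<close>

definition kern_grad :: "real \<Rightarrow> 'a::euclidean_space \<Rightarrow> 'a" where
  "kern_grad r z = (- 2 * flat 2 (r\<^sup>2 - (norm z)\<^sup>2)
     / (\<integral>z. flat 0 (r\<^sup>2 - (norm (z::'a))\<^sup>2) \<partial>lborel)) *\<^sub>R z"

lemma kern_GDERIV: "GDERIV (kern r) z :> kern_grad r (z :: 'a::euclidean_space)"
proof -
  let ?c = "\<integral>z. flat 0 (r\<^sup>2 - (norm (z::'a))\<^sup>2) \<partial>lborel"
  have 1: "GDERIV (\<lambda>z::'a. r\<^sup>2 - (norm z)\<^sup>2) z :> (- 2) *\<^sub>R z"
    unfolding gderiv_def power2_norm_eq_inner
    by (auto intro!: derivative_eq_intros simp: fun_eq_iff inner_commute)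
  have 2: "((\<lambda>t. flat 0 t / ?c) has_real_derivative flat 2 (r\<^sup>2 - (norm z)\<^sup>2) / ?c) (at (r\<^sup>2 - (norm z)\<^sup>2))"
    using DERIV_cdivide[OF flat_DERIV[of 0 "r\<^sup>2 - (norm z)\<^sup>2"], of ?c] by (simp add: numeral_2_eq_2)
  show ?thesis
    using GDERIV_DERIV_compose[OF 1 2] by (simp add: kern_def[abs_def] kern_grad_def mult.commute)
qed

lemma kern_grad_continuous: "continuous_on UNIV (kern_grad r :: 'a::euclidean_space \<Rightarrow> 'a)"
proof -
  have "continuous_on UNIV (\<lambda>z::'a. flat 2 (r\<^sup>2 - (norm z)\<^sup>2))"
    by (intro continuous_on_compose2[OF flat_continuous[of UNIV]] continuous_intros) auto
  then show ?thesis
    unfolding kern_grad_def divide_inverse by (intro continuous_intros)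
qed

lemma kern_grad_eq_0:
  assumes "r > 0" "norm z \<ge> r"
  shows "kern_grad r z = 0"
proof -
  have "r\<^sup>2 \<le> (norm z)\<^sup>2" using assms by (intro power_mono) auto
  then have "flat 2 (r\<^sup>2 - (norm z)\<^sup>2) = 0"
    unfolding flat_def by (intro if_not_P) linarith
  then show ?thesis by (simp add: kern_grad_def)
qed

lemma kern_grad_bounded:
  assumes "r > 0"
  obtains B where "B > 0" "\<And>z::'a::euclidean_space. norm (kern_grad r z) \<le> B"
  using continuous_compact_support_bounded[OF kern_grad_continuous kern_grad_eq_0[OF assms]] by blast

lemma conv_kern_GDERIV:
  assumes f: "integrable lebesgue f" and r: "r > 0"
  shows "GDERIV (conv f (kern r)) y :> conv f (kern_grad r) y"
    and "continuous_on UNIV (conv f (kern_grad r))"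
    and "conv f (kern_grad r) y \<bullet> b = (\<integral>x. f x * (kern_grad r (y - x) \<bullet> b) \<partial>lebesgue)"
proof -
  obtain A where A: "\<And>z::'a. \<bar>kern r z\<bar> \<le> A" using kern_bounded[OF r] by blast
  obtain B where B: "\<And>z::'a. norm (kern_grad r z) \<le> B" using kern_grad_bounded[OF r] by blast
  show "GDERIV (conv f (kern r)) y :> conv f (kern_grad r) y"
    by (rule conv_GDERIV[OF f A kern_GDERIV kern_grad_continuous B])
  show "continuous_on UNIV (conv f (kern_grad r))"
    by (rule conv_continuous[OF f kern_grad_continuous B])
  show "conv f (kern_grad r) y \<bullet> b = (\<integral>x. f x * (kern_grad r (y - x) \<bullet> b) \<partial>lebesgue)"
    unfolding conv_def
    using integral_inner_left[OF conv_integrable[OF f kern_grad_continuous B, of y], of b] by simp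
qed

section \<open>Testing weak derivatives against the reflected kernel\<close>

lemma kern_bump: "(\<lambda>x. kern r (y - x)) \<in> bumps y r"
  unfolding kern_def divide_inverse mult.commute[of "flat 0 _"] by (intro bumps.intros)

lemma kern_reflected_GDERIV:
  fixes y :: "'a::euclidean_space"
  shows "GDERIV (\<lambda>x. kern r (y - x)) x :> - kern_grad r (y - x)"
proof -
  have 1: "((\<lambda>x. y - x) has_derivative uminus) (at x)"
    by (auto intro!: derivative_eq_intros)
  have 2: "(kern r has_derivative (\<lambda>h. h \<bullet> kern_grad r (y - x))) (at (y - x))"
    using kern_GDERIV[of r "y - x"] by (simp add: gderiv_def)
  show ?thesis
    using has_derivative_compose[OF 1 2] by (simp add: gderiv_def)
qed

lemma bumps_integrable:
  assumes "u \<in> L1_loc" "f \<in> bumps y r"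
  shows "integrable lebesgue (\<lambda>x. u x * f x)"
proof -
  have i: "integrable lebesgue (\<lambda>x. indicator (cball y \<bar>r\<bar>) x * u x)"
    using assms(1) compact_cball by (auto simp: L1_loc_def set_integrable_def)
  have fc: "continuous_on UNIV f"
    using bumps_GDERIV[OF assms(2)] GDERIV_continuous by blast
  have f0: "f x = 0" if "norm x \<ge> norm y + \<bar>r\<bar>" for x
  proof -
    have "norm x - norm y \<le> norm (y - x)" by (metis norm_minus_commute norm_triangle_ineq2)
    then show ?thesis using that by (intro bumps_eq_0[OF assms(2)]) linarith
  qed
  obtain B where "\<And>x. norm (f x) \<le> B"
    using continuous_compact_support_bounded[OF fc f0] by blast
  from integrable_times_bounded[OF i lebesgue_measurable_continuous[OF fc] this]
  have "integrable lebesgue (\<lambda>x. indicator (cball y \<bar>r\<bar>) x * u x * f x)" by simp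
  moreover have "(\<lambda>x. indicator (cball y \<bar>r\<bar>) x * u x * f x) = (\<lambda>x. u x * f x)"
    using bumps_eq_0[OF assms(2)] by (force simp: indicator_def dist_norm)
  ultimately show ?thesis by simp
qed

text \<open>Mollifying \<open>cut R u\<close> instead of \<open>u\<close> makes all convolutions globally integrable; on the ball of
  radius \<open>R\<close> nothing changes for kernels of radius at most \<open>1\<close>.\<close>

definition cut :: "real \<Rightarrow> ('a::euclidean_space \<Rightarrow> real) \<Rightarrow> 'a \<Rightarrow> real" where
  "cut R u x = indicator (cball 0 (R + 1)) x * u x"

lemma L1_loc_inner:
  assumes "g \<in> L1_loc" shows "(\<lambda>x. g x \<bullet> i) \<in> L1_loc"
  unfolding L1_loc_def
proof safe
  fix K :: "'a set" assume "compact K"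
  then have "integrable lebesgue (\<lambda>x. indicator K x *\<^sub>R g x)"
    using assms by (simp add: L1_loc_def set_integrable_def)
  then have "integrable lebesgue (\<lambda>x. (indicator K x *\<^sub>R g x) \<bullet> i)"
    by (rule integrable_inner_left)
  then show "(\<lambda>x. g x \<bullet> i) absolutely_integrable_on K"
    by (simp add: set_integrable_def)
qed

lemma cut_integrable: "u \<in> L1_loc \<Longrightarrow> integrable lebesgue (cut R u)"
  by (auto simp: L1_loc_def set_integrable_def cut_def[abs_def])

lemma cut_kern:
  assumes "y \<in> ball 0 R" "0 < r" "r \<le> 1"
  shows "cut R u x * kern r (y - x) = u x * kern r (y - x)"
    and "cut R u x * (kern_grad r (y - x) \<bullet> i) = u x * (kern_grad r (y - x) \<bullet> i)"
proof -
  have "cut R u x = u x" if "norm (y - x) < r"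
  proof -
    have "norm x \<le> R + 1"
      using that assms norm_triangle_ineq2[of x y] by (simp add: dist_norm norm_minus_commute)
    then show ?thesis by (simp add: cut_def)
  qed
  then show "cut R u x * kern r (y - x) = u x * kern r (y - x)"
    and "cut R u x * (kern_grad r (y - x) \<bullet> i) = u x * (kern_grad r (y - x) \<bullet> i)"
    using kern_eq_0[OF assms(2), of "y - x"] kern_grad_eq_0[OF assms(2), of "y - x"]
    by (cases "norm (y - x) < r"; simp)+
qed

text \<open>The definition of the weak gradient is tested with
  \<open>\<lambda>x. kern r (y - x)\<close>; the sign from the reflection cancels the sign from the
  integration by parts.\<close>

lemma conv_cut_weak_gradient:
  assumes wg: "has_weak_gradient u g" and i: "i \<in> Basis"
    and y: "y \<in> ball 0 R" and r: "0 < r" "r \<le> 1"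
  shows "conv (cut R u) (kern_grad r) y \<bullet> i = conv (cut R (\<lambda>x. g x \<bullet> i)) (kern r) y"
proof -
  have u: "u \<in> L1_loc" using wg by (simp add: has_weak_gradient_def)
  have "conv (cut R u) (kern_grad r) y \<bullet> i = (\<integral>x. u x * (kern_grad r (y - x) \<bullet> i) \<partial>lebesgue)"
    unfolding conv_kern_GDERIV(3)[OF cut_integrable[OF u] r(1)] cut_kern(2)[OF y r]
    by (rule refl)
  also have "\<dots> = - (\<integral>x. u x * pderiv_at i (\<lambda>x. kern r (y - x)) x \<partial>lebesgue)"
    by (simp add: GDERIV_pderiv_at[OF kern_reflected_GDERIV])
  also have "\<dots> = (\<integral>x. (g x \<bullet> i) * kern r (y - x) \<partial>lebesgue)"
    using wg i bumps_test_function[OF kern_bump[of r y]] unfolding has_weak_gradient_def by force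
  also have "\<dots> = conv (cut R (\<lambda>x. g x \<bullet> i)) (kern r) y"
    by (simp add: conv_def cut_kern(1)[OF y r])
  finally show ?thesis .
qed

text \<open>The divergence of the mollified gradient is the mollified Laplacian although
  \<open>g\<close> has no weak derivatives: the weak gradient is tested with the partial derivatives
  of the reflected kernel, which are bumps again, and the sum is then the pairing of
  \<open>u\<close> with the Laplacian of the kernel.\<close>

lemma conv_cut_weak_Laplacian:
  assumes wg: "has_weak_gradient u g" and wl: "has_weak_Laplacian u l"
    and y: "y \<in> ball 0 R" and r: "0 < r" "r \<le> 1"
  shows "(\<Sum>i\<in>Basis. conv (cut R (\<lambda>x. g x \<bullet> i)) (kern_grad r) y \<bullet> i) = conv (cut R l) (kern r) y"
proof -
  have u: "u \<in> L1_loc" and g: "g \<in> L1_loc" using wg by (simp_all add: has_weak_gradient_def)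
  let ?\<eta> = "\<lambda>x. kern r (y - x)"
  obtain D where D: "\<And>x. GDERIV ?\<eta> x :> D x" "\<And>b. (\<lambda>x. D x \<bullet> b) \<in> bumps y r"
    using bumps_GDERIV[OF kern_bump[of r y]] by blast
  have p: "pderiv_at i ?\<eta> = (\<lambda>x. D x \<bullet> i)" for i
    using GDERIV_pderiv_at[OF D(1)] by blast
  have Dk: "D x \<bullet> i = - (kern_grad r (y - x) \<bullet> i)" for x i
    using GDERIV_pderiv_at[OF D(1), of x i] GDERIV_pderiv_at[OF kern_reflected_GDERIV[of r y x], of i]
    by simp
  have b2: "pderiv_at i (\<lambda>x. D x \<bullet> i) \<in> bumps y r" for i
  proof -
    obtain E where "\<And>x. GDERIV (\<lambda>x. D x \<bullet> i) x :> E x" "\<And>b. (\<lambda>x. E x \<bullet> b) \<in> bumps y r"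
      using bumps_GDERIV[OF D(2)[of i]] by blast
    moreover have "pderiv_at i (\<lambda>x. D x \<bullet> i) = (\<lambda>x. E x \<bullet> i)"
      using GDERIV_pderiv_at[OF calculation(1)] by blast
    ultimately show ?thesis by simp
  qed
  have "conv (cut R (\<lambda>x. g x \<bullet> i)) (kern_grad r) y \<bullet> i
      = (\<integral>x. u x * pderiv_at i (\<lambda>x. D x \<bullet> i) x \<partial>lebesgue)" if "i \<in> Basis" for i
  proof -
    have "conv (cut R (\<lambda>x. g x \<bullet> i)) (kern_grad r) y \<bullet> i = (\<integral>x. (g x \<bullet> i) * (kern_grad r (y - x) \<bullet> i) \<partial>lebesgue)"
      unfolding conv_kern_GDERIV(3)[OF cut_integrable[OF L1_loc_inner[OF g]] r(1)] cut_kern(2)[OF y r]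
      by (rule refl)
    also have "\<dots> = - (\<integral>x. (g x \<bullet> i) * (D x \<bullet> i) \<partial>lebesgue)"
      by (simp add: Dk)
    also have "\<dots> = (\<integral>x. u x * pderiv_at i (\<lambda>x. D x \<bullet> i) x \<partial>lebesgue)"
      using wg that bumps_test_function[OF D(2)[of i]] unfolding has_weak_gradient_def by force
    finally show ?thesis .
  qed
  then have "(\<Sum>i\<in>Basis. conv (cut R (\<lambda>x. g x \<bullet> i)) (kern_grad r) y \<bullet> i)
      = (\<Sum>i\<in>Basis. \<integral>x. u x * pderiv_at i (\<lambda>x. D x \<bullet> i) x \<partial>lebesgue)" by simp
  also have "\<dots> = (\<integral>x. (\<Sum>i\<in>Basis. u x * pderiv_at i (\<lambda>x. D x \<bullet> i) x) \<partial>lebesgue)"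
    using bumps_integrable[OF u b2] by (intro Bochner_Integration.integral_sum[symmetric])
  also have "\<dots> = (\<integral>x. u x * (\<Sum>i\<in>Basis. pderiv_at i (pderiv_at i ?\<eta>) x) \<partial>lebesgue)"
    by (simp add: p sum_distrib_left)
  also have "\<dots> = (\<integral>x. l x * kern r (y - x) \<partial>lebesgue)"
    using wl bumps_test_function[OF kern_bump[of r y]] unfolding has_weak_Laplacian_def by blast
  also have "\<dots> = conv (cut R l) (kern r) y"
    by (simp add: conv_def cut_kern(1)[OF y r])
  finally show ?thesis .
qed

lemma integral_lborel_translate:
  fixes F :: "'a::euclidean_space \<Rightarrow> real"
  assumes [measurable]: "F \<in> borel_measurable borel"
  shows "(\<integral>x. F (x + c) \<partial>lborel) = (\<integral>x. F x \<partial>lborel)"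
proof -
  have "(\<integral>x. F x \<partial>lborel) = (\<integral>x. F x \<partial>distr lborel borel ((+) c))"
    by (simp add: lborel_distr_plus)
  also have "\<dots> = (\<integral>x. F (x + c) \<partial>lborel)"
    by (subst integral_distr) (auto simp: add.commute)
  finally show ?thesis by simp
qed

text \<open>By translation invariance every difference quotient of \<open>F\<close> has integral 0.
  The quotients are bounded by \<open>B\<close>, and step sizes of at most 1 keep their supports in
  one ball.\<close>

lemma integral_gradient_eq_0:
  fixes F :: "'a::euclidean_space \<Rightarrow> real"
  assumes F: "\<And>x. GDERIV F x :> F' x" "continuous_on UNIV F'"
    and z: "\<And>x. norm x \<ge> R \<Longrightarrow> F x = 0" "\<And>x. norm x \<ge> R \<Longrightarrow> F' x = 0"
    and i: "i \<in> Basis"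
  shows "(\<integral>x. F' x \<bullet> i \<partial>lebesgue) = 0"
proof -
  obtain B where B: "B > 0" "\<And>x. norm (F' x) \<le> B"
    using continuous_compact_support_bounded[OF F(2) z(2)] by blast
  have Fc: "continuous_on UNIV F" by (rule GDERIV_continuous[OF F(1)])
  have [measurable]: "F \<in> borel_measurable borel" "F' \<in> borel_measurable borel"
    by (rule borel_measurable_continuous_onI, fact)+
  have ni: "norm i = 1" using i by simp
  define t where "t n = 1 / real (Suc n)" for n
  have t: "t n > 0" "t n \<le> 1" for n by (auto simp: t_def)
  have t0: "t \<longlonglongrightarrow> 0"
    unfolding t_def using LIMSEQ_inverse_real_of_nat by (simp add: inverse_eq_divide)
  have int: "integrable lborel F" by (rule integrable_compact_support(1)[OF Fc z(1)])
  have int': "integrable lborel (\<lambda>x. F (x + c))" for c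
  proof -
    have "continuous_on UNIV (\<lambda>x. F (x + c))"
      by (intro continuous_on_compose2[OF Fc] continuous_intros) auto
    moreover have "F (x + c) = 0" if "norm x \<ge> R + norm c" for x
      using that norm_triangle_ineq2[of x "- c"] by (intro z(1)) simp
    ultimately show ?thesis by (rule integrable_compact_support(1))
  qed
  have 0: "(\<integral>x. (F (x + t n *\<^sub>R i) - F x) / t n \<partial>lborel) = 0" for n
    using int int' by (simp add: integral_lborel_translate)
  have "(\<lambda>n. \<integral>x. (F (x + t n *\<^sub>R i) - F x) / t n \<partial>lborel) \<longlonglongrightarrow> (\<integral>x. F' x \<bullet> i \<partial>lborel)"
  proof (rule integral_dominated_convergence[where w="\<lambda>x. B * indicator (cball 0 (\<bar>R\<bar> + 1)) x"])
    show "integrable lborel (\<lambda>x::'a. B * indicator (cball 0 (\<bar>R\<bar> + 1)) x)"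
      by (intro integrable_mult_right integrable_real_indicator)
        (use emeasure_lborel_cball_finite[of 0 "\<bar>R\<bar> + 1"] in auto)
    show "AE x in lborel. norm ((F (x + t n *\<^sub>R i) - F x) / t n) \<le> B * indicator (cball 0 (\<bar>R\<bar> + 1)) x" for n
    proof (rule AE_I2)
      fix x
      show "norm ((F (x + t n *\<^sub>R i) - F x) / t n) \<le> B * indicator (cball 0 (\<bar>R\<bar> + 1)) x"
      proof (cases "norm x \<le> \<bar>R\<bar> + 1")
        case True
        have "\<bar>F (x + t n *\<^sub>R i) - F x\<bar> \<le> B * norm (x + t n *\<^sub>R i - x)"
          by (rule GDERIV_diff_bound[OF F(1) B(2)])
        then show ?thesis using True t(1)[of n] ni by (simp add: divide_le_eq)
      next
        case False
        have "norm x - norm (- (t n *\<^sub>R i)) \<le> norm (x - - (t n *\<^sub>R i))" by (rule norm_triangle_ineq2)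
        then have "norm (x + t n *\<^sub>R i) \<ge> norm x - t n"
          using ni t(1)[of n] by simp
        then have "F (x + t n *\<^sub>R i) = 0" "F x = 0"
          using False t(2)[of n] by (auto intro!: z(1))
        then show ?thesis using B(1) by simp
      qed
    qed
    show "AE x in lborel. (\<lambda>n. (F (x + t n *\<^sub>R i) - F x) / t n) \<longlonglongrightarrow> F' x \<bullet> i"
    proof (rule AE_I2)
      fix x
      have 1: "((\<lambda>s. x + s *\<^sub>R i) has_derivative (\<lambda>h. h *\<^sub>R i)) (at 0)"
        by (auto intro!: derivative_eq_intros)
      have 2: "(F has_derivative (\<lambda>h. h \<bullet> F' x)) (at (x + 0 *\<^sub>R i))"
        using F(1) by (simp add: gderiv_def)
      have "((\<lambda>s. F (x + s *\<^sub>R i)) has_derivative (\<lambda>h. h *\<^sub>R i \<bullet> F' x)) (at 0)"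
        by (rule has_derivative_compose[OF 1 2])
      then have "((\<lambda>s. F (x + s *\<^sub>R i)) has_real_derivative F' x \<bullet> i) (at 0)"
        by (simp add: has_field_derivative_def inner_commute mult.commute[of _ "i \<bullet> F' x"])
      then have "((\<lambda>h. (F (x + h *\<^sub>R i) - F x) / h) \<longlongrightarrow> F' x \<bullet> i) (at 0)"
        by (simp add: DERIV_def)
      moreover have "filterlim t (at 0) sequentially"
        unfolding filterlim_at using t0 t(1) by (auto simp: less_imp_neq[symmetric])
      ultimately show "(\<lambda>n. (F (x + t n *\<^sub>R i) - F x) / t n) \<longlonglongrightarrow> F' x \<bullet> i"
        by (rule filterlim_compose)
    qed
  qed measurable
  then have "(\<integral>x. F' x \<bullet> i \<partial>lborel) = 0"
    unfolding 0 by (simp add: LIMSEQ_const_iff)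
  then show ?thesis by (subst integral_completion) auto
qed

section \<open>Weak gradients\<close>

text \<open>Product and chain rule for p(u) q(v) in integrated form. After mollifying
  \<open>u\<close> and \<open>v\<close> it is the vanishing integral of a classical derivative;
  boundedness of \<open>p\<close>, \<open>q\<close> and their derivatives lets the majorant of the
  mollified gradients carry the limit. The test function \<psi> is only required to be C^1, since it
  will later contain the cut-off and the mollified weight.\<close>

lemma weak_gradient_product_chain:
  fixes u v \<psi> :: "'a::euclidean_space \<Rightarrow> real" and p q :: "real \<Rightarrow> real"
  assumes u: "has_weak_gradient u gu" and v: "has_weak_gradient v gv"
    and p: "\<And>s. (p has_real_derivative p' s) (at s)" "continuous_on UNIV p'" "\<And>s. \<bar>p s\<bar> \<le> A" "\<And>s. \<bar>p' s\<bar> \<le> A"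
    and q: "\<And>s. (q has_real_derivative q' s) (at s)" "continuous_on UNIV q'" "\<And>s. \<bar>q s\<bar> \<le> A" "\<And>s. \<bar>q' s\<bar> \<le> A"
    and \<psi>: "\<And>x. GDERIV \<psi> x :> \<psi>' x" "continuous_on UNIV \<psi>'"
      "\<And>x. norm x \<ge> R \<Longrightarrow> \<psi> x = 0" "\<And>x. norm x \<ge> R \<Longrightarrow> \<psi>' x = 0"
    and i: "i \<in> Basis"
  defines "E \<equiv> \<lambda>x. p (u x) * q (v x) * (\<psi>' x \<bullet> i)
      + \<psi> x * (p' (u x) * q (v x) * (gu x \<bullet> i) + p (u x) * q' (v x) * (gv x \<bullet> i))"
  shows "integrable lebesgue E" "(\<integral>x. E x \<partial>lebesgue) = 0"
proof -
  have L: "u \<in> L1_loc" "v \<in> L1_loc" "gu \<in> L1_loc" "gv \<in> L1_loc"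
    using u v by (auto simp: has_weak_gradient_def)
  define u0 v0 u1 v1 where "u0 = cut R u" and "v0 = cut R v"
    and "u1 = cut R (\<lambda>x. gu x \<bullet> i)" and "v1 = cut R (\<lambda>x. gv x \<bullet> i)"
  note defs = u0_def v0_def u1_def v1_def
  have I: "integrable lebesgue u0" "integrable lebesgue v0" "integrable lebesgue u1" "integrable lebesgue v1"
    unfolding defs using L by (auto intro: cut_integrable L1_loc_inner)
  obtain s G where s: "\<And>n. 0 < s n" "\<And>n. s n \<le> 1" and G: "integrable lebesgue G"
    and lim: "AE x in lebesgue. \<forall>f\<in>{u0, v0, u1, v1}. (\<lambda>n. conv f (kern (s n)) x) \<longlonglongrightarrow> f x"
    and bound: "AE x in lebesgue. \<forall>f\<in>{u0, v0, u1, v1}. \<forall>n. \<bar>conv f (kern (s n)) x\<bar> \<le> G x"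
  proof (rule mollifier_sequence[of "{u0, v0, u1, v1}"])
    show "integrable lebesgue f" if "f \<in> {u0, v0, u1, v1}" for f using that I by auto
  qed auto
  have pc: "continuous_on UNIV p" and qc: "continuous_on UNIV q"
    using p(1) q(1) by (meson DERIV_continuous_on has_field_derivative_at_within)+
  obtain B where B: "B > 0" "\<And>x. norm (\<psi>' x) \<le> B"
    using continuous_compact_support_bounded[OF \<psi>(2,4)] by blast
  obtain C where C: "C > 0" "\<And>x. norm (\<psi> x) \<le> C"
    using continuous_compact_support_bounded[OF GDERIV_continuous[OF \<psi>(1)] \<psi>(3)] by blast
  have A: "A \<ge> 0" using p(3)[of 0] by linarith
  define E' where "E' n x = p (conv u0 (kern (s n)) x) * q (conv v0 (kern (s n)) x) * (\<psi>' x \<bullet> i)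
      + \<psi> x * (p' (conv u0 (kern (s n)) x) * q (conv v0 (kern (s n)) x) * conv u1 (kern (s n)) x
         + p (conv u0 (kern (s n)) x) * q' (conv v0 (kern (s n)) x) * conv v1 (kern (s n)) x)" for n x
  have E'0: "(\<integral>x. E' n x \<partial>lebesgue) = 0" for n
  proof -
    let ?U = "conv u0 (kern (s n))" and ?V = "conv v0 (kern (s n))"
    let ?dU = "conv u0 (kern_grad (s n))" and ?dV = "conv v0 (kern_grad (s n))"
    note dU = conv_kern_GDERIV(1,2)[OF I(1) s(1)] and dV = conv_kern_GDERIV(1,2)[OF I(2) s(1)]
    define D where "D x = \<psi> x *\<^sub>R (p (?U x) *\<^sub>R (q' (?V x) *\<^sub>R ?dV x) + q (?V x) *\<^sub>R (p' (?U x) *\<^sub>R ?dU x))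
        + (p (?U x) * q (?V x)) *\<^sub>R \<psi>' x" for x
    have "GDERIV (\<lambda>x. \<psi> x * (p (?U x) * q (?V x))) x :> D x" for x
      unfolding D_def by (intro GDERIV_mult \<psi>(1) GDERIV_DERIV_compose[OF dU(1) p(1)] GDERIV_DERIV_compose[OF dV(1) q(1)])
    moreover have "continuous_on UNIV D"
      unfolding D_def
      by (intro continuous_intros GDERIV_continuous[OF \<psi>(1)] \<psi>(2) dU dV
          continuous_on_compose2[OF pc GDERIV_continuous[OF dU(1)]] continuous_on_compose2[OF qc GDERIV_continuous[OF dV(1)]]
          continuous_on_compose2[OF p(2) GDERIV_continuous[OF dU(1)]] continuous_on_compose2[OF q(2) GDERIV_continuous[OF dV(1)]]) auto
    ultimately have "(\<integral>x. D x \<bullet> i \<partial>lebesgue) = 0"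
      by (rule integral_gradient_eq_0) (use \<psi> i in \<open>auto simp: D_def\<close>)
    \<comment> \<open>On the ball of radius \<open>R\<close> the derivatives of the mollified
      \<open>cut\<close> functions are the mollified weak gradients; outside it both sides vanish
      together with \<psi> and its gradient.\<close>
    moreover have "D x \<bullet> i = E' n x" for x
    proof (cases "norm x < R")
      case True
      then have "x \<in> ball 0 R" by simp
      then have "?dU x \<bullet> i = conv u1 (kern (s n)) x" "?dV x \<bullet> i = conv v1 (kern (s n)) x"
        unfolding defs using u v i s by (auto intro!: conv_cut_weak_gradient)
      then show ?thesis
        by (simp add: D_def E'_def inner_add_left algebra_simps)
    next
      case False
      then show ?thesis using \<psi> by (simp add: D_def E'_def)
    qed
    ultimately show ?thesis by simp
  qed
  have [measurable]: "(\<lambda>x. conv u0 (kern (s n)) x) \<in> borel_measurable lebesgue"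
     "(\<lambda>x. conv v0 (kern (s n)) x) \<in> borel_measurable lebesgue"
     "(\<lambda>x. conv u1 (kern (s n)) x) \<in> borel_measurable lebesgue"
     "(\<lambda>x. conv v1 (kern (s n)) x) \<in> borel_measurable lebesgue" for n
    using I s(1) conv_kern_measurable by blast+
  have [measurable]: "p \<in> borel_measurable borel" "q \<in> borel_measurable borel"
    "p' \<in> borel_measurable borel" "q' \<in> borel_measurable borel"
    by (rule borel_measurable_continuous_onI, fact)+
  have [measurable]: "\<psi> \<in> borel_measurable lebesgue" "\<psi>' \<in> borel_measurable lebesgue"
    using GDERIV_continuous[OF \<psi>(1)] \<psi>(2) by (auto intro: lebesgue_measurable_continuous)
  have E'_meas: "E' n \<in> borel_measurable lebesgue" for n
    unfolding E'_def by measurable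
  have [measurable]: "u0 \<in> borel_measurable lebesgue" "v0 \<in> borel_measurable lebesgue"
      "u1 \<in> borel_measurable lebesgue" "v1 \<in> borel_measurable lebesgue" using I by auto
  define E0 where "E0 x = p (u0 x) * q (v0 x) * (\<psi>' x \<bullet> i)
      + \<psi> x * (p' (u0 x) * q (v0 x) * u1 x + p (u0 x) * q' (v0 x) * v1 x)" for x
  have E0: "E0 = E"
  proof
    fix x show "E0 x = E x"
    proof (cases "norm x < R")
      case True
      then show ?thesis by (simp add: E0_def E_def defs cut_def)
    next
      case False
      then show ?thesis using \<psi> by (simp add: E0_def E_def)
    qed
  qed
  have E0_meas: "E0 \<in> borel_measurable lebesgue"
    unfolding E0_def by measurable
  let ?w = "\<lambda>x. A * A * B * indicator (cball 0 R) x + C * A * A * 2 * \<bar>G x\<bar>"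
  have w: "integrable lebesgue ?w"
    by (intro Bochner_Integration.integrable_add integrable_mult_right integrable_real_indicator integrable_abs G)
      (use emeasure_lborel_cball_finite[of 0 R] in auto)
  have conv: "AE x in lebesgue. (\<lambda>n. E' n x) \<longlonglongrightarrow> E0 x"
    using lim
  proof eventually_elim
    case (elim x)
    have c: "isCont p s" "isCont q s" "isCont p' s" "isCont q' s" for s
      using pc qc p(2) q(2) by (auto simp: continuous_on_eq_continuous_at)
    show ?case
      unfolding E'_def E0_def
      by (intro tendsto_intros isCont_tendsto_compose[OF c(1)] isCont_tendsto_compose[OF c(2)]
          isCont_tendsto_compose[OF c(3)] isCont_tendsto_compose[OF c(4)]) (use elim in auto)
  qed
  have dom: "AE x in lebesgue. norm (E' n x) \<le> ?w x" for n
    using bound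
  proof eventually_elim
    case (elim x)
    show ?case
    proof (cases "norm x < R")
      case True
      let ?a = "conv u0 (kern (s n)) x" and ?b = "conv v0 (kern (s n)) x"
      have pq: "\<bar>p ?a * q ?b\<bar> \<le> A * A" "\<bar>p' ?a * q ?b\<bar> \<le> A * A" "\<bar>p ?a * q' ?b\<bar> \<le> A * A"
        unfolding abs_mult using p q A by (auto intro!: mult_mono)
      have "\<bar>\<psi>' x \<bullet> i\<bar> \<le> B"
        using Basis_le_norm[OF i, of "\<psi>' x"] B(2)[of x] by linarith
      then have 1: "\<bar>p ?a * q ?b * (\<psi>' x \<bullet> i)\<bar> \<le> A * A * B"
        unfolding abs_mult[of "p ?a * q ?b"] using pq A by (intro mult_mono) auto
      have g: "\<bar>conv u1 (kern (s n)) x\<bar> \<le> \<bar>G x\<bar>" "\<bar>conv v1 (kern (s n)) x\<bar> \<le> \<bar>G x\<bar>"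
        using elim by (auto intro: order_trans[OF _ abs_ge_self])
      have "\<bar>p' ?a * q ?b * conv u1 (kern (s n)) x + p ?a * q' ?b * conv v1 (kern (s n)) x\<bar>
          \<le> \<bar>p' ?a * q ?b\<bar> * \<bar>conv u1 (kern (s n)) x\<bar> + \<bar>p ?a * q' ?b\<bar> * \<bar>conv v1 (kern (s n)) x\<bar>"
        unfolding abs_mult[symmetric] by (rule abs_triangle_ineq)
      also have "\<dots> \<le> A * A * \<bar>G x\<bar> + A * A * \<bar>G x\<bar>"
        using pq g A by (intro add_mono mult_mono) auto
      finally have 2: "\<bar>\<psi> x * (p' ?a * q ?b * conv u1 (kern (s n)) x + p ?a * q' ?b * conv v1 (kern (s n)) x)\<bar>
          \<le> C * (A * A * \<bar>G x\<bar> + A * A * \<bar>G x\<bar>)"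
        unfolding abs_mult[of "\<psi> x"] using C by (intro mult_mono) auto
      show ?thesis
        using 1 2 True unfolding E'_def by (simp add: algebra_simps)
    next
      case False
      then show ?thesis using \<psi> A B(1) C(1) by (simp add: E'_def indicator_def)
    qed
  qed
  show "integrable lebesgue E"
    unfolding E0[symmetric] by (rule integrable_dominated_convergence[OF E0_meas E'_meas w conv dom])
  have "(\<lambda>n. \<integral>x. E' n x \<partial>lebesgue) \<longlonglongrightarrow> (\<integral>x. E0 x \<partial>lebesgue)"
    by (rule integral_dominated_convergence[OF E0_meas E'_meas w conv dom])
  then show "(\<integral>x. E x \<partial>lebesgue) = 0"
    by (simp add: E'0 E0 LIMSEQ_const_iff)
qed

text \<open>Fundamental lemma of the calculus of variations: on the ball of radius \<open>k\<close>
  the given integrals are the mollifications of \<open>cut k f\<close>, which converge to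
  \<open>f\<close> almost everywhere.\<close>

lemma AE_eq_0_if_kern_integrals_0:
  fixes f :: "'a::euclidean_space \<Rightarrow> real"
  assumes f: "f \<in> L1_loc" and z: "\<And>y r. 0 < r \<Longrightarrow> (\<integral>x. f x * kern r (y - x) \<partial>lebesgue) = 0"
  shows "AE x in lebesgue. f x = 0"
proof -
  have "AE x in lebesgue. norm x < real k \<longrightarrow> f x = 0" for k
  proof -
    obtain s G where s: "\<And>n. 0 < s n" "\<And>n. s n \<le> 1"
      and lim: "AE x in lebesgue. \<forall>f\<in>{cut k f}. (\<lambda>n. conv f (kern (s n)) x) \<longlonglongrightarrow> f x"
    proof (rule mollifier_sequence[of "{cut k f}"])
      show "integrable lebesgue g" if "g \<in> {cut k f}" for g using that cut_integrable[OF f] by auto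
    qed auto
    from lim show ?thesis
    proof eventually_elim
      case (elim x)
      have "conv (cut k f) (kern (s n)) x = 0" if "norm x < k" for n
      proof -
        have "x \<in> ball 0 (real k)" using that by simp
        then show ?thesis using z[OF s(1)] by (simp add: conv_def cut_kern(1)[OF _ s])
      qed
      with elim have "norm x < k \<Longrightarrow> cut k f x = 0"
        by (simp add: LIMSEQ_const_iff)
      then show ?case by (auto simp: cut_def)
    qed
  qed
  then have "AE x in lebesgue. \<forall>k. norm x < real k \<longrightarrow> f x = 0"
    unfolding AE_all_countable by blast
  then show ?thesis
    by eventually_elim (use reals_Archimedean2 in blast)
qed

lemma L1_loc_diff: "f \<in> L1_loc \<Longrightarrow> g \<in> L1_loc \<Longrightarrow> (\<lambda>x. f x - g x) \<in> L1_loc"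
  unfolding L1_loc_def set_integrable_def by (auto simp: scaleR_diff_right)

lemma AE_eq_vector:
  fixes f g :: "'a \<Rightarrow> 'b::euclidean_space"
  assumes "\<And>i. i \<in> Basis \<Longrightarrow> AE x in M. f x \<bullet> i = g x \<bullet> i"
  shows "AE x in M. f x = g x"
proof -
  have "AE x in M. \<forall>i\<in>Basis. f x \<bullet> i = g x \<bullet> i"
    using assms by (subst AE_ball_countable) (auto intro: countable_finite)
  then show ?thesis by eventually_elim (rule euclidean_eqI, simp)
qed

text \<open>Membership in \<open>H1\<close> provides some gradient in L2 while the theorem speaks of
  an arbitrary weak gradient; this identifies the two.\<close>

lemma weak_gradient_unique:
  assumes "has_weak_gradient u g" "has_weak_gradient u h"
  shows "AE x in lebesgue. g x = h x"
proof (rule AE_eq_vector)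
  fix i :: 'a assume i: "i \<in> Basis"
  have L: "(\<lambda>x. g x \<bullet> i) \<in> L1_loc" "(\<lambda>x. h x \<bullet> i) \<in> L1_loc"
    using assms by (auto simp: has_weak_gradient_def intro: L1_loc_inner)
  have "AE x in lebesgue. g x \<bullet> i - h x \<bullet> i = 0"
  proof (rule AE_eq_0_if_kern_integrals_0[OF L1_loc_diff[OF L]])
    fix y :: 'a and r :: real
    have t: "(\<lambda>x. kern r (y - x)) \<in> test_functions"
      by (rule bumps_test_function[OF kern_bump])
    have "- (\<integral>x. (g x \<bullet> i) * kern r (y - x) \<partial>lebesgue) = - (\<integral>x. (h x \<bullet> i) * kern r (y - x) \<partial>lebesgue)"
      using assms(1)[unfolded has_weak_gradient_def, THEN conjunct2, THEN conjunct2, THEN bspec, OF t, THEN bspec, OF i]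
        assms(2)[unfolded has_weak_gradient_def, THEN conjunct2, THEN conjunct2, THEN bspec, OF t, THEN bspec, OF i]
      by (rule trans[OF sym])
    then show "(\<integral>x. (g x \<bullet> i - h x \<bullet> i) * kern r (y - x) \<partial>lebesgue) = 0"
      using bumps_integrable[OF L(1) kern_bump] bumps_integrable[OF L(2) kern_bump]
      by (simp add: left_diff_distrib)
  qed
  then show "AE x in lebesgue. g x \<bullet> i = h x \<bullet> i" by simp
qed

text \<open>As \<open>k\<close> tends to \<open>0\<close>, \<open>damp k w\<close> tends to the indicator of \<open>w \<noteq> 0\<close>, while \<open>w * damp' k w\<close> stays
  bounded; and \<open>k * damp k w\<close> increases to \<open>w\<^sup>2\<close> as \<open>k\<close> tends to infinity.\<close>

definition damp :: "real \<Rightarrow> real \<Rightarrow> real" where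
  "damp k t = t\<^sup>2 / (k + t\<^sup>2)"

definition damp' :: "real \<Rightarrow> real \<Rightarrow> real" where
  "damp' k t = 2 * k * t / (k + t\<^sup>2)\<^sup>2"

lemma damp_facts:
  assumes k: "k > 0"
  shows damp_DERIV: "(damp k has_real_derivative damp' k t) (at t)"
    and damp'_continuous: "continuous_on UNIV (damp' k)"
    and damp_nonneg: "0 \<le> damp k t" and damp_le_1: "damp k t \<le> 1"
    and damp_mult_le: "k * damp k t \<le> t\<^sup>2" "k * damp k t \<le> k"
    and damp'_bound: "\<bar>damp' k t\<bar> \<le> 1 + 1 / k" and damp'_mult: "\<bar>damp' k t * t\<bar> \<le> 1"
    and damp'_le: "k * \<bar>damp' k t\<bar> \<le> 2 * \<bar>t\<bar>"
proof -
  have pos: "k + t\<^sup>2 > 0" for t using k by (simp add: add_pos_nonneg)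
  have nz: "k + t\<^sup>2 \<noteq> 0" for t using pos[of t] by linarith
  show "(damp k has_real_derivative damp' k t) (at t)"
    unfolding damp_def[abs_def] damp'_def
    by (rule derivative_eq_intros refl nz)+ (simp add: power2_eq_square algebra_simps)
  show "continuous_on UNIV (damp' k)"
    unfolding damp'_def using nz by (intro continuous_intros) auto
  show "0 \<le> damp k t" "damp k t \<le> 1"
    using k pos[of t] by (simp_all add: damp_def)
  then show "k * damp k t \<le> k" using k by simp
  show "k * damp k t \<le> t\<^sup>2"
  proof -
    have "k * t\<^sup>2 \<le> t\<^sup>2 * (k + t\<^sup>2)" by (simp add: algebra_simps)
    then show ?thesis using pos[of t] by (simp add: damp_def divide_le_eq)
  qed
  have sq: "k\<^sup>2 \<le> (k + t\<^sup>2)\<^sup>2" using k by (intro power_mono) auto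
  have eq: "(k + t\<^sup>2)\<^sup>2 = k\<^sup>2 + 2 * k * t\<^sup>2 + (t\<^sup>2)\<^sup>2" by (simp add: power2_eq_square algebra_simps)
  have 4: "2 * k * t\<^sup>2 \<le> (k + t\<^sup>2)\<^sup>2" using eq by simp
  show "\<bar>damp' k t * t\<bar> \<le> 1"
  proof -
    have "damp' k t * t = 2 * k * t\<^sup>2 / (k + t\<^sup>2)\<^sup>2"
      unfolding damp'_def by (simp only: times_divide_eq_left power2_eq_square[of t] mult.assoc)
    moreover have "0 \<le> 2 * k * t\<^sup>2 / (k + t\<^sup>2)\<^sup>2"
      using k by (intro divide_nonneg_nonneg mult_nonneg_nonneg) auto
    moreover have "2 * k * t\<^sup>2 / (k + t\<^sup>2)\<^sup>2 \<le> 1"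
      using 4 pos_divide_le_eq[OF zero_less_power[OF pos[of t], of 2], of "2 * k * t\<^sup>2" 1] by linarith
    ultimately show ?thesis by linarith
  qed
  show "\<bar>damp' k t\<bar> \<le> 1 + 1 / k"
  proof -
    have "2 * \<bar>t\<bar> \<le> 1 + t\<^sup>2"
      using sum_squares_bound[of "\<bar>t\<bar>" 1] by simp
    then have "2 * k * \<bar>t\<bar> \<le> k + k * t\<^sup>2"
      using k mult_left_mono[of "2 * \<bar>t\<bar>" "1 + t\<^sup>2" k] by (simp add: algebra_simps)
    also have "\<dots> \<le> (1 / k) * (k + t\<^sup>2)\<^sup>2 + (k + t\<^sup>2)\<^sup>2"
    proof (rule add_mono)
      show "k \<le> (1 / k) * (k + t\<^sup>2)\<^sup>2" using sq k by (simp add: field_simps power2_eq_square)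
      show "k * t\<^sup>2 \<le> (k + t\<^sup>2)\<^sup>2" 
      proof -
        have "0 \<le> k * t\<^sup>2" using k by simp
        then show ?thesis using 4 by linarith
      qed
    qed
    finally have "2 * k * \<bar>t\<bar> \<le> (1 + 1 / k) * (k + t\<^sup>2)\<^sup>2" by (simp add: algebra_simps)
    then show ?thesis
      using k pos[of t] by (simp add: damp'_def abs_mult divide_le_eq)
  qed
  show "k * \<bar>damp' k t\<bar> \<le> 2 * \<bar>t\<bar>"
  proof -
    have "k * \<bar>damp' k t\<bar> = 2 * \<bar>t\<bar> * (k\<^sup>2 / (k + t\<^sup>2)\<^sup>2)"
      using k by (simp add: damp'_def abs_mult power2_eq_square)
    also have "\<dots> \<le> 2 * \<bar>t\<bar> * 1"
      using sq pos[of t] by (intro mult_left_mono) (auto simp: divide_le_eq)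
    finally show ?thesis by simp
  qed
qed

section \<open>Local integrability and the gradient of a square\<close>

lemma L2_loc_square: "f \<in> L2_loc \<Longrightarrow> (\<lambda>x. (norm (f x))\<^sup>2) \<in> L1_loc"
  by (auto simp: L2_loc_def L1_loc_def)

lemma L1_loc_bound:
  fixes f :: "'a::euclidean_space \<Rightarrow> 'b::euclidean_space"
  assumes f: "f \<in> borel_measurable lebesgue" and h: "h \<in> L1_loc"
    and b: "AE x in lebesgue. norm (f x) \<le> (h x :: real)"
  shows "f \<in> L1_loc"
  unfolding L1_loc_def set_integrable_def
proof safe
  fix K :: "'a set" assume K: "compact K"
  then have "K \<in> sets lebesgue" by (simp add: borel_compact)
  then have [measurable]: "(indicator K :: 'a \<Rightarrow> real) \<in> borel_measurable lebesgue" by simp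
  have "integrable lebesgue (\<lambda>x. indicator K x *\<^sub>R h x)"
    using h K by (simp add: L1_loc_def set_integrable_def)
  then show "integrable lebesgue (\<lambda>x. indicator K x *\<^sub>R f x)"
  proof (rule Bochner_Integration.integrable_bound)
    show "AE x in lebesgue. norm (indicator K x *\<^sub>R f x) \<le> norm (indicator K x *\<^sub>R h x)"
      using b by eventually_elim (auto simp: indicator_def)
  qed (use f in measurable)
qed

lemma L1_loc_add: "f \<in> L1_loc \<Longrightarrow> g \<in> L1_loc \<Longrightarrow> (\<lambda>x. f x + g x) \<in> L1_loc"
  unfolding L1_loc_def set_integrable_def by (auto simp: scaleR_add_right)

lemma L1_loc_cmult:
  fixes f :: "'a::euclidean_space \<Rightarrow> real"
  shows "f \<in> L1_loc \<Longrightarrow> (\<lambda>x. c * f x) \<in> L1_loc"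
  unfolding L1_loc_def set_integrable_def
  by (auto simp: mult.left_commute[of _ c])

lemma L1_loc_const: "(\<lambda>x::'a::euclidean_space. c::real) \<in> L1_loc"
  unfolding L1_loc_def set_integrable_def
proof safe
  fix K :: "'a set" assume "compact K"
  then show "integrable lebesgue (\<lambda>x. indicator K x *\<^sub>R c)"
    using emeasure_compact_finite[of K]
    by (intro integrable_scaleR_left integrable_real_indicator) (auto simp: borel_compact)
qed

lemma L1_loc_measurable:
  fixes f :: "'a::euclidean_space \<Rightarrow> 'b::euclidean_space"
  assumes "f \<in> L1_loc"
  shows "f \<in> borel_measurable lebesgue"
proof (rule borel_measurable_LIMSEQ_metric)
  show "(\<lambda>x. indicator (cball 0 (real n)) x *\<^sub>R f x) \<in> borel_measurable lebesgue" for n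
    by (rule borel_measurable_integrable)
      (use assms compact_cball[of 0 "real n"] in \<open>simp add: L1_loc_def set_integrable_def\<close>)
  show "(\<lambda>n. indicator (cball 0 (real n)) x *\<^sub>R f x) \<longlonglongrightarrow> f x" for x
  proof (rule tendsto_eventually)
    obtain N :: nat where N: "norm x \<le> real N" using real_arch_simple by blast
    show "\<forall>\<^sub>F n in sequentially. indicator (cball 0 (real n)) x *\<^sub>R f x = f x"
      unfolding eventually_sequentially
    proof (intro exI[of _ N] allI impI)
      fix n assume "N \<le> n"
      then have "norm x \<le> real n" using N by linarith
      then show "indicator (cball 0 (real n)) x *\<^sub>R f x = f x" by simp
    qed
  qed
qed

lemma L2_loc_mult:
  fixes f :: "'a::euclidean_space \<Rightarrow> real" and g :: "'a \<Rightarrow> 'b::euclidean_space"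
  assumes f: "f \<in> L2_loc" and g: "g \<in> L2_loc"
  shows "(\<lambda>x. f x *\<^sub>R g x) \<in> L1_loc"
proof (rule L1_loc_bound)
  have [measurable]: "f \<in> borel_measurable lebesgue" "g \<in> borel_measurable lebesgue"
    using f g by (auto simp: L2_loc_def)
  show "(\<lambda>x. f x *\<^sub>R g x) \<in> borel_measurable lebesgue" by measurable
  show "(\<lambda>x. (norm (f x))\<^sup>2 + (norm (g x))\<^sup>2) \<in> L1_loc"
    by (intro L1_loc_add L2_loc_square f g)
  show "AE x in lebesgue. norm (f x *\<^sub>R g x) \<le> (norm (f x))\<^sup>2 + (norm (g x))\<^sup>2"
  proof (rule AE_I2)
    fix x
    have "2 * \<bar>f x\<bar> * norm (g x) \<le> \<bar>f x\<bar>\<^sup>2 + (norm (g x))\<^sup>2"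
      by (rule sum_squares_bound)
    moreover have "0 \<le> \<bar>f x\<bar> * norm (g x)" by simp
    ultimately have "\<bar>f x\<bar> * norm (g x) \<le> \<bar>f x\<bar>\<^sup>2 + (norm (g x))\<^sup>2"
      by linarith
    then show "norm (f x *\<^sub>R g x) \<le> (norm (f x))\<^sup>2 + (norm (g x))\<^sup>2"
      by simp
  qed
qed

lemma bump_times_integrable:
  "u \<in> L1_loc \<Longrightarrow> f \<in> bumps y r \<Longrightarrow> integrable lebesgue (\<lambda>x. f x * u x)"
  using bumps_integrable[of u f y r] by (simp add: mult.commute)

text \<open>The chain rule at hand needs bounded functions with bounded derivatives, which squaring
  is not. With k = n + 1, k times \<open>damp k\<close> stays below t^2 and its derivative below 2
  |t| in absolute value, and both converge, so dominated convergence gives the pairing of w^2 with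
  the kernel gradient. Comparison with the given \<open>D\<close> through kernels identifies the two
  fields.\<close>

lemma weak_gradient_square:
  assumes w: "w \<in> L2_loc" "g \<in> L2_loc" "has_weak_gradient w g"
    and D: "has_weak_gradient (\<lambda>x. (w x)\<^sup>2) D"
  shows "AE x in lebesgue. D x = (2 * w x) *\<^sub>R g x"
proof (rule AE_eq_vector)
  fix i :: 'a assume i: "i \<in> Basis"
  have L: "(\<lambda>x. D x \<bullet> i) \<in> L1_loc" "(\<lambda>x. (w x *\<^sub>R g x) \<bullet> i) \<in> L1_loc" "(\<lambda>x. (w x)\<^sup>2) \<in> L1_loc"
  proof -
    show "(\<lambda>x. D x \<bullet> i) \<in> L1_loc" "(\<lambda>x. (w x)\<^sup>2) \<in> L1_loc"
      using D by (auto simp: has_weak_gradient_def intro: L1_loc_inner)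
    show "(\<lambda>x. (w x *\<^sub>R g x) \<bullet> i) \<in> L1_loc"
      by (rule L1_loc_inner[OF L2_loc_mult[OF w(1,2)]])
  qed
  have L2: "(\<lambda>x. 2 * ((w x *\<^sub>R g x) \<bullet> i)) \<in> L1_loc"
    by (rule L1_loc_cmult[OF L(2)])
  have "AE x in lebesgue. D x \<bullet> i - 2 * ((w x *\<^sub>R g x) \<bullet> i) = 0"
  proof (rule AE_eq_0_if_kern_integrals_0[OF L1_loc_diff[OF L(1) L2]])
    fix y :: 'a and r :: real assume r: "r > 0"
    let ?\<psi> = "\<lambda>x. kern r (y - x)" and ?\<psi>' = "\<lambda>x. - kern_grad r (y - x)"
    have t: "?\<psi> \<in> test_functions"
      by (rule bumps_test_function[OF kern_bump])
    have G: "GDERIV ?\<psi> x :> ?\<psi>' x" for x by (rule kern_reflected_GDERIV)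
    have z: "?\<psi> x = 0" "?\<psi>' x = 0" if "norm x \<ge> norm y + r" for x
    proof -
      have "norm x - norm y \<le> norm (y - x)" by (metis norm_minus_commute norm_triangle_ineq2)
      then have "norm (y - x) \<ge> r" using that by linarith
      then show "?\<psi> x = 0" "?\<psi>' x = 0"
        using kern_eq_0[OF r, of "y - x"] kern_grad_eq_0[OF r, of "y - x"] by auto
    qed
    have c: "continuous_on UNIV ?\<psi>'"
      by (intro continuous_intros continuous_on_compose2[OF kern_grad_continuous]) auto
    have b: "(\<lambda>x. ?\<psi>' x \<bullet> i) \<in> bumps y r"
    proof -
      obtain E where E: "\<And>x. GDERIV ?\<psi> x :> E x" "\<And>b. (\<lambda>x. E x \<bullet> b) \<in> bumps y r"
        using bumps_GDERIV[OF kern_bump[of r y]] by blast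
      have "(\<lambda>x. E x \<bullet> i) = (\<lambda>x. ?\<psi>' x \<bullet> i)"
        using GDERIV_pderiv_at[OF E(1), of _ i] GDERIV_pderiv_at[OF G, of _ i] by (metis (no_types))
      then show ?thesis using E(2)[of i] by (simp only:)
    qed
    let ?p = "\<lambda>n t. real (Suc n) * damp (real (Suc n)) t" and ?p' = "\<lambda>n t. real (Suc n) * damp' (real (Suc n)) t"
    define E where "E n x = ?p n (w x) * (?\<psi>' x \<bullet> i) + ?\<psi> x * (?p' n (w x) * (g x \<bullet> i))" for n x
    have pos: "real (Suc n) > 0" for n by simp
    have E0: "(\<integral>x. E n x \<partial>lebesgue) = 0" and Ei: "integrable lebesgue (E n)" for n
    proof -
      let ?A = "real (Suc n) * (1 + 1 / real (Suc n)) + 1"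
      have p1: "(?p n has_real_derivative ?p' n s) (at s)" for s
        by (rule DERIV_cmult[OF damp_DERIV[OF pos]])
      have p2: "continuous_on UNIV (?p' n)"
        by (intro continuous_intros damp'_continuous pos)
      have p3: "\<bar>?p n s\<bar> \<le> ?A" for s
      proof -
        have "real (Suc n) * damp (real (Suc n)) s \<le> real (Suc n)" "real (Suc n) * damp (real (Suc n)) s \<ge> 0"
          using damp_mult_le(2)[OF pos] damp_nonneg[OF pos] by auto
        moreover have "real (Suc n) \<le> ?A" by (simp add: field_simps)
        ultimately show ?thesis by linarith
      qed
      have p4: "\<bar>?p' n s\<bar> \<le> ?A" for s
      proof -
        have "real (Suc n) * \<bar>damp' (real (Suc n)) s\<bar> \<le> real (Suc n) * (1 + 1 / real (Suc n))"
          by (intro mult_left_mono damp'_bound pos) auto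
        then show ?thesis unfolding abs_mult abs_of_nat by linarith
      qed
      \<comment> \<open>The second factor is the constant 1, so only the chain rule for
        \<open>w\<close> remains.\<close>
      have q1: "((\<lambda>s. 1) has_real_derivative (\<lambda>s. 0) s) (at s)" for s :: real by simp
      have A1: "1 \<le> ?A" by simp
      then have q3: "\<bar>1\<bar> \<le> ?A" and q4: "\<bar>0\<bar> \<le> ?A" by linarith+
      note C = weak_gradient_product_chain[OF w(3) w(3) p1 p2 p3 p4 q1 continuous_on_const q3 q4 G c z i]
      show "(\<integral>x. E n x \<partial>lebesgue) = 0" "integrable lebesgue (E n)"
        using C unfolding E_def by simp_all
    qed
    define E' where "E' x = (w x)\<^sup>2 * (?\<psi>' x \<bullet> i) + ?\<psi> x * (2 * ((w x *\<^sub>R g x) \<bullet> i))" for x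
    have i1: "integrable lebesgue (\<lambda>x. (w x)\<^sup>2 * (?\<psi>' x \<bullet> i))" 
      and i2: "integrable lebesgue (\<lambda>x. ?\<psi> x * (2 * ((w x *\<^sub>R g x) \<bullet> i)))"
      by (rule bumps_integrable[OF L(3) b], rule bump_times_integrable[OF L2 kern_bump])
    have "(\<lambda>n. \<integral>x. E n x \<partial>lebesgue) \<longlonglongrightarrow> (\<integral>x. E' x \<partial>lebesgue)"
    proof (rule integral_dominated_convergence)
      show "integrable lebesgue (\<lambda>x. \<bar>(w x)\<^sup>2 * (?\<psi>' x \<bullet> i)\<bar> + \<bar>?\<psi> x * (2 * ((w x *\<^sub>R g x) \<bullet> i))\<bar>)"
        by (intro Bochner_Integration.integrable_add integrable_abs i1 i2)
      show "E' \<in> borel_measurable lebesgue" "E n \<in> borel_measurable lebesgue" for n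
        using i1 i2 Ei unfolding E'_def by auto
      show "AE x in lebesgue. norm (E n x) \<le> \<bar>(w x)\<^sup>2 * (?\<psi>' x \<bullet> i)\<bar> + \<bar>?\<psi> x * (2 * ((w x *\<^sub>R g x) \<bullet> i))\<bar>" for n
      proof (rule AE_I2)
        fix x
        have "\<bar>?p n (w x)\<bar> \<le> \<bar>(w x)\<^sup>2\<bar>"
          using damp_mult_le(1)[OF pos, of n "w x"] damp_nonneg[OF pos, of n "w x"] by simp
        then have "\<bar>?p n (w x) * (?\<psi>' x \<bullet> i)\<bar> \<le> \<bar>(w x)\<^sup>2 * (?\<psi>' x \<bullet> i)\<bar>"
          unfolding abs_mult[of "?p n (w x)"] abs_mult[of "(w x)\<^sup>2"] by (rule mult_right_mono) simp
        moreover have "\<bar>?p' n (w x)\<bar> \<le> 2 * \<bar>w x\<bar>"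
          using damp'_le[OF pos, of n "w x"] by (simp add: abs_mult)
        then have "\<bar>?p' n (w x) * (g x \<bullet> i)\<bar> \<le> \<bar>2 * ((w x *\<^sub>R g x) \<bullet> i)\<bar>"
          using mult_right_mono[of "\<bar>?p' n (w x)\<bar>" "2 * \<bar>w x\<bar>" "\<bar>g x \<bullet> i\<bar>"] by (simp add: abs_mult)
        then have "\<bar>?\<psi> x * (?p' n (w x) * (g x \<bullet> i))\<bar> \<le> \<bar>?\<psi> x * (2 * ((w x *\<^sub>R g x) \<bullet> i))\<bar>"
          unfolding abs_mult[of "?\<psi> x"] by (rule mult_left_mono) simp
        ultimately show "norm (E n x) \<le> \<bar>(w x)\<^sup>2 * (?\<psi>' x \<bullet> i)\<bar> + \<bar>?\<psi> x * (2 * ((w x *\<^sub>R g x) \<bullet> i))\<bar>"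
          unfolding E_def real_norm_def by (intro order_trans[OF abs_triangle_ineq] add_mono)
      qed
      show "AE x in lebesgue. (\<lambda>n. E n x) \<longlonglongrightarrow> E' x"
      proof (rule AE_I2)
        fix x
        have inv: "(\<lambda>n. inverse (real (Suc n))) \<longlonglongrightarrow> 0" by (rule LIMSEQ_inverse_real_of_nat)
        have "(\<lambda>n. (w x)\<^sup>2 / (1 + inverse (real (Suc n)) * (w x)\<^sup>2)) \<longlonglongrightarrow> (w x)\<^sup>2 / (1 + 0 * (w x)\<^sup>2)"
          by (intro tendsto_intros inv) simp
        moreover have "(w x)\<^sup>2 / (1 + inverse (real (Suc n)) * (w x)\<^sup>2) = ?p n (w x)" for n
          by (simp add: damp_def field_simps)
        ultimately have 1: "(\<lambda>n. ?p n (w x)) \<longlonglongrightarrow> (w x)\<^sup>2" by simp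
        have "(\<lambda>n. 2 * w x / (1 + inverse (real (Suc n)) * (w x)\<^sup>2)\<^sup>2) \<longlonglongrightarrow> 2 * w x / (1 + 0 * (w x)\<^sup>2)\<^sup>2"
          by (intro tendsto_intros inv) simp
        moreover have "2 * w x / (1 + inverse (real (Suc n)) * (w x)\<^sup>2)\<^sup>2 = ?p' n (w x)" for n
        proof -
          have "1 + inverse (real (Suc n)) * (w x)\<^sup>2 = (real (Suc n) + (w x)\<^sup>2) / real (Suc n)"
            by (simp add: field_simps)
          then show ?thesis by (simp add: damp'_def power_divide power2_eq_square)
        qed
        ultimately have 2: "(\<lambda>n. ?p' n (w x)) \<longlonglongrightarrow> 2 * w x" by simp
        have "(\<lambda>n. E n x) \<longlonglongrightarrow> (w x)\<^sup>2 * (?\<psi>' x \<bullet> i) + ?\<psi> x * (2 * w x * (g x \<bullet> i))"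
          unfolding E_def by (intro tendsto_add tendsto_mult tendsto_const 1 2)
        then show "(\<lambda>n. E n x) \<longlonglongrightarrow> E' x" by (simp add: E'_def mult.assoc)
      qed
    qed
    then have "(\<integral>x. E' x \<partial>lebesgue) = 0" by (simp add: E0 LIMSEQ_const_iff)
    then have "(\<integral>x. (w x)\<^sup>2 * (?\<psi>' x \<bullet> i) \<partial>lebesgue) = - (\<integral>x. ?\<psi> x * (2 * ((w x *\<^sub>R g x) \<bullet> i)) \<partial>lebesgue)"
      unfolding E'_def Bochner_Integration.integral_add[OF i1 i2] by linarith
    moreover have "(\<integral>x. (w x)\<^sup>2 * (?\<psi>' x \<bullet> i) \<partial>lebesgue) = - (\<integral>x. (D x \<bullet> i) * ?\<psi> x \<partial>lebesgue)"
      using D[unfolded has_weak_gradient_def, THEN conjunct2, THEN conjunct2, THEN bspec, OF t, THEN bspec, OF i]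
      by (simp add: GDERIV_pderiv_at[OF G])
    ultimately have "(\<integral>x. (D x \<bullet> i) * ?\<psi> x \<partial>lebesgue) - (\<integral>x. (2 * ((w x *\<^sub>R g x) \<bullet> i)) * ?\<psi> x \<partial>lebesgue) = 0"
      by (simp add: mult.commute[of "?\<psi> _"])
    then show "(\<integral>x. (D x \<bullet> i - 2 * ((w x *\<^sub>R g x) \<bullet> i)) * ?\<psi> x \<partial>lebesgue) = 0"
      unfolding left_diff_distrib
      by (subst Bochner_Integration.integral_diff[OF bumps_integrable[OF L(1) kern_bump] bumps_integrable[OF L2 kern_bump]])
  qed
  then show "AE x in lebesgue. D x \<bullet> i = (2 * w x) *\<^sub>R g x \<bullet> i"
    by eventually_elim simp
qed

section \<open>The divergence identity for a weight\<close>

text \<open>With \<open>V = \<nabla>\<mu> / 2 + \<mu> Y\<close>, \<open>H = m / (m + \<mu>)\<close> and \<open>Q = \<nabla>a\<close>, this is the expanded form of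
  \<open>a div (z H V) + z H V \<bullet> \<nabla>a\<close>, where \<open>M\<close>, \<open>d\<close>, \<open>l\<close> stand for \<open>\<mu>\<close>, \<open>\<nabla>\<mu>\<close>, \<open>\<Delta>\<mu>\<close> and \<open>z'\<close> for \<open>\<nabla>z\<close>. The factor
  \<open>H\<close> is needed because \<open>\<nabla>\<mu> = 2 w \<nabla>w\<close> is only in \<open>L\<^sup>1\<close>, whereas \<open>H \<nabla>\<mu>\<close> is in \<open>L\<^sup>2\<close>.\<close>

definition field_term ::
  "real \<Rightarrow> real \<Rightarrow> real \<Rightarrow> 'a::euclidean_space \<Rightarrow> 'a \<Rightarrow> real \<Rightarrow> real \<Rightarrow> 'a \<Rightarrow> real \<Rightarrow> 'a \<Rightarrow> real" where
  "field_term m a z z' Y dY M d l Q =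
     a * (m / (m + M) * (z' \<bullet> (d /\<^sub>R 2 + M *\<^sub>R Y)) - z * (m / (m + M)\<^sup>2 * (d \<bullet> (d /\<^sub>R 2 + M *\<^sub>R Y)))
        + z * (m / (m + M) * (l / 2 + d \<bullet> Y + M * dY)))
     + z * (m / (m + M) * ((d /\<^sub>R 2 + M *\<^sub>R Y) \<bullet> Q))"

lemma abs_inner_le: "norm x \<le> a \<Longrightarrow> norm y \<le> b \<Longrightarrow> \<bar>x \<bullet> y\<bar> \<le> a * b"
  by (meson Cauchy_Schwarz_ineq2 mult_mono norm_ge_zero order_trans)

lemma saturation_bounds:
  fixes m M :: real
  assumes "m > 0" "M \<ge> 0"
  shows "0 \<le> m / (m + M)" "m / (m + M) \<le> 1" "m / (m + M) * M \<le> m"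
    "0 \<le> m / (m + M)\<^sup>2" "m / (m + M)\<^sup>2 * M \<le> 1"
proof -
  have pos: "m + M > 0" using assms by linarith
  show "0 \<le> m / (m + M)" "m / (m + M) \<le> 1" "0 \<le> m / (m + M)\<^sup>2"
    using assms pos by (auto simp: divide_le_eq)
  have "m * M \<le> m * (m + M)" using assms by (intro mult_left_mono) auto
  then show "m / (m + M) * M \<le> m" using pos by (simp add: divide_le_eq)
  have "m * M \<le> (m + M)\<^sup>2"
    using assms by (simp add: power2_eq_square algebra_simps)
  then show "m / (m + M)\<^sup>2 * M \<le> 1" using pos by (simp add: divide_le_eq)
qed

text \<open>Majorant for removing the mollification at fixed \<open>m\<close>; \<open>q\<close>
  stands for the mollified |grad w|^2 and \<open>K\<close> for the dimension. The term quadratic in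
  \<open>d\<close> is absorbed by M m / (m + M)^2 \<le> 1. In the pairing with \<open>Q\<close>,
  Young's inequality is used with (m |d| / (m + M))^2 \<le> 4 K m q, which is where the dependence
  on \<open>m\<close> and the unweighted square of \<open>Q\<close> come from.\<close>

lemma field_term_bound:
  assumes m: "m > 0" and M: "0 \<le> M" "M \<le> G" and q: "0 \<le> q" "q \<le> G" and l: "\<bar>l\<bar> \<le> G"
    and d: "norm d \<le> K * G" "(norm d)\<^sup>2 \<le> 4 * K * M * q"
    and a: "\<bar>a\<bar> \<le> A" and z: "\<bar>z\<bar> \<le> C" "norm z' \<le> B" and Y: "norm Y \<le> N" "\<bar>dY\<bar> \<le> N'" and K: "K \<ge> 0"
  shows "\<bar>field_term m a z z' Y dY M d l Q\<bar> \<le>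
    A * (B * ((K / 2 + N) * G) + C * ((2 * K + K * N) * G) + C * ((1 / 2 + K * N + N') * G))
     + C * (K * m * G + (norm Q)\<^sup>2 + m * N * (1 + (norm Q)\<^sup>2))"
proof -
  let ?V = "d /\<^sub>R 2 + M *\<^sub>R Y" and ?H = "m / (m + M)" and ?H' = "m / (m + M)\<^sup>2"
  note s = saturation_bounds[OF m M(1)]
  have nn: "0 \<le> A" "0 \<le> B" "0 \<le> C" "0 \<le> N" "0 \<le> N'" "0 \<le> G"
    using a z Y M norm_ge_zero[of z'] norm_ge_zero[of Y] by linarith+
  have H: "\<bar>?H\<bar> \<le> 1" using s(1,2) by linarith
  have HM: "\<bar>?H * M\<bar> \<le> m" using s(3) mult_nonneg_nonneg[OF s(1) M(1)] by linarith
  have V: "norm ?V \<le> (K / 2 + N) * G"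
  proof -
    have "norm ?V \<le> norm (d /\<^sub>R 2) + norm (M *\<^sub>R Y)" by (rule norm_triangle_ineq)
    also have "\<dots> = norm d / 2 + M * norm Y" using M by simp
    also have "\<dots> \<le> K * G / 2 + G * N"
      using d(1) M Y(1) nn by (intro add_mono mult_mono) auto
    finally show ?thesis by (simp add: algebra_simps)
  qed
  have T1: "\<bar>?H * (z' \<bullet> ?V)\<bar> \<le> B * ((K / 2 + N) * G)"
  proof -
    have "\<bar>?H\<bar> * \<bar>z' \<bullet> ?V\<bar> \<le> 1 * (B * ((K / 2 + N) * G))"
      by (rule mult_mono[OF H abs_inner_le[OF z(2) V]]) auto
    then show ?thesis by (simp only: abs_mult mult_1)
  qed
  have T2: "\<bar>?H' * (d \<bullet> ?V)\<bar> \<le> (2 * K + K * N) * G"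
  proof -
    have eq: "d \<bullet> ?V = (norm d)\<^sup>2 / 2 + M * (d \<bullet> Y)"
      by (simp add: inner_add_right power2_norm_eq_inner)
    have "\<bar>d \<bullet> Y\<bar> \<le> K * G * N" by (rule abs_inner_le[OF d(1) Y(1)])
    then have "\<bar>M * (d \<bullet> Y)\<bar> \<le> M * (K * G * N)"
      using M by (simp add: abs_mult mult_left_mono)
    moreover have "0 \<le> (norm d)\<^sup>2 / 2" "(norm d)\<^sup>2 / 2 \<le> M * (2 * K * q)" using d(2) by (simp_all add: mult_ac)
    ultimately have "\<bar>d \<bullet> ?V\<bar> \<le> M * (2 * K * q + K * G * N)"
      unfolding eq distrib_left[of M] by linarith
    then have "\<bar>?H' * (d \<bullet> ?V)\<bar> \<le> ?H' * (M * (2 * K * q + K * G * N))"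
      using s(4) by (simp only: abs_mult abs_of_nonneg mult_left_mono)
    also have "\<dots> = (?H' * M) * (2 * K * q + K * G * N)" by (simp only: mult.assoc)
    also have "\<dots> \<le> 1 * (2 * K * G + K * G * N)"
      using s(5) q K nn by (intro mult_mono add_mono mult_left_mono) auto
    finally show ?thesis by (simp add: algebra_simps)
  qed
  have T3: "\<bar>?H * (l / 2 + d \<bullet> Y + M * dY)\<bar> \<le> (1 / 2 + K * N + N') * G"
  proof -
    have 1: "\<bar>d \<bullet> Y\<bar> \<le> K * G * N" by (rule abs_inner_le[OF d(1) Y(1)])
    have 2: "\<bar>M * dY\<bar> \<le> G * N'" unfolding abs_mult using M Y nn by (intro mult_mono) auto
    have "\<bar>l / 2 + d \<bullet> Y + M * dY\<bar> \<le> G / 2 + K * G * N + G * N'"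
      using 1 2 l by linarith
    then have "\<bar>?H\<bar> * \<bar>l / 2 + d \<bullet> Y + M * dY\<bar> \<le> 1 * (G / 2 + K * G * N + G * N')"
      by (rule mult_mono[OF H]) auto
    then show ?thesis unfolding abs_mult[symmetric] by (simp add: algebra_simps)
  qed
  have T4: "\<bar>?H * (?V \<bullet> Q)\<bar> \<le> K * m * G + (norm Q)\<^sup>2 + m * N * (1 + (norm Q)\<^sup>2)"
  proof -
    have eq: "?H * (?V \<bullet> Q) = ?H * (d \<bullet> Q) / 2 + (?H * M) * (Y \<bullet> Q)"
      by (simp add: inner_add_left algebra_simps)
    define T where "T = ?H * norm d"
    have "T\<^sup>2 \<le> 4 * (K * m * G)"
    proof -
      have "(?H * norm d)\<^sup>2 \<le> ?H\<^sup>2 * (4 * K * M * q)"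
        unfolding power_mult_distrib using d(2) by (rule mult_left_mono) simp
      also have "\<dots> = ?H * ((?H * M) * (4 * K * q))" by (simp add: power2_eq_square)
      also have "\<dots> \<le> 1 * (m * (4 * K * G))"
        using s m M q K nn by (intro mult_mono) auto
      finally show ?thesis by (simp add: T_def mult_ac)
    qed
    moreover have "2 * T * norm Q \<le> T\<^sup>2 + (norm Q)\<^sup>2"
      by (rule sum_squares_bound)
    moreover have "\<bar>?H * (d \<bullet> Q)\<bar> \<le> T * norm Q"
      using s(1) unfolding T_def mult.assoc
      by (simp only: abs_mult abs_of_nonneg) (rule mult_left_mono[OF Cauchy_Schwarz_ineq2])
    moreover have "h / 2 \<le> k + Q2" if "T2 \<le> 4 * k" "2 * T * n \<le> T2 + Q2" "h \<le> T * n" "0 \<le> Q2"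
      for h k Q2 T2 n :: real
      using that by (simp add: mult.assoc)
    ultimately have "\<bar>?H * (d \<bullet> Q)\<bar> / 2 \<le> K * m * G + (norm Q)\<^sup>2"
      using zero_le_power2[of "norm Q"] by blast
    then have 1: "\<bar>?H * (d \<bullet> Q) / 2\<bar> \<le> K * m * G + (norm Q)\<^sup>2"
      by (simp only: abs_divide abs_numeral)
    have "norm Q \<le> 1 + (norm Q)\<^sup>2"
      using sum_squares_bound[of "norm Q" 1] norm_ge_zero[of Q] by (simp only: power_one mult_1_right; linarith?)
    then have "\<bar>Y \<bullet> Q\<bar> \<le> N * (1 + (norm Q)\<^sup>2)"
      by (rule abs_inner_le[OF Y(1)])
    then have "\<bar>?H * M\<bar> * \<bar>Y \<bullet> Q\<bar> \<le> m * (N * (1 + (norm Q)\<^sup>2))"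
      using m by (intro mult_mono[OF HM]) auto
    then have 2: "\<bar>(?H * M) * (Y \<bullet> Q)\<bar> \<le> m * N * (1 + (norm Q)\<^sup>2)"
      by (simp only: abs_mult mult.assoc)
    show ?thesis unfolding eq using 1 2 by linarith
  qed
  have S: "\<bar>z * t\<bar> \<le> C * b" if "\<bar>t\<bar> \<le> b" for t b
    unfolding abs_mult using that z(1) nn by (intro mult_mono) auto
  have "\<bar>?H * (z' \<bullet> ?V) - z * (?H' * (d \<bullet> ?V)) + z * (?H * (l / 2 + d \<bullet> Y + M * dY))\<bar>
     \<le> B * ((K / 2 + N) * G) + C * ((2 * K + K * N) * G) + C * ((1 / 2 + K * N + N') * G)"
    using T1 S[OF T2] S[OF T3] by linarith
  then have "\<bar>a * (?H * (z' \<bullet> ?V) - z * (?H' * (d \<bullet> ?V)) + z * (?H * (l / 2 + d \<bullet> Y + M * dY)))\<bar>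
     \<le> A * (B * ((K / 2 + N) * G) + C * ((2 * K + K * N) * G) + C * ((1 / 2 + K * N + N') * G))"
    unfolding abs_mult[of a] using a by (intro mult_mono) auto
  then show ?thesis
    unfolding field_term_def using S[OF T4] by linarith
qed

lemma field_term_tendsto:
  assumes "M \<longlonglongrightarrow> M0" "d \<longlonglongrightarrow> d0" "l \<longlonglongrightarrow> l0" "m > 0" "M0 \<ge> 0"
  shows "(\<lambda>n. field_term m a z z' Y dY (M n) (d n) (l n) Q) \<longlonglongrightarrow> field_term m a z z' Y dY M0 d0 l0 Q"
  unfolding field_term_def using assms by (intro tendsto_intros) auto

lemma field_term_measurable [measurable]:
  assumes [measurable]: "a \<in> borel_measurable N" "z \<in> borel_measurable N" "z' \<in> borel_measurable N"
    "Y \<in> borel_measurable N" "dY \<in> borel_measurable N" "M \<in> borel_measurable N" "d \<in> borel_measurable N"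
    "l \<in> borel_measurable N" "Q \<in> borel_measurable N"
  shows "(\<lambda>x. field_term m (a x) (z x) (z' x) (Y x) (dY x) (M x) (d x) (l x) (Q x)) \<in> borel_measurable N"
  unfolding field_term_def by measurable

text \<open>Optimisation over the parameter: t = |d| / (2 m) gives the claim, and if m = 0 a large
  \<open>t\<close> forces d = 0. In this way Cauchy-Schwarz for integrals follows from pointwise
  Young inequalities.\<close>

lemma sq_le_of_weighted_bounds:
  fixes d m q :: real
  assumes "m \<ge> 0" "q \<ge> 0" "\<And>t. t > 0 \<Longrightarrow> \<bar>d\<bar> \<le> t * m + q / t"
  shows "d\<^sup>2 \<le> 4 * m * q"
proof (cases "d = 0")
  case False
  then have d: "\<bar>d\<bar> > 0" by simp
  have "m > 0"
  proof (rule ccontr)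
    assume "\<not> m > 0"
    then have "m = 0" using assms(1) by simp
    then have "\<bar>d\<bar> \<le> q / ((q + 1) / \<bar>d\<bar>)"
      using assms(3)[of "(q + 1) / \<bar>d\<bar>"] assms(2) d by simp
    also have "\<dots> < \<bar>d\<bar>" using assms(2) d by (simp add: field_simps)
    finally show False by simp
  qed
  then have "\<bar>d\<bar> \<le> \<bar>d\<bar> / (2 * m) * m + q / (\<bar>d\<bar> / (2 * m))"
    using d by (intro assms(3)) simp
  also have "\<dots> = \<bar>d\<bar> / 2 + 2 * m * q / \<bar>d\<bar>" using \<open>m > 0\<close> by simp
  finally have "\<bar>d\<bar> / 2 \<le> 2 * m * q / \<bar>d\<bar>" by simp
  then have "\<bar>d\<bar> / 2 * \<bar>d\<bar> \<le> 2 * m * q" using d by (simp only: pos_le_divide_eq)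
  then show ?thesis by (simp add: power2_eq_square)
qed (use assms in simp)

text \<open>Here \<open>w\<close> is the square root of \<mu> and \<open>g\<close> its weak
  gradient, while \<open>D\<close> and \<open>l\<close> are the weak gradient and Laplacian of \<mu>
  itself. The two gradients are independent data, linked almost everywhere by
  \<open>D_eq\<close>.\<close>

locale weight =
  fixes w l :: "'a::euclidean_space \<Rightarrow> real" and g D :: "'a \<Rightarrow> 'a"
  assumes w_nonneg: "\<And>x. 0 \<le> w x" and w: "w \<in> L2_loc" and g: "g \<in> L2_loc"
    and wg: "has_weak_gradient w g"
    and wD: "has_weak_gradient (\<lambda>x. (w x)\<^sup>2) D" and wl: "has_weak_Laplacian (\<lambda>x. (w x)\<^sup>2) l"
begin

lemma D_eq: "AE x in lebesgue. D x = (2 * w x) *\<^sub>R g x"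
  by (rule weak_gradient_square[OF w g wg wD])

lemma loc: "(\<lambda>x. (w x)\<^sup>2) \<in> L1_loc" "(\<lambda>x. (norm (g x))\<^sup>2) \<in> L1_loc" "l \<in> L1_loc" "D \<in> L1_loc"
  using L2_loc_square[OF g] wD wl by (auto simp: has_weak_gradient_def has_weak_Laplacian_def)

lemma meas [measurable]:
  "w \<in> borel_measurable lebesgue" "g \<in> borel_measurable lebesgue"
  "l \<in> borel_measurable lebesgue" "D \<in> borel_measurable lebesgue"
  using w g L1_loc_measurable[OF loc(3)] L1_loc_measurable[OF loc(4)] by (auto simp: L2_loc_def)

text \<open>This is what dominates the mollified \<open>\<nabla>\<mu>\<close> by quantities converging in \<open>L\<^sup>1\<close>.\<close>

lemma conv_gradient_square_le:
  assumes i: "i \<in> Basis" and r: "r > 0"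
  shows "(conv (cut R (\<lambda>x. D x \<bullet> i)) (kern r) y)\<^sup>2
    \<le> 4 * conv (cut R (\<lambda>x. (w x)\<^sup>2)) (kern r) y * conv (cut R (\<lambda>x. (norm (g x))\<^sup>2)) (kern r) y"
proof (rule sq_le_of_weighted_bounds)
  let ?k = "\<lambda>x. kern r (y - x)"
  have k: "?k x \<ge> 0" for x by (rule kern_nonneg[OF r])
  show "0 \<le> conv (cut R (\<lambda>x. (w x)\<^sup>2)) (kern r) y" "0 \<le> conv (cut R (\<lambda>x. (norm (g x))\<^sup>2)) (kern r) y"
    unfolding conv_def using k by (auto intro!: Bochner_Integration.integral_nonneg simp: cut_def)
  fix t :: real assume t: "t > 0"
  have I: "integrable lebesgue (\<lambda>x. cut R (\<lambda>x. D x \<bullet> i) x * ?k x)"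
    "integrable lebesgue (\<lambda>x. cut R (\<lambda>x. (w x)\<^sup>2) x * ?k x)"
    "integrable lebesgue (\<lambda>x. cut R (\<lambda>x. (norm (g x))\<^sup>2) x * ?k x)"
    using loc r by (auto intro!: conv_kern_integrable cut_integrable L1_loc_inner)
  have "\<bar>conv (cut R (\<lambda>x. D x \<bullet> i)) (kern r) y\<bar> \<le> (\<integral>x. \<bar>cut R (\<lambda>x. D x \<bullet> i) x * ?k x\<bar> \<partial>lebesgue)"
    unfolding conv_def real_scaleR_def real_norm_def[symmetric] by (rule integral_norm_bound)
  also have "\<dots> \<le> (\<integral>x. t * (cut R (\<lambda>x. (w x)\<^sup>2) x * ?k x) + cut R (\<lambda>x. (norm (g x))\<^sup>2) x * ?k x / t \<partial>lebesgue)"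
  proof (rule integral_mono_AE)
    show "AE x in lebesgue. \<bar>cut R (\<lambda>x. D x \<bullet> i) x * ?k x\<bar>
        \<le> t * (cut R (\<lambda>x. (w x)\<^sup>2) x * ?k x) + cut R (\<lambda>x. (norm (g x))\<^sup>2) x * ?k x / t"
      using D_eq
    proof eventually_elim
      case (elim x)
      have "\<bar>g x \<bullet> i\<bar> \<le> norm (g x)" by (rule Basis_le_norm[OF i])
      then have "\<bar>D x \<bullet> i\<bar> \<le> 2 * w x * norm (g x)"
        using w_nonneg[of x] by (simp add: elim abs_mult mult_left_mono)
      \<comment> \<open>Young's inequality with a free weight \<open>t\<close>, to be optimised only
        after integration.\<close>
      also have "\<dots> = 2 * (sqrt t * w x) * (norm (g x) / sqrt t)" using t by simp
      also have "\<dots> \<le> (sqrt t * w x)\<^sup>2 + (norm (g x) / sqrt t)\<^sup>2" by (rule sum_squares_bound)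
      also have "\<dots> = t * (w x)\<^sup>2 + (norm (g x))\<^sup>2 / t"
        using t by (simp add: power_mult_distrib power_divide)
      finally have "\<bar>D x \<bullet> i\<bar> * ?k x \<le> (t * (w x)\<^sup>2 + (norm (g x))\<^sup>2 / t) * ?k x"
        using k by (rule mult_right_mono)
      then show ?case
        using k[of x] by (simp add: cut_def indicator_def abs_mult distrib_right)
    qed
  qed (use I in auto)
  also have "\<dots> = t * conv (cut R (\<lambda>x. (w x)\<^sup>2)) (kern r) y + conv (cut R (\<lambda>x. (norm (g x))\<^sup>2)) (kern r) y / t"
    using I by (simp add: conv_def)
  finally show "\<bar>conv (cut R (\<lambda>x. D x \<bullet> i)) (kern r) y\<bar>
      \<le> t * conv (cut R (\<lambda>x. (w x)\<^sup>2)) (kern r) y + conv (cut R (\<lambda>x. (norm (g x))\<^sup>2)) (kern r) y / t" .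
qed

end

section \<open>The divergence identity with a saturated weight\<close>

lemma integrable_imp_L1_loc:
  fixes f :: "'a::euclidean_space \<Rightarrow> real"
  assumes "integrable lebesgue f" shows "f \<in> L1_loc"
  unfolding L1_loc_def set_integrable_def
  using integrable_mult_indicator[OF _ assms] by (auto simp: borel_compact)

lemma L1_loc_integrable_cball:
  fixes f :: "'a::euclidean_space \<Rightarrow> real"
  assumes "f \<in> L1_loc"
  shows "integrable lebesgue (\<lambda>x. indicator (cball 0 R) x * f x)"
  using assms compact_cball[of 0 R] by (simp add: L1_loc_def set_integrable_def)

lemma field_term_0 [simp]: "field_term m a 0 0 Y dY M d l Q = 0"
  by (simp add: field_term_def)

lemma saturation_DERIV:
  assumes "m > 0" "t \<ge> 0"
  shows "((\<lambda>t. m / (m + t)) has_real_derivative - (m / (m + t)\<^sup>2)) (at t)"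
proof -
  have "m + t \<noteq> 0" using assms by linarith
  then show ?thesis
    by (auto intro!: derivative_eq_intros simp: power2_eq_square)
qed

lemma DERIV_continuous_UNIV:
  fixes f :: "real \<Rightarrow> real"
  shows "(\<And>s. (f has_real_derivative f' s) (at s)) \<Longrightarrow> continuous_on UNIV f"
  by (meson DERIV_continuous_on has_field_derivative_at_within)

text \<open>The product p(u) q(w) is the factor \<open>a\<close> of \<open>field_term\<close> and
  \<zeta> the factor \<open>z\<close>. The weakly differentiable factor is kept apart from the C^1
  data \<zeta> and \<open>Y\<close>, because they enter the product rule in different roles.\<close>

locale weighted_field = weight w l g D
  for w l :: "'a::euclidean_space \<Rightarrow> real" and g D :: "'a \<Rightarrow> 'a" +
  fixes u \<zeta> :: "'a \<Rightarrow> real" and P \<zeta>' Y :: "'a \<Rightarrow> 'a" and Y' :: "'a \<Rightarrow> 'a \<Rightarrow> 'a"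
    and p p' q q' :: "real \<Rightarrow> real" and A R :: real
  assumes u: "has_weak_gradient u P"
    and p: "\<And>s. (p has_real_derivative p' s) (at s)" "continuous_on UNIV p'" "\<And>s. \<bar>p s\<bar> \<le> A" "\<And>s. \<bar>p' s\<bar> \<le> A"
    and q: "\<And>s. (q has_real_derivative q' s) (at s)" "continuous_on UNIV q'" "\<And>s. \<bar>q s\<bar> \<le> A" "\<And>s. \<bar>q' s\<bar> \<le> A"
    and \<zeta>: "\<And>x. GDERIV \<zeta> x :> \<zeta>' x" "continuous_on UNIV \<zeta>'"
      "\<And>x. norm x \<ge> R \<Longrightarrow> \<zeta> x = 0" "\<And>x. norm x \<ge> R \<Longrightarrow> \<zeta>' x = 0"
    and Y: "\<And>x i. i \<in> Basis \<Longrightarrow> GDERIV (\<lambda>x. Y x \<bullet> i) x :> Y' i x"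
      "\<And>i. i \<in> Basis \<Longrightarrow> continuous_on UNIV (Y' i)"
begin

definition dY :: "'a \<Rightarrow> real" where
  "dY x = (\<Sum>i\<in>Basis. Y' i x \<bullet> i)"

definition Q :: "'a \<Rightarrow> 'a" where
  "Q x = (p' (u x) * q (w x)) *\<^sub>R P x + (p (u x) * q' (w x)) *\<^sub>R g x"

lemma continuity:
  shows \<zeta>_continuous: "continuous_on UNIV \<zeta>" and p_continuous: "continuous_on UNIV p"
    and q_continuous: "continuous_on UNIV q" and Y_continuous: "continuous_on UNIV Y"
    and dY_continuous: "continuous_on UNIV dY"
    and Y_comp_continuous: "i \<in> Basis \<Longrightarrow> continuous_on UNIV (\<lambda>x. Y x \<bullet> i)"
proof -
  show "continuous_on UNIV \<zeta>" by (rule GDERIV_continuous[OF \<zeta>(1)])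
  show "continuous_on UNIV p" "continuous_on UNIV q"
    by (rule DERIV_continuous_UNIV, rule p q)+
  show c: "continuous_on UNIV (\<lambda>x. Y x \<bullet> i)" if "i \<in> Basis" for i
    by (rule GDERIV_continuous[OF Y(1)[OF that]])
  then show "continuous_on UNIV Y"
    by (intro continuous_on_componentwise[THEN iffD2]) auto
  show "continuous_on UNIV dY"
    unfolding dY_def[abs_def] by (intro continuous_intros Y(2))
qed

lemma measurability [measurable]:
  "u \<in> borel_measurable lebesgue" "P \<in> borel_measurable lebesgue"
  "p \<in> borel_measurable borel" "q \<in> borel_measurable borel"
  "p' \<in> borel_measurable borel" "q' \<in> borel_measurable borel"
  "\<zeta> \<in> borel_measurable lebesgue" "\<zeta>' \<in> borel_measurable lebesgue"
  "Y \<in> borel_measurable lebesgue" "dY \<in> borel_measurable lebesgue"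
  using u p(2) q(2) \<zeta>(2) continuity
  by (auto simp: has_weak_gradient_def intro: L1_loc_measurable borel_measurable_continuous_onI lebesgue_measurable_continuous)

lemma Q_measurable [measurable]: "Q \<in> borel_measurable lebesgue"
  unfolding Q_def[abs_def] by measurable

lemma A_nonneg: "A \<ge> 0"
  using p(3)[of 0] by linarith

lemma coefficient_bound: "\<bar>p (u x) * q (w x)\<bar> \<le> A * A"
  unfolding abs_mult using p q A_nonneg by (intro mult_mono) auto

text \<open>Once \<mu> is mollified, every component of the saturated field times \<zeta> is a C^1
  test function for \<open>weak_gradient_product_chain\<close>. Summation over the components turns
  the second derivatives into the mollified Laplacian, and \<open>field_term_bound\<close> then
  removes the mollification.\<close>

lemma field_identity_saturated:
  assumes m: "m > 0" and Q2: "(\<lambda>x. (norm (Q x))\<^sup>2) \<in> L1_loc"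
  defines "E \<equiv> \<lambda>x. field_term m (p (u x) * q (w x)) (\<zeta> x) (\<zeta>' x) (Y x) (dY x) ((w x)\<^sup>2) (D x) (l x) (Q x)"
  shows "(\<integral>x. E x \<partial>lebesgue) = 0"
proof -
  define \<mu>0 l0 g0 where "\<mu>0 = cut R (\<lambda>x. (w x)\<^sup>2)" and "l0 = cut R l" and "g0 = cut R (\<lambda>x. (norm (g x))\<^sup>2)"
  define D0 where "D0 i = cut R (\<lambda>x. D x \<bullet> i)" for i
  note defs = \<mu>0_def l0_def g0_def D0_def
  have I: "integrable lebesgue \<mu>0" "integrable lebesgue l0" "integrable lebesgue g0" "integrable lebesgue (D0 i)" for i
    unfolding defs using loc by (auto intro: cut_integrable L1_loc_inner)
  \<comment> \<open>The function \<open>g0\<close> is included for the majorant: its mollification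
    is the \<open>q\<close> of \<open>field_term_bound\<close>.\<close>
  define F where "F = {\<mu>0, l0, g0} \<union> D0 ` Basis"
  obtain s G where s: "\<And>n. 0 < s n" "\<And>n. s n \<le> 1" and G: "integrable lebesgue G"
    and lim: "AE x in lebesgue. \<forall>f\<in>F. (\<lambda>n. conv f (kern (s n)) x) \<longlonglongrightarrow> f x"
    and bound: "AE x in lebesgue. \<forall>f\<in>F. \<forall>n. \<bar>conv f (kern (s n)) x\<bar> \<le> G x"
  proof (rule mollifier_sequence[of F])
    show "finite F" by (simp add: F_def)
    show "integrable lebesgue f" if "f \<in> F" for f using that I by (auto simp: F_def)
  qed auto
  define M where "M n = conv \<mu>0 (kern (s n))" for n
  define d where "d n x = (\<Sum>i\<in>Basis. conv (D0 i) (kern (s n)) x *\<^sub>R i)" for n x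
  define L where "L n = conv l0 (kern (s n))" for n
  have d_inner: "d n x \<bullet> i = conv (D0 i) (kern (s n)) x" if "i \<in> Basis" for n x i
    using that by (simp add: d_def)
  have M_nonneg: "M n x \<ge> 0" for n x
    unfolding M_def conv_def \<mu>0_def cut_def
    by (intro Bochner_Integration.integral_nonneg) (auto simp: kern_nonneg[OF s(1)])
  define E' where "E' n x = field_term m (p (u x) * q (w x)) (\<zeta> x) (\<zeta>' x) (Y x) (dY x) (M n x) (d n x) (L n x) (Q x)" for n x
  have E'0: "(\<integral>x. E' n x \<partial>lebesgue) = 0" for n
  proof -
    let ?k = "kern (s n)" and ?k' = "kern_grad (s n)"
    define gM where "gM = conv \<mu>0 ?k'"
    define gd where "gd i = conv (D0 i) ?k'" for i
    note GM = conv_kern_GDERIV(1,2)[OF I(1) s(1)[of n], folded M_def gM_def]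
    note Gd = conv_kern_GDERIV(1,2)[OF I(4) s(1)[of n], folded gd_def]
    let ?H = "\<lambda>x. m / (m + M n x)" and ?H' = "\<lambda>x. m / (m + M n x)\<^sup>2"
    let ?V = "\<lambda>i x. 1 / 2 * conv (D0 i) ?k x + M n x * (Y x \<bullet> i)"
    define \<psi> where "\<psi> i x = \<zeta> x * (?H x * ?V i x)" for i x
    \<comment> \<open>Written exactly as the product rules deliver it; the summand with factor 0 is
      the derivative of the constant 1 / 2.\<close>
    define \<psi>' where "\<psi>' i x = \<zeta> x *\<^sub>R (?H x *\<^sub>R (((1 / 2) *\<^sub>R gd i x + conv (D0 i) ?k x *\<^sub>R 0)
          + (M n x *\<^sub>R Y' i x + (Y x \<bullet> i) *\<^sub>R gM x))
        + ?V i x *\<^sub>R (- ?H' x *\<^sub>R gM x)) + (?H x * ?V i x) *\<^sub>R \<zeta>' x" for i x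
    have Mc: "continuous_on UNIV (M n)" by (rule GDERIV_continuous[OF GM(1)])
    have dc: "continuous_on UNIV (conv (D0 i) ?k)" for i by (rule GDERIV_continuous[OF Gd(1)])
    have nz: "m + M n x \<noteq> 0" for x using m M_nonneg[of n x] by linarith
    have 1: "GDERIV (\<psi> i) x :> \<psi>' i x" if "i \<in> Basis" for i x
      unfolding \<psi>_def \<psi>'_def
      by (intro GDERIV_mult GDERIV_add GDERIV_const \<zeta>(1) Y(1)[OF that] GM(1) Gd(1)
          GDERIV_DERIV_compose[OF GM(1) saturation_DERIV[OF m M_nonneg]])
    have 2: "continuous_on UNIV (\<psi>' i)" if "i \<in> Basis" for i
      unfolding \<psi>'_def using nz
      by (intro continuous_intros \<zeta>_continuous \<zeta>(2) Mc dc GM(2) Gd(2) Y(2)[OF that] Y_comp_continuous[OF that]) auto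
    have 3: "\<psi> i x = 0" "\<psi>' i x = 0" if "norm x \<ge> R" for i x
      using \<zeta>(3,4)[OF that] by (simp_all add: \<psi>_def \<psi>'_def)
    define T where "T i x = p (u x) * q (w x) * (\<psi>' i x \<bullet> i)
      + \<psi> i x * (p' (u x) * q (w x) * (P x \<bullet> i) + p (u x) * q' (w x) * (g x \<bullet> i))" for i x
    have T: "integrable lebesgue (T i)" "(\<integral>x. T i x \<partial>lebesgue) = 0" if "i \<in> Basis" for i
      unfolding T_def
      by (rule weak_gradient_product_chain[OF u wg p q 1[OF that] 2[OF that] 3 that]; assumption)+
    have "(\<Sum>i\<in>Basis. T i x) = E' n x" for x
    proof (cases "norm x < R")
      case True
      then have x: "x \<in> ball 0 R" by simp
      have gMi: "gM x \<bullet> i = d n x \<bullet> i" if "i \<in> Basis" for i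
        unfolding d_inner[OF that] gM_def \<mu>0_def D0_def
        by (rule conv_cut_weak_gradient[OF wD that x s])
      \<comment> \<open>The individual second derivatives of the mollified weight are not
        controlled, only their sum is. This is why the components are added before the
        limit.\<close>
      have gdi: "(\<Sum>i\<in>Basis. gd i x \<bullet> i) = L n x"
        unfolding gd_def D0_def L_def l0_def by (rule conv_cut_weak_Laplacian[OF wD wl x s])
      let ?W = "d n x /\<^sub>R 2 + M n x *\<^sub>R Y x"
      have V: "?V i x = ?W \<bullet> i" if "i \<in> Basis" for i
        using d_inner[OF that] by (simp add: inner_add_left)
      have Ti: "T i x = p (u x) * q (w x) * (?H x * ((\<zeta>' x \<bullet> i) * (?W \<bullet> i)) - \<zeta> x * (?H' x * ((d n x \<bullet> i) * (?W \<bullet> i)))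
          + \<zeta> x * (?H x * ((gd i x \<bullet> i) / 2 + (d n x \<bullet> i) * (Y x \<bullet> i) + M n x * (Y' i x \<bullet> i))))
          + \<zeta> x * (?H x * ((?W \<bullet> i) * (Q x \<bullet> i)))" if i: "i \<in> Basis" for i
        unfolding T_def \<psi>_def \<psi>'_def V[OF i] Q_def
        by (simp only: inner_add_left inner_scaleR_left inner_minus_left inner_zero_left gMi[OF i] scaleR_zero_right)
          (simp add: algebra_simps)
      have "(\<Sum>i\<in>Basis. T i x) = E' n x"
        unfolding E'_def field_term_def dY_def
        by (subst (1 2 3 4) euclidean_inner)
          (simp only: Ti sum.distrib sum_subtractf sum_distrib_left[symmetric] sum_divide_distrib[symmetric] gdi cong: sum.cong)
      then show ?thesis .
    next
      case False
      then show ?thesis using 3[of x] \<zeta>(3,4)[of x] by (simp add: T_def E'_def)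
    qed
    then have "(\<integral>x. E' n x \<partial>lebesgue) = (\<integral>x. (\<Sum>i\<in>Basis. T i x) \<partial>lebesgue)" by simp
    also have "\<dots> = (\<Sum>i\<in>Basis. \<integral>x. T i x \<partial>lebesgue)"
      by (rule Bochner_Integration.integral_sum) (rule T(1))
    also have "\<dots> = 0" using T(2) by simp
    finally show ?thesis .
  qed

  have [measurable]: "M n \<in> borel_measurable lebesgue" "L n \<in> borel_measurable lebesgue"
      "conv (D0 i) (kern (s n)) \<in> borel_measurable lebesgue" for n i
    unfolding M_def L_def using I s(1) by (auto intro: conv_kern_measurable)
  have [measurable]: "d n \<in> borel_measurable lebesgue" for n
    unfolding d_def by measurable
  have meas: "E \<in> borel_measurable lebesgue" "E' n \<in> borel_measurable lebesgue" for n
    unfolding E_def E'_def by measurable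

  obtain B where B: "B > 0" "\<And>x. norm (\<zeta>' x) \<le> B"
    using continuous_compact_support_bounded[OF \<zeta>(2,4)] by blast
  obtain C where C: "C > 0" "\<And>x. norm (\<zeta> x) \<le> C"
    using continuous_compact_support_bounded[OF \<zeta>_continuous \<zeta>(3)] by blast
  have "bounded (Y ` cball 0 R)" "bounded (dY ` cball 0 R)"
    by (intro compact_imp_bounded compact_continuous_image continuous_on_subset[OF Y_continuous] continuous_on_subset[OF dY_continuous]; simp)+
  then obtain N N' where N: "\<And>x. norm x \<le> R \<Longrightarrow> norm (Y x) \<le> N" and N': "\<And>x. norm x \<le> R \<Longrightarrow> norm (dY x) \<le> N'"
    unfolding bounded_iff ball_simps by (metis mem_cball_0 real_norm_def)
  let ?K = "real DIM('a)"
  define b where "b x = A * A * (B * ((?K / 2 + N) * G x) + C * ((2 * ?K + ?K * N) * G x) + C * ((1 / 2 + ?K * N + N') * G x))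
     + C * (?K * m * G x + (norm (Q x))\<^sup>2 + m * N * (1 + (norm (Q x))\<^sup>2))" for x
  have "b \<in> L1_loc"
    unfolding b_def by (intro L1_loc_add L1_loc_cmult L1_loc_const integrable_imp_L1_loc[OF G] Q2)
  then have bi: "integrable lebesgue (\<lambda>x. indicator (cball 0 R) x * b x)"
    by (rule L1_loc_integrable_cball)
  have dom: "AE x in lebesgue. norm (E' n x) \<le> indicator (cball 0 R) x * b x" for n
    using bound
  proof eventually_elim
    case (elim x)
    show ?case
    proof (cases "norm x < R")
      case True
      have G: "\<bar>M n x\<bar> \<le> G x" "\<bar>L n x\<bar> \<le> G x" "\<bar>conv g0 (kern (s n)) x\<bar> \<le> G x"
        "\<And>i. i \<in> Basis \<Longrightarrow> \<bar>d n x \<bullet> i\<bar> \<le> G x"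
        using elim by (auto simp: M_def L_def F_def d_inner)
      have g0: "conv g0 (kern (s n)) x \<ge> 0"
        unfolding conv_def g0_def cut_def
        by (intro Bochner_Integration.integral_nonneg) (auto simp: kern_nonneg[OF s(1)])
      have "norm (d n x) \<le> (\<Sum>i\<in>Basis. \<bar>d n x \<bullet> i\<bar>)" by (rule norm_le_l1)
      also have "\<dots> \<le> (\<Sum>i\<in>(Basis::'a set). G x)" by (intro sum_mono G)
      finally have d1: "norm (d n x) \<le> ?K * G x" by simp
      have "(norm (d n x))\<^sup>2 = (\<Sum>i\<in>Basis. (d n x \<bullet> i)\<^sup>2)"
        unfolding power2_norm_eq_inner by (subst euclidean_inner) (simp add: power2_eq_square)
      also have "\<dots> \<le> (\<Sum>i\<in>(Basis::'a set). 4 * M n x * conv g0 (kern (s n)) x)"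
      proof (rule sum_mono)
        fix i :: 'a assume i: "i \<in> Basis"
        show "(d n x \<bullet> i)\<^sup>2 \<le> 4 * M n x * conv g0 (kern (s n)) x"
          unfolding d_inner[OF i] D0_def M_def \<mu>0_def g0_def
          by (rule conv_gradient_square_le[OF i s(1)])
      qed
      finally have d2: "(norm (d n x))\<^sup>2 \<le> 4 * ?K * M n x * conv g0 (kern (s n)) x"
        by (simp add: mult_ac)
      have "\<bar>E' n x\<bar> \<le> b x"
        unfolding E'_def b_def
        by (rule field_term_bound[where q="conv g0 (kern (s n)) x"])
          (use m M_nonneg G g0 d1 d2 coefficient_bound B C N N' True in auto)
      then show ?thesis using True by simp
    next
      case False
      have "b x \<ge> 0" if "norm x \<le> R"
      proof -
        have "\<bar>M n x\<bar> \<le> G x" using elim by (auto simp: M_def F_def)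
        then have "0 \<le> G x" using M_nonneg[of n x] by linarith
        moreover have "0 \<le> N" "0 \<le> N'"
          using N[OF that] N'[OF that] by (auto intro: order_trans[OF norm_ge_zero])
        ultimately show ?thesis unfolding b_def
          using A_nonneg B(1) C(1) m by (intro add_nonneg_nonneg mult_nonneg_nonneg) auto
      qed
      then show ?thesis using False \<zeta>(3,4)[of x] by (simp add: E'_def indicator_def)
    qed
  qed
  have conv: "AE x in lebesgue. (\<lambda>n. E' n x) \<longlonglongrightarrow> E x"
    using lim
  proof eventually_elim
    case (elim x)
    show ?case
    proof (cases "norm x < R")
      case True
      have "(\<lambda>n. M n x) \<longlonglongrightarrow> \<mu>0 x" "(\<lambda>n. L n x) \<longlonglongrightarrow> l0 x"
        using elim by (auto simp: M_def L_def F_def)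
      moreover have "(\<lambda>n. d n x) \<longlonglongrightarrow> (\<Sum>i\<in>Basis. D0 i x *\<^sub>R i)"
        unfolding d_def using elim by (intro tendsto_intros) (auto simp: F_def)
      moreover have "\<mu>0 x = (w x)\<^sup>2" "l0 x = l x" "(\<Sum>i\<in>Basis. D0 i x *\<^sub>R i) = D x"
        using True by (simp_all add: defs cut_def euclidean_representation)
      ultimately show ?thesis
        unfolding E'_def E_def by (intro field_term_tendsto m) auto
    next
      case False
      then show ?thesis using \<zeta>(3,4)[of x] by (simp add: E'_def E_def)
    qed
  qed
  have "(\<lambda>n. \<integral>x. E' n x \<partial>lebesgue) \<longlonglongrightarrow> (\<integral>x. E x \<partial>lebesgue)"
    by (rule integral_dominated_convergence[OF meas bi conv dom])
  then show ?thesis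
    by (simp add: E'0 LIMSEQ_const_iff)
qed

end

text \<open>The formula for \<open>field_term\<close> at m = infinity, where m / (m + M) becomes 1
  and m / (m + M)^2 becomes 0.\<close>

definition field_limit ::
  "real \<Rightarrow> real \<Rightarrow> 'a::euclidean_space \<Rightarrow> 'a \<Rightarrow> real \<Rightarrow> real \<Rightarrow> 'a \<Rightarrow> real \<Rightarrow> 'a \<Rightarrow> real" where
  "field_limit a z z' Y dY M d l Q =
     a * (z' \<bullet> (d /\<^sub>R 2 + M *\<^sub>R Y) + z * (l / 2 + d \<bullet> Y + M * dY)) + z * ((d /\<^sub>R 2 + M *\<^sub>R Y) \<bullet> Q)"

lemma field_term_tendsto_limit:
  assumes M: "M \<ge> 0"
  shows "(\<lambda>n. field_term (real (Suc n)) a z z' Y dY M d l Q) \<longlonglongrightarrow> field_limit a z z' Y dY M d l Q"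
proof -
  have inv: "(\<lambda>n. inverse (real (Suc n))) \<longlonglongrightarrow> 0" by (rule LIMSEQ_inverse_real_of_nat)
  have "(\<lambda>n. 1 / (1 + inverse (real (Suc n)) * M)) \<longlonglongrightarrow> 1 / (1 + 0 * M)"
    by (intro tendsto_intros inv) simp
  moreover have "1 / (1 + inverse (real (Suc n)) * M) = real (Suc n) / (real (Suc n) + M)" for n
    by (simp add: field_simps)
  ultimately have 1: "(\<lambda>n. real (Suc n) / (real (Suc n) + M)) \<longlonglongrightarrow> 1" by simp
  have "(\<lambda>n. inverse (real (Suc n)) * (real (Suc n) / (real (Suc n) + M))\<^sup>2) \<longlonglongrightarrow> 0 * 1\<^sup>2"
    by (intro tendsto_intros inv 1)
  moreover have "inverse (real (Suc n)) * (real (Suc n) / (real (Suc n) + M))\<^sup>2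
      = real (Suc n) / (real (Suc n) + M)\<^sup>2" for n
  proof -
    have "inverse k * (k / t)\<^sup>2 = k / t\<^sup>2" if "k > 0" for k t :: real
      using that by (simp add: power_divide power2_eq_square divide_inverse)
    then show ?thesis by simp
  qed
  ultimately have 2: "(\<lambda>n. real (Suc n) / (real (Suc n) + M)\<^sup>2) \<longlonglongrightarrow> 0" by simp
  have "(\<lambda>n. field_term (real (Suc n)) a z z' Y dY M d l Q) \<longlonglongrightarrow>
     a * (1 * (z' \<bullet> (d /\<^sub>R 2 + M *\<^sub>R Y)) - z * (0 * (d \<bullet> (d /\<^sub>R 2 + M *\<^sub>R Y)))
        + z * (1 * (l / 2 + d \<bullet> Y + M * dY)))
     + z * (1 * ((d /\<^sub>R 2 + M *\<^sub>R Y) \<bullet> Q))"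
    unfolding field_term_def by (intro tendsto_intros 1 2)
  then show ?thesis by (simp add: field_limit_def)
qed

text \<open>A majorant free of \<open>m\<close>. It becomes possible after the mollification is
  gone, because \<open>d\<close> then has the exact size 2 v r with M = v^2: each factor
  \<open>v\<close> can be paired with the norm of \<open>Q\<close>, and the weighted M |Q|^2
  replaces the unweighted square.\<close>

lemma field_term_bound_uniform:
  assumes m: "m > 0" and M: "M = v\<^sup>2" "v \<ge> 0" and d: "norm d = 2 * v * r" "r \<ge> 0"
    and a: "\<bar>a\<bar> \<le> A" and z: "\<bar>z\<bar> \<le> C" "norm z' \<le> B" and Y: "norm Y \<le> N" "\<bar>dY\<bar> \<le> N'"
  shows "\<bar>field_term m a z z' Y dY M d l Q\<bar> \<le>
    A * (B * (norm d / 2 + N * M) + C * (2 * r\<^sup>2 + N * norm d) + C * (\<bar>l\<bar> / 2 + N * norm d + N' * M))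
     + C * (r\<^sup>2 + N\<^sup>2 * M + M * (norm Q)\<^sup>2)"
proof -
  let ?V = "d /\<^sub>R 2 + M *\<^sub>R Y" and ?H = "m / (m + M)" and ?H' = "m / (m + M)\<^sup>2"
  have M0: "M \<ge> 0" using M by simp
  note s = saturation_bounds[OF m M0]
  have nn: "0 \<le> A" "0 \<le> B" "0 \<le> C" "0 \<le> N" "0 \<le> N'"
    using a z Y norm_ge_zero[of z'] norm_ge_zero[of Y] by linarith+
  have H: "\<bar>?H * t\<bar> \<le> b" if "\<bar>t\<bar> \<le> b" for t b
  proof -
    have "\<bar>?H\<bar> * \<bar>t\<bar> \<le> 1 * b" using s that by (intro mult_mono) linarith+
    then show ?thesis by (simp only: abs_mult mult_1)
  qed
  have V: "norm ?V \<le> norm d / 2 + N * M"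
  proof -
    have "norm ?V \<le> norm (d /\<^sub>R 2) + norm (M *\<^sub>R Y)" by (rule norm_triangle_ineq)
    also have "\<dots> = norm d / 2 + M * norm Y" using M0 by simp
    also have "\<dots> \<le> norm d / 2 + M * N" using Y M0 by (intro add_left_mono mult_left_mono)
    finally show ?thesis by (simp add: mult.commute)
  qed
  have dY: "\<bar>d \<bullet> Y\<bar> \<le> N * norm d"
    using abs_inner_le[OF order_refl Y(1), of d] by (simp add: mult.commute)
  have T1: "\<bar>?H * (z' \<bullet> ?V)\<bar> \<le> B * (norm d / 2 + N * M)"
    by (rule H[OF abs_inner_le[OF z(2) V]])
  have T2: "\<bar>?H' * (d \<bullet> ?V)\<bar> \<le> 2 * r\<^sup>2 + N * norm d"
  proof -
    have "d \<bullet> ?V = M * (2 * r\<^sup>2 + d \<bullet> Y)"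
      using d(1) by (simp add: M inner_add_right power2_norm_eq_inner[symmetric] power_mult_distrib distrib_left)
    then have "\<bar>?H' * (d \<bullet> ?V)\<bar> = \<bar>?H' * M\<bar> * \<bar>2 * r\<^sup>2 + d \<bullet> Y\<bar>"
      by (simp only: abs_mult mult.assoc)
    also have "\<dots> \<le> 1 * (2 * r\<^sup>2 + N * norm d)"
    proof (rule mult_mono)
      show "\<bar>?H' * M\<bar> \<le> 1" using mult_nonneg_nonneg[OF s(4) M0] s(5) by linarith
      show "\<bar>2 * r\<^sup>2 + d \<bullet> Y\<bar> \<le> 2 * r\<^sup>2 + N * norm d"
        using dY zero_le_power2[of r] by linarith
    qed auto
    finally show ?thesis by simp
  qed
  have "\<bar>M * dY\<bar> \<le> N' * M"
    unfolding abs_mult using Y(2) M0 by (simp add: mult.commute mult_left_mono)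
  then have T3: "\<bar>?H * (l / 2 + d \<bullet> Y + M * dY)\<bar> \<le> \<bar>l\<bar> / 2 + N * norm d + N' * M"
    using dY by (intro H) linarith
  have T4: "\<bar>?H * (?V \<bullet> Q)\<bar> \<le> r\<^sup>2 + N\<^sup>2 * M + M * (norm Q)\<^sup>2"
  proof (rule H)
    have "\<bar>?V \<bullet> Q\<bar> \<le> (norm d / 2 + N * M) * norm Q"
      by (rule abs_inner_le[OF V order_refl])
    also have "\<dots> = r * (v * norm Q) + (N * v) * (v * norm Q)"
      by (simp add: d M power2_eq_square algebra_simps)
    also have "\<dots> \<le> r\<^sup>2 + N\<^sup>2 * M + M * (norm Q)\<^sup>2"
    proof -
      have "2 * r * (v * norm Q) \<le> r\<^sup>2 + (v * norm Q)\<^sup>2"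
        "2 * (N * v) * (v * norm Q) \<le> (N * v)\<^sup>2 + (v * norm Q)\<^sup>2"
        by (rule sum_squares_bound)+
      moreover have "0 \<le> r\<^sup>2" "0 \<le> (N * v)\<^sup>2" by simp_all
      ultimately have "r * (v * norm Q) + (N * v) * (v * norm Q) \<le> r\<^sup>2 + (N * v)\<^sup>2 + (v * norm Q)\<^sup>2"
        by linarith
      then show ?thesis by (simp add: M power_mult_distrib)
    qed
    finally show "\<bar>?V \<bullet> Q\<bar> \<le> r\<^sup>2 + N\<^sup>2 * M + M * (norm Q)\<^sup>2" .
  qed
  have S: "\<bar>z * t\<bar> \<le> C * b" if "\<bar>t\<bar> \<le> b" for t b
    unfolding abs_mult using that z(1) nn by (intro mult_mono) auto
  have "\<bar>?H * (z' \<bullet> ?V) - z * (?H' * (d \<bullet> ?V)) + z * (?H * (l / 2 + d \<bullet> Y + M * dY))\<bar>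
     \<le> B * (norm d / 2 + N * M) + C * (2 * r\<^sup>2 + N * norm d) + C * (\<bar>l\<bar> / 2 + N * norm d + N' * M)"
    using T1 S[OF T2] S[OF T3] by linarith
  then have "\<bar>a * (?H * (z' \<bullet> ?V) - z * (?H' * (d \<bullet> ?V)) + z * (?H * (l / 2 + d \<bullet> Y + M * dY)))\<bar>
     \<le> A * (B * (norm d / 2 + N * M) + C * (2 * r\<^sup>2 + N * norm d) + C * (\<bar>l\<bar> / 2 + N * norm d + N' * M))"
    unfolding abs_mult[of a] using a by (intro mult_mono) auto
  then show ?thesis
    unfolding field_term_def using S[OF T4] by linarith
qed

lemma L1_loc_norm:
  fixes f :: "'a::euclidean_space \<Rightarrow> 'b::euclidean_space"
  shows "f \<in> L1_loc \<Longrightarrow> (\<lambda>x. norm (f x)) \<in> L1_loc"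
  unfolding L1_loc_def set_integrable_def
proof safe
  fix K :: "'a set" assume "\<forall>K. compact K \<longrightarrow> integrable lebesgue (\<lambda>x. indicator K x *\<^sub>R f x)" "compact K"
  then have "integrable lebesgue (\<lambda>x. norm (indicator K x *\<^sub>R f x))" by (intro integrable_norm) blast
  then show "integrable lebesgue (\<lambda>x. indicator K x *\<^sub>R norm (f x))" by simp
qed

context weighted_field
begin

text \<open>The two integrability assumptions on \<open>Q\<close> serve two limits: the unweighted
  one removes the mollification at fixed saturation, the weighted one removes the
  saturation.\<close>

lemma field_identity:
  assumes N: "\<And>x. norm (Y x) \<le> N" "\<And>x. \<bar>dY x\<bar> \<le> N'"
    and Q2: "(\<lambda>x. (norm (Q x))\<^sup>2) \<in> L1_loc" "(\<lambda>x. (w x)\<^sup>2 * (norm (Q x))\<^sup>2) \<in> L1_loc"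
  defines "E \<equiv> \<lambda>x. field_limit (p (u x) * q (w x)) (\<zeta> x) (\<zeta>' x) (Y x) (dY x) ((w x)\<^sup>2) (D x) (l x) (Q x)"
  shows "integrable lebesgue E" "(\<integral>x. E x \<partial>lebesgue) = 0"
proof -
  define E' where "E' n x = field_term (real (Suc n)) (p (u x) * q (w x)) (\<zeta> x) (\<zeta>' x) (Y x) (dY x)
      ((w x)\<^sup>2) (D x) (l x) (Q x)" for n x
  have E'0: "(\<integral>x. E' n x \<partial>lebesgue) = 0" for n
    unfolding E'_def by (rule field_identity_saturated[OF _ Q2(1)]) simp
  have meas: "E \<in> borel_measurable lebesgue" "E' n \<in> borel_measurable lebesgue" for n
    unfolding E_def E'_def field_limit_def by measurable
  obtain B where B: "B > 0" "\<And>x. norm (\<zeta>' x) \<le> B"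
    using continuous_compact_support_bounded[OF \<zeta>(2,4)] by blast
  obtain C where C: "C > 0" "\<And>x. norm (\<zeta> x) \<le> C"
    using continuous_compact_support_bounded[OF \<zeta>_continuous \<zeta>(3)] by blast
  define b where "b x = A * A * (B * (1 / 2 * norm (D x) + N * (w x)\<^sup>2) + C * (2 * (norm (g x))\<^sup>2 + N * norm (D x))
       + C * (1 / 2 * \<bar>l x\<bar> + N * norm (D x) + N' * (w x)\<^sup>2))
     + C * ((norm (g x))\<^sup>2 + N\<^sup>2 * (w x)\<^sup>2 + (w x)\<^sup>2 * (norm (Q x))\<^sup>2)" for x
  have "b \<in> L1_loc"
    unfolding b_def using L1_loc_norm[OF loc(3)]
    by (intro L1_loc_add L1_loc_cmult loc L1_loc_norm[OF loc(4)] Q2(2)) simp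
  then have bi: "integrable lebesgue (\<lambda>x. indicator (cball 0 R) x * b x)"
    by (rule L1_loc_integrable_cball)
  have dom: "AE x in lebesgue. norm (E' n x) \<le> indicator (cball 0 R) x * b x" for n
    using D_eq
  proof eventually_elim
    case (elim x)
    have "\<bar>E' n x\<bar> \<le> A * A * (B * (norm (D x) / 2 + N * (w x)\<^sup>2) + C * (2 * (norm (g x))\<^sup>2 + N * norm (D x))
          + C * (\<bar>l x\<bar> / 2 + N * norm (D x) + N' * (w x)\<^sup>2))
        + C * ((norm (g x))\<^sup>2 + N\<^sup>2 * (w x)\<^sup>2 + (w x)\<^sup>2 * (norm (Q x))\<^sup>2)"
      unfolding E'_def
      by (rule field_term_bound_uniform[where v="w x" and r="norm (g x)"])
        (use coefficient_bound B C N elim w_nonneg in auto)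
    then have "\<bar>E' n x\<bar> \<le> b x" by (simp add: b_def)
    then show ?case
      using \<zeta>(3,4)[of x] by (cases "norm x < R") (auto simp: E'_def indicator_def)
  qed
  have conv: "AE x in lebesgue. (\<lambda>n. E' n x) \<longlonglongrightarrow> E x"
    unfolding E'_def E_def by (intro AE_I2 field_term_tendsto_limit) simp
  show "integrable lebesgue E"
    by (rule integrable_dominated_convergence[OF meas bi conv dom])
  have "(\<lambda>n. \<integral>x. E' n x \<partial>lebesgue) \<longlonglongrightarrow> (\<integral>x. E x \<partial>lebesgue)"
    by (rule integral_dominated_convergence[OF meas bi conv dom])
  then show "(\<integral>x. E x \<partial>lebesgue) = 0"
    by (simp add: E'0 LIMSEQ_const_iff)
qed

end

section \<open>Completing the square\<close>

lemma L1_loc_integrable: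
  fixes f :: "'a::euclidean_space \<Rightarrow> real"
  assumes "f \<in> L1_loc" "\<And>x. norm x \<ge> R \<Longrightarrow> f x = 0"
  shows "integrable lebesgue f"
proof -
  have "(\<lambda>x. indicator (cball 0 R) x * f x) = f"
    using assms(2) by (force simp: indicator_def)
  then show ?thesis using L1_loc_integrable_cball[OF assms(1), of R] by simp
qed

lemma L1_loc_mult_bounded:
  fixes f h :: "'a::euclidean_space \<Rightarrow> real"
  assumes f: "f \<in> L1_loc" and h: "h \<in> borel_measurable lebesgue" "\<And>x. \<bar>h x\<bar> \<le> B"
  shows "(\<lambda>x. h x * f x) \<in> L1_loc"
proof (rule L1_loc_bound)
  show "(\<lambda>x. h x * f x) \<in> borel_measurable lebesgue"
    using h L1_loc_measurable[OF f] by measurable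
  show "(\<lambda>x. B * norm (f x)) \<in> L1_loc"
    by (intro L1_loc_cmult L1_loc_norm f)
  show "AE x in lebesgue. norm (h x * f x) \<le> B * norm (f x)"
    using h(2) by (intro AE_I2) (simp add: abs_mult mult_right_mono)
qed

lemma norm_add_square_le:
  fixes a b :: "'a::real_inner"
  shows "(norm (a + b))\<^sup>2 \<le> 2 * (norm a)\<^sup>2 + 2 * (norm b)\<^sup>2"
proof -
  have "(norm (a + b))\<^sup>2 + (norm (a - b))\<^sup>2 = 2 * (norm a)\<^sup>2 + 2 * (norm b)\<^sup>2"
    by (simp add: power2_norm_eq_inner inner_simps inner_commute)
  then show ?thesis using zero_le_power2[of "norm (a - b)"] by linarith
qed

lemma norm_add_square_bound:
  fixes a b c :: "'a::real_inner"
  assumes "(norm a)\<^sup>2 \<le> \<alpha>" "(norm b)\<^sup>2 \<le> \<beta>"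
  shows "(norm (a + b))\<^sup>2 \<le> 2 * \<alpha> + 2 * \<beta>"
  using norm_add_square_le[of a b] assms by linarith

lemma norm_scaleR_square_le:
  assumes "\<bar>c\<bar> \<le> (A::real)"
  shows "(norm (c *\<^sub>R x))\<^sup>2 \<le> A\<^sup>2 * (norm x)\<^sup>2"
proof -
  have "c\<^sup>2 \<le> A\<^sup>2" using assms by (metis abs_le_square_iff abs_of_nonneg abs_ge_zero order_trans)
  then show ?thesis by (simp add: power_mult_distrib mult_right_mono)
qed

text \<open>To be read with v = w, t = T(u), h = damp and h' its derivative. Multiplied by
  \<open>v\<close>, the last summand carries v h', which is at most 1, so the bound does not see the
  damping parameter.\<close>

lemma truncated_gradient_bound:
  fixes z' r s :: "'a::real_inner"
  assumes t: "\<bar>t\<bar> \<le> A" "\<bar>t'\<bar> \<le> A" and z: "\<bar>z\<bar> \<le> C" "norm z' \<le> B" and h: "\<bar>h\<bar> \<le> 1" "\<bar>v * h'\<bar> \<le> (1 :: real)"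
  shows "v\<^sup>2 * (norm ((t * h) *\<^sub>R z' + (z * t' * h) *\<^sub>R r + (z * t * h') *\<^sub>R s))\<^sup>2
    \<le> 2 * (2 * (A\<^sup>2 * (B\<^sup>2 * v\<^sup>2)) + 2 * ((C * A)\<^sup>2 * (v\<^sup>2 * (norm r)\<^sup>2))) + 2 * ((C * A)\<^sup>2 * (norm s)\<^sup>2)"
proof -
  let ?a = "(t * h) *\<^sub>R (v *\<^sub>R z')" and ?b = "(z * t' * h) *\<^sub>R (v *\<^sub>R r)" and ?c = "(z * t * (v * h')) *\<^sub>R s"
  have nn: "0 \<le> A" "0 \<le> C" using t z by linarith+
  have eq: "v\<^sup>2 * (norm ((t * h) *\<^sub>R z' + (z * t' * h) *\<^sub>R r + (z * t * h') *\<^sub>R s))\<^sup>2 = (norm (?a + ?b + ?c))\<^sup>2"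
  proof -
    have "v *\<^sub>R ((t * h) *\<^sub>R z' + (z * t' * h) *\<^sub>R r + (z * t * h') *\<^sub>R s) = ?a + ?b + ?c"
      by (simp add: algebra_simps)
    then have "(norm (v *\<^sub>R ((t * h) *\<^sub>R z' + (z * t' * h) *\<^sub>R r + (z * t * h') *\<^sub>R s)))\<^sup>2 = (norm (?a + ?b + ?c))\<^sup>2"
      by simp
    then show ?thesis by (simp add: power_mult_distrib)
  qed
  have "\<bar>t\<bar> * \<bar>h\<bar> \<le> A * 1" using t h nn by (intro mult_mono) auto
  then have "(norm ?a)\<^sup>2 \<le> A\<^sup>2 * (norm (v *\<^sub>R z'))\<^sup>2"
    by (intro norm_scaleR_square_le) (simp add: abs_mult)
  also have "\<dots> \<le> A\<^sup>2 * (B\<^sup>2 * v\<^sup>2)"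
  proof (rule mult_left_mono)
    have "(norm z')\<^sup>2 \<le> B\<^sup>2" by (rule power_mono[OF z(2)]) simp
    then show "(norm (v *\<^sub>R z'))\<^sup>2 \<le> B\<^sup>2 * v\<^sup>2"
      by (simp add: power_mult_distrib mult.commute[of "B\<^sup>2"] mult_left_mono)
  qed simp
  finally have a: "(norm ?a)\<^sup>2 \<le> A\<^sup>2 * (B\<^sup>2 * v\<^sup>2)" .
  have "\<bar>z\<bar> * \<bar>t'\<bar> * \<bar>h\<bar> \<le> C * A * 1" using t h z nn by (intro mult_mono) auto
  then have "(norm ?b)\<^sup>2 \<le> (C * A)\<^sup>2 * (norm (v *\<^sub>R r))\<^sup>2"
    by (intro norm_scaleR_square_le) (simp add: abs_mult)
  then have b: "(norm ?b)\<^sup>2 \<le> (C * A)\<^sup>2 * (v\<^sup>2 * (norm r)\<^sup>2)" by (simp add: power_mult_distrib)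
  have "\<bar>z\<bar> * \<bar>t\<bar> * \<bar>v * h'\<bar> \<le> C * A * 1" using t h z nn by (intro mult_mono) auto
  then have c: "(norm ?c)\<^sup>2 \<le> (C * A)\<^sup>2 * (norm s)\<^sup>2"
    by (intro norm_scaleR_square_le) (simp add: abs_mult)
  show ?thesis unfolding eq by (intro norm_add_square_bound a b c)
qed

lemma damp_le_abs: "k > 0 \<Longrightarrow> damp k t \<le> (1 + 1 / k) * \<bar>t\<bar>"
proof -
  assume k: "k > 0"
  have pos: "k + t\<^sup>2 > 0" using k by (simp add: add_pos_nonneg)
  have "\<bar>t\<bar> \<le> 1 + t\<^sup>2"
    using sum_squares_bound[of "\<bar>t\<bar>" 1] by (simp; linarith)
  also have "\<dots> \<le> (1 + 1 / k) * (k + t\<^sup>2)" using k by (simp add: field_simps)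
  finally have "\<bar>t\<bar> * \<bar>t\<bar> \<le> ((1 + 1 / k) * (k + t\<^sup>2)) * \<bar>t\<bar>" by (rule mult_right_mono) simp
  then show ?thesis
    using pos by (simp add: damp_def divide_le_eq power2_eq_square mult_ac)
qed

section \<open>The damped and truncated function\<close>

locale truncation = weight w l g D
  for w l :: "'a::euclidean_space \<Rightarrow> real" and g D :: "'a \<Rightarrow> 'a" +
  fixes u \<kappa> :: "'a \<Rightarrow> real" and P \<kappa>' :: "'a \<Rightarrow> 'a" and T T' :: "real \<Rightarrow> real" and A R :: real
  assumes u: "has_weak_gradient u P" and wP: "(\<lambda>x. (w x)\<^sup>2 * (norm (P x))\<^sup>2) \<in> L1_loc"
    and T: "\<And>s. (T has_real_derivative T' s) (at s)" "continuous_on UNIV T'" "\<And>s. \<bar>T s\<bar> \<le> A" "\<And>s. \<bar>T' s\<bar> \<le> A"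
    and \<kappa>: "\<And>x. GDERIV \<kappa> x :> \<kappa>' x" "continuous_on UNIV \<kappa>'"
      "\<And>x. norm x \<ge> R \<Longrightarrow> \<kappa> x = 0" "\<And>x. norm x \<ge> R \<Longrightarrow> \<kappa>' x = 0"
begin

text \<open>The factor \<open>damp k w = O(w)\<close> turns \<open>w \<nabla>u \<in> L\<^sup>2\<close> into an unweighted \<open>L\<^sup>2\<close> bound, also near the
  zeros of \<open>w\<close>.\<close>

definition \<Phi> :: "real \<Rightarrow> 'a \<Rightarrow> real" where
  "\<Phi> k x = \<kappa> x * T (u x) * damp k (w x)"

definition D\<Phi> :: "real \<Rightarrow> 'a \<Rightarrow> 'a" where
  "D\<Phi> k x = (T (u x) * damp k (w x)) *\<^sub>R \<kappa>' x + (\<kappa> x * T' (u x) * damp k (w x)) *\<^sub>R P x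
      + (\<kappa> x * T (u x) * damp' k (w x)) *\<^sub>R g x"

lemma continuity: shows T_continuous: "continuous_on UNIV T" and \<kappa>_continuous: "continuous_on UNIV \<kappa>"
  using DERIV_continuous_UNIV[OF T(1)] GDERIV_continuous[OF \<kappa>(1)] by auto

lemma measurability [measurable]:
  "u \<in> borel_measurable lebesgue" "P \<in> borel_measurable lebesgue"
  "T \<in> borel_measurable borel" "T' \<in> borel_measurable borel"
  "\<kappa> \<in> borel_measurable lebesgue" "\<kappa>' \<in> borel_measurable lebesgue"
  using u T(2) \<kappa>(2) continuity
  by (auto simp: has_weak_gradient_def intro: L1_loc_measurable borel_measurable_continuous_onI lebesgue_measurable_continuous)

lemma \<Phi>_measurable [measurable]:
  assumes k: "k > 0"
  shows "\<Phi> k \<in> borel_measurable lebesgue" "D\<Phi> k \<in> borel_measurable lebesgue"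
proof -
  have [measurable]: "damp k \<in> borel_measurable borel" "damp' k \<in> borel_measurable borel"
    using damp'_continuous[OF k] DERIV_continuous_UNIV[OF damp_DERIV[OF k]]
    by (auto intro: borel_measurable_continuous_onI)
  show "\<Phi> k \<in> borel_measurable lebesgue" "D\<Phi> k \<in> borel_measurable lebesgue"
    unfolding \<Phi>_def[abs_def] D\<Phi>_def[abs_def] by measurable
qed

lemma A_nonneg: "A \<ge> 0"
  using T(3)[of 0] by linarith

text \<open>The constants \<open>B\<close> and \<open>C\<close> are independent of \<open>k\<close>,
  so these estimates provide the majorants for removing the damping.\<close>

lemma cutoff_bounds:
  obtains B C where "B > 0" "\<And>x. norm (\<kappa>' x) \<le> B" "C > 0" "\<And>x. \<bar>\<kappa> x\<bar> \<le> C"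
    "\<And>k x. k > 0 \<Longrightarrow> (\<Phi> k x)\<^sup>2 \<le> (C * A)\<^sup>2"
    "\<And>k x. k > 0 \<Longrightarrow> (w x)\<^sup>2 * (norm (D\<Phi> k x))\<^sup>2 \<le>
      2 * (2 * (A\<^sup>2 * (B\<^sup>2 * (w x)\<^sup>2)) + 2 * ((C * A)\<^sup>2 * ((w x)\<^sup>2 * (norm (P x))\<^sup>2)))
        + 2 * ((C * A)\<^sup>2 * (norm (g x))\<^sup>2)"
proof -
  obtain B where B: "B > 0" "\<And>x. norm (\<kappa>' x) \<le> B"
    using continuous_compact_support_bounded[OF \<kappa>(2,4)] by blast
  obtain C where C: "C > 0" "\<And>x. \<bar>\<kappa> x\<bar> \<le> C"
    using continuous_compact_support_bounded[OF \<kappa>_continuous \<kappa>(3)] by (metis real_norm_def)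
  have h: "\<bar>damp k t\<bar> \<le> 1" "\<bar>t * damp' k t\<bar> \<le> 1" if "k > 0" for k t
    using damp_nonneg[OF that, of t] damp_le_1[OF that, of t] damp'_mult[OF that, of t] by (auto simp: mult.commute)
  have "(\<Phi> k x)\<^sup>2 \<le> (C * A)\<^sup>2" if "k > 0" for k x
  proof -
    have "\<bar>\<kappa> x\<bar> * \<bar>T (u x)\<bar> * \<bar>damp k (w x)\<bar> \<le> C * A * 1"
      using C A_nonneg T h[OF that] by (intro mult_mono) auto
    then have "\<bar>\<Phi> k x\<bar> \<le> \<bar>C * A\<bar>" using C A_nonneg by (simp add: \<Phi>_def abs_mult)
    then show ?thesis by (simp only: abs_le_square_iff)
  qed
  then show ?thesis
    using that[OF B C] truncated_gradient_bound[OF T(3,4) C(2) B(2) h] unfolding D\<Phi>_def by blast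
qed

text \<open>The identity is applied with a = (T(u) damp k w)^2 and \<zeta> = \<kappa>^2, whose
  product is the square of \<Phi>. Its integrand \<open>E\<close> has integral 0 and contains the
  mixed term of the square to be completed, so adding \<open>E\<close> leaves the integral unchanged
  and makes the integrand a square.\<close>

lemma truncated_inequality:
  assumes Y: "\<And>x i. i \<in> Basis \<Longrightarrow> GDERIV (\<lambda>x. Y x \<bullet> i) x :> Y' i x"
      "\<And>i. i \<in> Basis \<Longrightarrow> continuous_on UNIV (Y' i)"
      "\<And>x. norm (Y x) \<le> N" "\<And>x. \<bar>\<Sum>i\<in>Basis. Y' i x \<bullet> i\<bar> \<le> N'"
    and k: "k > 0"
  shows "integrable lebesgue (\<lambda>x. (w x)\<^sup>2 * (norm (D\<Phi> k x))\<^sup>2)" (is ?I1)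
    and "integrable lebesgue (\<lambda>x. (\<Phi> k x)\<^sup>2 * ((norm (g x))\<^sup>2 - l x / 2))" (is ?I2)
    and "integrable lebesgue (\<lambda>x. (\<Phi> k x)\<^sup>2 * (w x)\<^sup>2)" (is ?I3)
    and "integrable lebesgue (\<lambda>x. (\<Phi> k x)\<^sup>2 * (w x)\<^sup>2 * ((\<Sum>i\<in>Basis. Y' i x \<bullet> i) - (norm (Y x))\<^sup>2))" (is ?I4)
    and "(\<integral>x. (\<Phi> k x)\<^sup>2 * (w x)\<^sup>2 * ((\<Sum>i\<in>Basis. Y' i x \<bullet> i) - (norm (Y x))\<^sup>2) \<partial>lebesgue)
      \<le> (\<integral>x. (w x)\<^sup>2 * (norm (D\<Phi> k x))\<^sup>2 \<partial>lebesgue) + (\<integral>x. (\<Phi> k x)\<^sup>2 * ((norm (g x))\<^sup>2 - l x / 2) \<partial>lebesgue)"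
proof -
  define c where "c = 1 + 1 / k"
  have c: "c \<ge> 1" "\<And>t. damp k t \<le> c * \<bar>t\<bar>" "\<And>t. \<bar>damp' k t\<bar> \<le> c"
    using k damp_le_abs[OF k] damp'_bound[OF k] by (auto simp: c_def)
  have h: "0 \<le> damp k t" "\<bar>damp k t\<bar> \<le> 1" for t
    using damp_nonneg[OF k] damp_le_1[OF k] by auto
  have hw: "\<bar>w x * damp' k (w x)\<bar> \<le> 1" for x
    using damp'_mult[OF k, of "w x"] by (simp add: mult.commute)
  have hc: "continuous_on UNIV (damp k)" by (rule DERIV_continuous_UNIV[OF damp_DERIV[OF k]])
  note A = A_nonneg and [measurable] = \<Phi>_measurable[OF k]

  define p p' where "p s = (T s)\<^sup>2" and "p' s = 2 * T s * T' s" for s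
  define q q' where "q s = (damp k s)\<^sup>2" and "q' s = 2 * damp k s * damp' k s" for s
  define \<zeta> \<zeta>' where "\<zeta> x = (\<kappa> x)\<^sup>2" and "\<zeta>' x = (2 * \<kappa> x) *\<^sub>R \<kappa>' x" for x
  \<comment> \<open>One bound for all four of \<open>p\<close>, \<open>p'\<close>, \<open>q\<close>,
    \<open>q'\<close>, as the locale asks for.\<close>
  let ?A = "2 * A\<^sup>2 + 2 * c"
  have p: "(p has_real_derivative p' s) (at s)" "continuous_on UNIV p'" "\<bar>p s\<bar> \<le> ?A" "\<bar>p' s\<bar> \<le> 2 * A\<^sup>2" "\<bar>p s\<bar> \<le> A\<^sup>2" for s
  proof -
    show "(p has_real_derivative p' s) (at s)"
      unfolding p_def p'_def by (auto intro!: derivative_eq_intros T(1))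
    show "continuous_on UNIV p'" unfolding p'_def by (intro continuous_intros T_continuous T(2))
    show 1: "\<bar>p s\<bar> \<le> A\<^sup>2"
      using power_mono[OF T(3)[of s], of 2] by (simp add: p_def)
    then show "\<bar>p s\<bar> \<le> ?A" using c(1) zero_le_power2[of A] by linarith
    have "\<bar>T s\<bar> * \<bar>T' s\<bar> \<le> A * A" using T A by (intro mult_mono) auto
    then show "\<bar>p' s\<bar> \<le> 2 * A\<^sup>2" by (simp add: p'_def abs_mult power2_eq_square)
  qed
  have p4: "\<bar>p' s\<bar> \<le> ?A" for s
    using p(4)[of s] c(1) by linarith
  have q: "(q has_real_derivative q' s) (at s)" "continuous_on UNIV q'" "\<bar>q s\<bar> \<le> 1" "\<bar>q' s\<bar> \<le> 2 * c"
    "\<bar>q s\<bar> \<le> c * \<bar>s\<bar>" for s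
  proof -
    show "(q has_real_derivative q' s) (at s)"
      unfolding q_def q'_def by (auto intro!: derivative_eq_intros damp_DERIV k)
    show "continuous_on UNIV q'" unfolding q'_def by (intro continuous_intros hc damp'_continuous k)
    show "\<bar>q s\<bar> \<le> 1" using power_mono[OF h(2)[of s], of 2] by (simp add: q_def)
    have "damp k s * damp k s \<le> 1 * (c * \<bar>s\<bar>)" using h[of s] c by (intro mult_mono) auto
    then show "\<bar>q s\<bar> \<le> c * \<bar>s\<bar>" by (simp add: q_def power2_eq_square)
    have "\<bar>damp k s\<bar> * \<bar>damp' k s\<bar> \<le> 1 * c" using h c by (intro mult_mono) auto
    then show "\<bar>q' s\<bar> \<le> 2 * c" by (simp add: q'_def abs_mult)
  qed
  have q34: "\<bar>q s\<bar> \<le> ?A" "\<bar>q' s\<bar> \<le> ?A" for s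
    using q(3,4)[of s] c(1) zero_le_power2[of A] by linarith+
  have \<zeta>: "GDERIV \<zeta> x :> \<zeta>' x" "continuous_on UNIV \<zeta>'" for x
  proof -
    have "GDERIV (\<lambda>x. \<kappa> x * \<kappa> x) x :> \<kappa> x *\<^sub>R \<kappa>' x + \<kappa> x *\<^sub>R \<kappa>' x"
      by (intro GDERIV_mult \<kappa>)
    then show "GDERIV \<zeta> x :> \<zeta>' x"
      by (simp add: \<zeta>_def[abs_def] \<zeta>'_def power2_eq_square scaleR_add_left[symmetric])
    show "continuous_on UNIV \<zeta>'" unfolding \<zeta>'_def by (intro continuous_intros \<kappa>_continuous \<kappa>(2))
  qed
  have \<zeta>0: "\<zeta> x = 0" "\<zeta>' x = 0" if "norm x \<ge> R" for x
    using \<kappa>(3)[OF that] by (simp_all add: \<zeta>_def \<zeta>'_def)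
  interpret F: weighted_field w l g D u \<zeta> P \<zeta>' Y Y' p p' q q' ?A R
    by unfold_locales (rule u p(1,2,3) p4 q(1,2) q34 \<zeta> \<zeta>0 Y(1,2); assumption)+
  note F.Q_measurable [measurable] F.measurability [measurable]
  \<comment> \<open>The bound \<open>\<bar>q s\<bar> \<le> c * \<bar>s\<bar>\<close> supplies the
    missing factor \<open>w\<close> in front of \<open>P\<close>. The constant blows up as
    \<open>k\<close> tends to 0, which is harmless while \<open>k\<close> is fixed.\<close>
  have Q1: "(\<lambda>x. (norm (F.Q x))\<^sup>2) \<in> L1_loc"
  proof (rule L1_loc_bound)
    show "(\<lambda>x. 2 * ((2 * A\<^sup>2 * c)\<^sup>2 * ((w x)\<^sup>2 * (norm (P x))\<^sup>2)) + 2 * ((A\<^sup>2 * (2 * c))\<^sup>2 * (norm (g x))\<^sup>2)) \<in> L1_loc"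
      by (intro L1_loc_add L1_loc_cmult wP loc)
    show "AE x in lebesgue. norm ((norm (F.Q x))\<^sup>2) \<le>
       2 * ((2 * A\<^sup>2 * c)\<^sup>2 * ((w x)\<^sup>2 * (norm (P x))\<^sup>2)) + 2 * ((A\<^sup>2 * (2 * c))\<^sup>2 * (norm (g x))\<^sup>2)"
    proof (rule AE_I2)
      fix x
      have "\<bar>p' (u x)\<bar> * \<bar>q (w x)\<bar> \<le> (2 * A\<^sup>2) * (c * \<bar>w x\<bar>)"
        using p q c by (intro mult_mono) auto
      then have "(norm ((p' (u x) * q (w x)) *\<^sub>R P x))\<^sup>2 \<le> ((2 * A\<^sup>2) * (c * \<bar>w x\<bar>))\<^sup>2 * (norm (P x))\<^sup>2"
        by (intro norm_scaleR_square_le) (simp only: abs_mult)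
      then have 1: "(norm ((p' (u x) * q (w x)) *\<^sub>R P x))\<^sup>2 \<le> (2 * A\<^sup>2 * c)\<^sup>2 * ((w x)\<^sup>2 * (norm (P x))\<^sup>2)"
        by (simp add: power_mult_distrib mult_ac)
      have "\<bar>p (u x)\<bar> * \<bar>q' (w x)\<bar> \<le> A\<^sup>2 * (2 * c)"
        using p q c by (intro mult_mono) auto
      then have 2: "(norm ((p (u x) * q' (w x)) *\<^sub>R g x))\<^sup>2 \<le> (A\<^sup>2 * (2 * c))\<^sup>2 * (norm (g x))\<^sup>2"
        by (intro norm_scaleR_square_le) (simp only: abs_mult)
      show "norm ((norm (F.Q x))\<^sup>2) \<le>
       2 * ((2 * A\<^sup>2 * c)\<^sup>2 * ((w x)\<^sup>2 * (norm (P x))\<^sup>2)) + 2 * ((A\<^sup>2 * (2 * c))\<^sup>2 * (norm (g x))\<^sup>2)"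
        using norm_add_square_bound[OF 1 2] unfolding F.Q_def by simp
    qed
  qed measurable
  have Q2: "(\<lambda>x. (w x)\<^sup>2 * (norm (F.Q x))\<^sup>2) \<in> L1_loc"
  proof (rule L1_loc_bound)
    show "(\<lambda>x. 2 * ((2 * A\<^sup>2)\<^sup>2 * ((w x)\<^sup>2 * (norm (P x))\<^sup>2)) + 2 * ((A\<^sup>2 * 2)\<^sup>2 * (norm (g x))\<^sup>2)) \<in> L1_loc"
      by (intro L1_loc_add L1_loc_cmult wP loc)
    show "AE x in lebesgue. norm ((w x)\<^sup>2 * (norm (F.Q x))\<^sup>2) \<le>
       2 * ((2 * A\<^sup>2)\<^sup>2 * ((w x)\<^sup>2 * (norm (P x))\<^sup>2)) + 2 * ((A\<^sup>2 * 2)\<^sup>2 * (norm (g x))\<^sup>2)"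
    proof (rule AE_I2)
      fix x
      have eq: "(w x)\<^sup>2 * (norm (F.Q x))\<^sup>2 = (norm ((p' (u x) * q (w x)) *\<^sub>R (w x *\<^sub>R P x) + (p (u x) * (w x * q' (w x))) *\<^sub>R g x))\<^sup>2"
      proof -
        have "w x *\<^sub>R F.Q x = (p' (u x) * q (w x)) *\<^sub>R (w x *\<^sub>R P x) + (p (u x) * (w x * q' (w x))) *\<^sub>R g x"
          by (simp add: F.Q_def algebra_simps)
        then show ?thesis by (metis norm_scaleR power_mult_distrib power2_abs)
      qed
      have "\<bar>p' (u x)\<bar> * \<bar>q (w x)\<bar> \<le> (2 * A\<^sup>2) * 1"
        using p q by (intro mult_mono) auto
      then have "(norm ((p' (u x) * q (w x)) *\<^sub>R (w x *\<^sub>R P x)))\<^sup>2 \<le> (2 * A\<^sup>2)\<^sup>2 * (norm (w x *\<^sub>R P x))\<^sup>2"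
        by (intro norm_scaleR_square_le) (simp add: abs_mult)
      then have 1: "(norm ((p' (u x) * q (w x)) *\<^sub>R (w x *\<^sub>R P x)))\<^sup>2 \<le> (2 * A\<^sup>2)\<^sup>2 * ((w x)\<^sup>2 * (norm (P x))\<^sup>2)"
        by (simp add: power_mult_distrib)
      have "\<bar>damp k (w x)\<bar> * \<bar>w x * damp' k (w x)\<bar> \<le> 1 * 1" using h hw by (intro mult_mono) auto
      then have "\<bar>w x * q' (w x)\<bar> \<le> 2" by (simp add: q'_def abs_mult mult_ac)
      then have "\<bar>p (u x)\<bar> * \<bar>w x * q' (w x)\<bar> \<le> A\<^sup>2 * 2"
        using p by (intro mult_mono) auto
      then have 2: "(norm ((p (u x) * (w x * q' (w x))) *\<^sub>R g x))\<^sup>2 \<le> (A\<^sup>2 * 2)\<^sup>2 * (norm (g x))\<^sup>2"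
        by (intro norm_scaleR_square_le) (simp only: abs_mult)
      show "norm ((w x)\<^sup>2 * (norm (F.Q x))\<^sup>2) \<le>
       2 * ((2 * A\<^sup>2)\<^sup>2 * ((w x)\<^sup>2 * (norm (P x))\<^sup>2)) + 2 * ((A\<^sup>2 * 2)\<^sup>2 * (norm (g x))\<^sup>2)"
        using norm_add_square_bound[OF 1 2] unfolding eq by simp
    qed
  qed measurable

  obtain B C where "B > 0" and "\<And>x. norm (\<kappa>' x) \<le> B" and "C > 0" "\<And>x. \<bar>\<kappa> x\<bar> \<le> C"
    and \<Phi>2: "\<And>x. (\<Phi> k x)\<^sup>2 \<le> (C * A)\<^sup>2"
    and D\<Phi>2: "\<And>x. (w x)\<^sup>2 * (norm (D\<Phi> k x))\<^sup>2 \<le>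
      2 * (2 * (A\<^sup>2 * (B\<^sup>2 * (w x)\<^sup>2)) + 2 * ((C * A)\<^sup>2 * ((w x)\<^sup>2 * (norm (P x))\<^sup>2)))
        + 2 * ((C * A)\<^sup>2 * (norm (g x))\<^sup>2)"
    using cutoff_bounds k by metis
  have \<Phi>0: "\<Phi> k x = 0" "D\<Phi> k x = 0" if "norm x \<ge> R" for x
    using \<kappa>(3,4)[OF that] by (simp_all add: \<Phi>_def D\<Phi>_def)
  have \<Phi>_int: "integrable lebesgue (\<lambda>x. (\<Phi> k x)\<^sup>2 * f x)" if "f \<in> L1_loc" for f
    by (rule L1_loc_integrable[where R=R], rule L1_loc_mult_bounded[OF that, where B="(C * A)\<^sup>2"])
      (use \<Phi>0 \<Phi>2 in auto)
  have "(\<lambda>x. (w x)\<^sup>2 * (norm (D\<Phi> k x))\<^sup>2) \<in> L1_loc"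
  proof (rule L1_loc_bound)
    show "(\<lambda>x. (w x)\<^sup>2 * (norm (D\<Phi> k x))\<^sup>2) \<in> borel_measurable lebesgue" by measurable
    show "(\<lambda>x. 2 * (2 * (A\<^sup>2 * (B\<^sup>2 * (w x)\<^sup>2)) + 2 * ((C * A)\<^sup>2 * ((w x)\<^sup>2 * (norm (P x))\<^sup>2)))
        + 2 * ((C * A)\<^sup>2 * (norm (g x))\<^sup>2)) \<in> L1_loc"
      by (intro L1_loc_add L1_loc_cmult loc wP)
  qed (use D\<Phi>2 in simp)
  then show I1: ?I1
    by (rule L1_loc_integrable[where R=R]) (use \<Phi>0 in auto)
  show I2: ?I2
  proof (rule \<Phi>_int)
    have "(\<lambda>x. (norm (g x))\<^sup>2 - (1 / 2) * l x) \<in> L1_loc"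
      by (intro L1_loc_diff L1_loc_cmult loc)
    then show "(\<lambda>x. (norm (g x))\<^sup>2 - l x / 2) \<in> L1_loc" by simp
  qed
  show I3: ?I3 by (rule \<Phi>_int) (rule loc)
  have I4: "integrable lebesgue (\<lambda>x. (\<Phi> k x)\<^sup>2 * (w x)\<^sup>2 * (F.dY x - (norm (Y x))\<^sup>2))"
  proof -
    have "(\<lambda>x. (F.dY x - (norm (Y x))\<^sup>2) * (w x)\<^sup>2) \<in> L1_loc"
    proof (rule L1_loc_mult_bounded[OF loc(1)])
      show "\<bar>F.dY x - (norm (Y x))\<^sup>2\<bar> \<le> N' + N\<^sup>2" for x
      proof -
        have "(norm (Y x))\<^sup>2 \<le> N\<^sup>2" using Y(3) by (intro power_mono) auto
        then show ?thesis using Y(4)[of x] zero_le_power2[of "norm (Y x)"] unfolding F.dY_def by linarith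
      qed
    qed measurable
    from \<Phi>_int[OF this] show ?thesis by (simp add: mult_ac)
  qed
  then show ?I4 by (simp add: F.dY_def)
  define E where "E x = field_limit (p (u x) * q (w x)) (\<zeta> x) (\<zeta>' x) (Y x) (F.dY x) ((w x)\<^sup>2) (D x) (l x) (F.Q x)" for x
  have E: "integrable lebesgue E" "(\<integral>x. E x \<partial>lebesgue) = 0"
    unfolding E_def by (rule F.field_identity[OF Y(3) Y(4)[folded F.dY_def] Q1 Q2])+
  have "0 \<le> (\<integral>x. (w x)\<^sup>2 * (norm (D\<Phi> k x))\<^sup>2 + (\<Phi> k x)\<^sup>2 * ((norm (g x))\<^sup>2 - l x / 2) + E x
      - (\<Phi> k x)\<^sup>2 * (w x)\<^sup>2 * (F.dY x - (norm (Y x))\<^sup>2) \<partial>lebesgue)"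
  proof (rule integral_nonneg_AE)
    show "AE x in lebesgue. 0 \<le> (w x)\<^sup>2 * (norm (D\<Phi> k x))\<^sup>2 + (\<Phi> k x)\<^sup>2 * ((norm (g x))\<^sup>2 - l x / 2) + E x
      - (\<Phi> k x)\<^sup>2 * (w x)\<^sup>2 * (F.dY x - (norm (Y x))\<^sup>2)"
      using D_eq
    proof eventually_elim
      case (elim x)
      have "E x = (2 * \<Phi> k x) * (D\<Phi> k x \<bullet> (w x *\<^sub>R g x + (w x)\<^sup>2 *\<^sub>R Y x))
          + (\<Phi> k x)\<^sup>2 * (l x / 2 + D x \<bullet> Y x + (w x)\<^sup>2 * F.dY x)"
        unfolding E_def field_limit_def D\<Phi>_def \<Phi>_def F.Q_def \<zeta>_def \<zeta>'_def p_def p'_def q_def q'_def elim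
        by (simp add: inner_add_left inner_add_right inner_commute power2_eq_square algebra_simps)
      \<comment> \<open>With grad \<mu> = 2 w grad w, this is \<mu> times the square of D\<Phi> +
        \<Phi> (Y + grad \<mu> / (2 \<mu>)), in a form that also makes sense where \<mu> =
        0.\<close>
      moreover have "(norm (w x *\<^sub>R D\<Phi> k x + \<Phi> k x *\<^sub>R (g x + w x *\<^sub>R Y x)))\<^sup>2 =
          (w x)\<^sup>2 * (norm (D\<Phi> k x))\<^sup>2 + (2 * \<Phi> k x) * (D\<Phi> k x \<bullet> (w x *\<^sub>R g x + (w x)\<^sup>2 *\<^sub>R Y x))
          + (\<Phi> k x)\<^sup>2 * ((norm (g x))\<^sup>2 + D x \<bullet> Y x + (w x)\<^sup>2 * (norm (Y x))\<^sup>2)"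
        unfolding elim power2_norm_eq_inner
        by (simp add: inner_add_left inner_add_right inner_commute power2_eq_square algebra_simps)
      ultimately have "(w x)\<^sup>2 * (norm (D\<Phi> k x))\<^sup>2 + (\<Phi> k x)\<^sup>2 * ((norm (g x))\<^sup>2 - l x / 2) + E x
          - (\<Phi> k x)\<^sup>2 * (w x)\<^sup>2 * (F.dY x - (norm (Y x))\<^sup>2) = (norm (w x *\<^sub>R D\<Phi> k x + \<Phi> k x *\<^sub>R (g x + w x *\<^sub>R Y x)))\<^sup>2"
        by (simp add: algebra_simps)
      then show ?case by simp
    qed
  qed
  also have "\<dots> = (\<integral>x. (w x)\<^sup>2 * (norm (D\<Phi> k x))\<^sup>2 \<partial>lebesgue) + (\<integral>x. (\<Phi> k x)\<^sup>2 * ((norm (g x))\<^sup>2 - l x / 2) \<partial>lebesgue)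
     + (\<integral>x. E x \<partial>lebesgue) - (\<integral>x. (\<Phi> k x)\<^sup>2 * (w x)\<^sup>2 * (F.dY x - (norm (Y x))\<^sup>2) \<partial>lebesgue)"
    using I1 I2 E(1) I4
    by (subst Bochner_Integration.integral_diff Bochner_Integration.integral_add;
        (intro Bochner_Integration.integrable_add)?; simp?)+
  finally show "(\<integral>x. (\<Phi> k x)\<^sup>2 * (w x)\<^sup>2 * ((\<Sum>i\<in>Basis. Y' i x \<bullet> i) - (norm (Y x))\<^sup>2) \<partial>lebesgue)
      \<le> (\<integral>x. (w x)\<^sup>2 * (norm (D\<Phi> k x))\<^sup>2 \<partial>lebesgue) + (\<integral>x. (\<Phi> k x)\<^sup>2 * ((norm (g x))\<^sup>2 - l x / 2) \<partial>lebesgue)"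
    unfolding E(2) F.dY_def by linarith
qed

end

section \<open>Cut-off functions and the radial field\<close>

text \<open>Fatou on the left and dominated convergence on the right: the singular weight \<rho>
  needs no majorant, and the limit of the left side may a priori be infinite.\<close>

lemma ennreal_weighted_limit:
  fixes b :: "nat \<Rightarrow> 'a \<Rightarrow> real"
  assumes le: "\<And>n. (\<integral>\<^sup>+x. ennreal (b n x * \<rho> x) \<partial>M) \<le> ennreal ((\<integral>x. a n x \<partial>M) + C * (\<integral>x. b n x \<partial>M))"
    and meas: "\<And>n. a n \<in> borel_measurable M" "\<And>n. b n \<in> borel_measurable M" "\<rho> \<in> borel_measurable M"
      "a' \<in> borel_measurable M" "b' \<in> borel_measurable M"
    and a: "AE x in M. (\<lambda>n. a n x) \<longlonglongrightarrow> a' x" "integrable M wa" "\<And>n. AE x in M. norm (a n x) \<le> wa x"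
    and b: "AE x in M. (\<lambda>n. b n x) \<longlonglongrightarrow> b' x" "integrable M wb" "\<And>n. AE x in M. norm (b n x) \<le> wb x"
  shows "(\<integral>\<^sup>+x. ennreal (b' x * \<rho> x) \<partial>M) \<le> ennreal ((\<integral>x. a' x \<partial>M) + C * (\<integral>x. b' x \<partial>M))"
proof -
  note [measurable] = meas
  have "(\<lambda>n. (\<integral>x. a n x \<partial>M) + C * (\<integral>x. b n x \<partial>M)) \<longlonglongrightarrow> (\<integral>x. a' x \<partial>M) + C * (\<integral>x. b' x \<partial>M)"
    by (intro tendsto_intros integral_dominated_convergence[OF meas(4,1) a(2,1,3)]
        integral_dominated_convergence[OF meas(5,2) b(2,1,3)])
  then have lim: "(\<lambda>n. ennreal ((\<integral>x. a n x \<partial>M) + C * (\<integral>x. b n x \<partial>M))) \<longlonglongrightarrow> ennreal ((\<integral>x. a' x \<partial>M) + C * (\<integral>x. b' x \<partial>M))"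
    by (rule tendsto_ennrealI)
  have "(\<integral>\<^sup>+x. ennreal (b' x * \<rho> x) \<partial>M) = (\<integral>\<^sup>+x. liminf (\<lambda>n. ennreal (b n x * \<rho> x)) \<partial>M)"
  proof (rule nn_integral_cong_AE)
    show "AE x in M. ennreal (b' x * \<rho> x) = liminf (\<lambda>n. ennreal (b n x * \<rho> x))"
      using b(1)
    proof eventually_elim
      case (elim x)
      have "(\<lambda>n. ennreal (b n x * \<rho> x)) \<longlonglongrightarrow> ennreal (b' x * \<rho> x)"
        by (intro tendsto_ennrealI tendsto_mult elim tendsto_const)
      then show ?case by (simp add: lim_imp_Liminf)
    qed
  qed
  also have "\<dots> \<le> liminf (\<lambda>n. \<integral>\<^sup>+x. ennreal (b n x * \<rho> x) \<partial>M)"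
    by (rule nn_integral_liminf) measurable
  also have "\<dots> \<le> liminf (\<lambda>n. ennreal ((\<integral>x. a n x \<partial>M) + C * (\<integral>x. b n x \<partial>M)))"
    by (intro Liminf_mono always_eventually allI le)
  also have "\<dots> = ennreal ((\<integral>x. a' x \<partial>M) + C * (\<integral>x. b' x \<partial>M))"
    using lim by (simp add: lim_imp_Liminf)
  finally show ?thesis .
qed

text \<open>For \<delta> = 0, div Y - |Y|^2 equals (a (N - 2) - a^2) / |x|^2, which is largest for a
  = (N - 2) / 2, with numerator c_0(N). A positive \<delta> makes the field C^1 and bounded.\<close>

definition hardy_field :: "real \<Rightarrow> real \<Rightarrow> 'a::euclidean_space \<Rightarrow> 'a" where
  "hardy_field a \<delta> x = (a / ((norm x)\<^sup>2 + \<delta>)) *\<^sub>R x"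

definition hardy_field_grad :: "real \<Rightarrow> real \<Rightarrow> 'a::euclidean_space \<Rightarrow> 'a \<Rightarrow> 'a" where
  "hardy_field_grad a \<delta> i x = (a / ((norm x)\<^sup>2 + \<delta>)) *\<^sub>R i
     + (x \<bullet> i) *\<^sub>R ((- (a / ((norm x)\<^sup>2 + \<delta>)\<^sup>2)) *\<^sub>R (2 *\<^sub>R x))"

lemma hardy_field:
  fixes a \<delta> :: real and x :: "'a::euclidean_space"
  assumes a: "a > 0" and \<delta>: "\<delta> > 0"
  shows "GDERIV (\<lambda>x. hardy_field a \<delta> x \<bullet> i) x :> hardy_field_grad a \<delta> i x"
    and "continuous_on UNIV (hardy_field_grad a \<delta> (i :: 'a))"
    and "norm (hardy_field a \<delta> x) \<le> a * (1 + 1 / \<delta>)"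
    and "\<bar>\<Sum>i\<in>Basis. hardy_field_grad a \<delta> i x \<bullet> i\<bar> \<le> (real DIM('a) + 2) * a / \<delta>"
    and "2 * a = real DIM('a) - 2 \<Longrightarrow> a\<^sup>2 / ((norm x)\<^sup>2 + \<delta>)
      \<le> (\<Sum>i\<in>Basis. hardy_field_grad a \<delta> i x \<bullet> i) - (norm (hardy_field a \<delta> x))\<^sup>2"
proof -
  have s: "(norm y)\<^sup>2 + \<delta> > 0" for y :: 'a using \<delta> by (simp add: add_nonneg_pos)
  have nz: "(norm y)\<^sup>2 + \<delta> \<noteq> 0" for y :: 'a using s[of y] by linarith
  have 1: "GDERIV (\<lambda>x::'a. (norm x)\<^sup>2 + \<delta>) x :> 2 *\<^sub>R x" for x
    unfolding gderiv_def power2_norm_eq_inner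
    by (auto intro!: derivative_eq_intros simp: fun_eq_iff inner_commute)
  have 2: "((\<lambda>t. a / t) has_real_derivative - (a / t\<^sup>2)) (at t)" if "t \<noteq> 0" for t
    using that by (auto intro!: derivative_eq_intros simp: power2_eq_square)
  have 3: "GDERIV (\<lambda>x. x \<bullet> i) x :> i" for x
    unfolding gderiv_def by (auto intro!: derivative_eq_intros)
  have "GDERIV (\<lambda>x. a / ((norm x)\<^sup>2 + \<delta>) * (x \<bullet> i)) x :> hardy_field_grad a \<delta> i x"
    unfolding hardy_field_grad_def by (intro GDERIV_mult GDERIV_DERIV_compose[OF 1 2] nz 3)
  then show "GDERIV (\<lambda>x. hardy_field a \<delta> x \<bullet> i) x :> hardy_field_grad a \<delta> i x" by (simp add: hardy_field_def)
  show "continuous_on UNIV (hardy_field_grad a \<delta> i)"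
    unfolding hardy_field_grad_def[abs_def] using nz by (intro continuous_intros) auto
  let ?s = "(norm x)\<^sup>2 + \<delta>"
  have nY: "norm (hardy_field a \<delta> x) = a * norm x / ?s" using a s[of x] by (simp add: hardy_field_def)
  have "norm x \<le> (norm x)\<^sup>2 + 1"
    using sum_squares_bound[of "norm x" 1] norm_ge_zero[of x] by (simp; linarith)
  also have "\<dots> \<le> (1 + 1 / \<delta>) * ?s" using \<delta> by (simp add: field_simps)
  finally have "a * norm x \<le> a * ((1 + 1 / \<delta>) * ?s)" using a by (intro mult_left_mono) auto
  then show "norm (hardy_field a \<delta> x) \<le> a * (1 + 1 / \<delta>)"
    unfolding nY using s[of x] by (simp add: divide_le_eq mult.assoc)
  have div: "(\<Sum>i\<in>Basis. hardy_field_grad a \<delta> i x \<bullet> i) = real DIM('a) * a / ?s - 2 * a * (norm x)\<^sup>2 / ?s\<^sup>2"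
  proof -
    have "(\<Sum>i\<in>Basis. hardy_field_grad a \<delta> i x \<bullet> i) = (\<Sum>i\<in>(Basis :: 'a set). a / ?s + (- (2 * a / ?s\<^sup>2)) * ((x \<bullet> i) * (x \<bullet> i)))"
      by (intro sum.cong refl) (simp add: hardy_field_grad_def inner_add_left inner_diff_left mult_ac)
    also have "\<dots> = real DIM('a) * (a / ?s) + (- (2 * a / ?s\<^sup>2)) * (x \<bullet> x)"
      unfolding sum.distrib sum_distrib_left[symmetric] by (subst (2) euclidean_inner) simp
    finally show ?thesis by (simp add: power2_norm_eq_inner)
  qed
  have le: "(norm x)\<^sup>2 / ?s\<^sup>2 \<le> 1 / ?s"
    using s[of x] \<delta> by (simp add: divide_simps power2_eq_square[of ?s])
  have "1 / ?s \<le> 1 / \<delta>" using s[of x] \<delta> by (intro divide_left_mono) auto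
  then have "real DIM('a) * a * (1 / ?s) \<le> real DIM('a) * a * (1 / \<delta>)"
    using a by (intro mult_left_mono) simp_all
  moreover have "2 * a * ((norm x)\<^sup>2 / ?s\<^sup>2) \<le> 2 * a * (1 / \<delta>)"
    using a order_trans[OF le \<open>1 / ?s \<le> 1 / \<delta>\<close>] by (intro mult_left_mono) simp_all
  moreover have "0 \<le> real DIM('a) * a * (1 / ?s)" "0 \<le> 2 * a * ((norm x)\<^sup>2 / ?s\<^sup>2)"
    using a s[of x] by (intro mult_nonneg_nonneg; simp)+
  ultimately have "\<bar>real DIM('a) * a * (1 / ?s) - 2 * a * ((norm x)\<^sup>2 / ?s\<^sup>2)\<bar> \<le> real DIM('a) * a * (1 / \<delta>) + 2 * a * (1 / \<delta>)"
    by linarith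
  then show "\<bar>\<Sum>i\<in>Basis. hardy_field_grad a \<delta> i x \<bullet> i\<bar> \<le> (real DIM('a) + 2) * a / \<delta>"
    unfolding div by (simp add: add_divide_distrib distrib_right)
  \<comment> \<open>With s = |x|^2 + \<delta> and N = 2 a + 2 the right side is (2 a^2 + 2 a) / s -
    (2 a + a^2) |x|^2 / s^2, and |x|^2 / s^2 \<le> 1 / s leaves a^2 / s.\<close>
  assume dim: "2 * a = real DIM('a) - 2"
  have "(2 * a + a\<^sup>2) * ((norm x)\<^sup>2 / ?s\<^sup>2) \<le> (2 * a + a\<^sup>2) * (1 / ?s)"
    using a le by (intro mult_left_mono) auto
  moreover have N: "real DIM('a) = 2 * a + 2" using dim by linarith
  have "real DIM('a) * a = 2 * a\<^sup>2 + 2 * a"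
    unfolding N by (simp add: power2_eq_square algebra_simps)
  ultimately show "a\<^sup>2 / ?s \<le> (\<Sum>i\<in>Basis. hardy_field_grad a \<delta> i x \<bullet> i) - (norm (hardy_field a \<delta> x))\<^sup>2"
    unfolding div nY by (simp add: power_divide power_mult_distrib add_divide_distrib distrib_right)
qed

text \<open>Squaring the positive part makes the function C^1, which is the regularity required of a
  test function in \<open>weak_gradient_product_chain\<close>.\<close>

definition cutoff :: "real \<Rightarrow> 'a::euclidean_space \<Rightarrow> real" where
  "cutoff R x = (max 0 (1 - (norm x)\<^sup>2 / R\<^sup>2))\<^sup>2"

definition cutoff_grad :: "real \<Rightarrow> 'a::euclidean_space \<Rightarrow> 'a" where
  "cutoff_grad R x = (2 * max 0 (1 - (norm x)\<^sup>2 / R\<^sup>2)) *\<^sub>R ((- 2 / R\<^sup>2) *\<^sub>R x)"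

lemma max_0_square_DERIV: "((\<lambda>t. (max 0 t)\<^sup>2) has_real_derivative 2 * max 0 t) (at (t :: real))"
proof (cases t "0::real" rule: linorder_cases)
  case less
  have "((\<lambda>t. 0::real) has_real_derivative 0) (at t)" by simp
  then have "((\<lambda>t. (max 0 t)\<^sup>2) has_real_derivative 0) (at t)"
    by (rule has_field_derivative_transform_within_open[of _ _ _ "{..<0}"]) (use less in auto)
  then show ?thesis using less by simp
next
  case greater
  have "((\<lambda>t::real. t\<^sup>2) has_real_derivative 2 * t) (at t)"
    by (auto intro!: derivative_eq_intros)
  then have "((\<lambda>t. (max 0 t)\<^sup>2) has_real_derivative 2 * t) (at t)"
    by (rule has_field_derivative_transform_within_open[of _ _ _ "{0<..}"]) (use greater in auto)
  then show ?thesis using greater by simp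
next
  case equal
  have "(\<lambda>h::real. (max 0 h)\<^sup>2 / h) = max 0"
    by (auto simp: fun_eq_iff max_def power2_eq_square)
  moreover have "(max 0 \<longlongrightarrow> max 0 (0::real)) (at 0)" by (intro tendsto_intros)
  ultimately show ?thesis using equal by (simp add: DERIV_def)
qed

lemma cutoff_facts:
  assumes R: "R \<ge> 1"
  shows "GDERIV (cutoff R) x :> cutoff_grad R (x::'a::euclidean_space)"
    and "continuous_on UNIV (cutoff_grad R :: 'a \<Rightarrow> 'a)"
    and "norm x \<ge> R \<Longrightarrow> cutoff R x = 0" "norm x \<ge> R \<Longrightarrow> cutoff_grad R x = 0"
    and "\<bar>cutoff R x\<bar> \<le> 1" "norm (cutoff_grad R x) \<le> 4 / R"
proof -
  have 1: "GDERIV (\<lambda>x::'a. 1 - (norm x)\<^sup>2 / R\<^sup>2) x :> (- 2 / R\<^sup>2) *\<^sub>R x"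
    unfolding gderiv_def power2_norm_eq_inner divide_inverse
    by (auto intro!: derivative_eq_intros simp: fun_eq_iff inner_commute)
  show "GDERIV (cutoff R) x :> cutoff_grad R x"
    unfolding cutoff_def[abs_def] cutoff_grad_def by (rule GDERIV_DERIV_compose[OF 1 max_0_square_DERIV])
  show "continuous_on UNIV (cutoff_grad R :: 'a \<Rightarrow> 'a)"
    unfolding cutoff_grad_def divide_inverse by (intro continuous_intros)
  have z: "max 0 (1 - (norm x)\<^sup>2 / R\<^sup>2) = 0" if "norm x \<ge> R"
  proof -
    have "R\<^sup>2 \<le> (norm x)\<^sup>2" using that R by (intro power_mono) auto
    moreover have "0 < R\<^sup>2" using R by simp
    ultimately have "1 \<le> (norm x)\<^sup>2 / R\<^sup>2" by (subst pos_le_divide_eq) auto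
    then show ?thesis by simp
  qed
  then show "norm x \<ge> R \<Longrightarrow> cutoff R x = 0" "norm x \<ge> R \<Longrightarrow> cutoff_grad R x = 0"
    by (simp_all add: cutoff_def cutoff_grad_def)
  have m: "0 \<le> max 0 (1 - (norm x)\<^sup>2 / R\<^sup>2)" "max 0 (1 - (norm x)\<^sup>2 / R\<^sup>2) \<le> 1"
    by auto
  then show "\<bar>cutoff R x\<bar> \<le> 1"
    unfolding cutoff_def by (simp add: power_le_one)
  show "norm (cutoff_grad R x) \<le> 4 / R"
  proof (cases "norm x \<le> R")
    case True
    have "norm (cutoff_grad R x) = max 0 (1 - (norm x)\<^sup>2 / R\<^sup>2) * (4 / R\<^sup>2 * norm x)"
      by (simp add: cutoff_grad_def)
    also have "\<dots> \<le> 1 * (4 / R\<^sup>2 * R)" using m True by (intro mult_mono) auto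
    finally show ?thesis using R by (simp add: power2_eq_square)
  next
    case False
    then show ?thesis using z R by (simp add: cutoff_grad_def)
  qed
qed

lemma cutoff_tendsto: "(\<lambda>n. cutoff (real (Suc n)) x) \<longlonglongrightarrow> 1"
proof -
  have "(\<lambda>n. (max 0 (1 - (norm x)\<^sup>2 * (inverse (real (Suc n)))\<^sup>2))\<^sup>2) \<longlonglongrightarrow> (max 0 (1 - (norm x)\<^sup>2 * 0\<^sup>2))\<^sup>2"
    by (intro tendsto_intros LIMSEQ_inverse_real_of_nat)
  then show ?thesis by (simp add: cutoff_def divide_inverse power_inverse)
qed

lemma cutoff_grad_tendsto: "(\<lambda>n. cutoff_grad (real (Suc n)) (x::'a::euclidean_space)) \<longlonglongrightarrow> 0"
proof (rule tendsto_norm_zero_cancel, rule tendsto_sandwich[OF _ _ tendsto_const])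
  have "(\<lambda>n. 4 * inverse (real (Suc n))) \<longlonglongrightarrow> 4 * 0"
    by (intro tendsto_intros LIMSEQ_inverse_real_of_nat)
  then show "(\<lambda>n. 4 / real (Suc n)) \<longlonglongrightarrow> 0" by (simp add: divide_inverse)
  show "\<forall>\<^sub>F n in sequentially. norm (cutoff_grad (real (Suc n)) x) \<le> 4 / real (Suc n)"
    by (intro always_eventually allI cutoff_facts(6)) simp
qed simp

text \<open>A C^1 substitute for clipping. It is not monotone and decays at infinity, but it stays
  below |s| in absolute value, its derivative is bounded by 1, and it tends to the identity; the
  exhaustion needs exactly this.\<close>

definition trunc :: "real \<Rightarrow> real \<Rightarrow> real" where
  "trunc k s = k * s / (k + s\<^sup>2)"

definition trunc' :: "real \<Rightarrow> real \<Rightarrow> real" where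
  "trunc' k s = k * (k - s\<^sup>2) / (k + s\<^sup>2)\<^sup>2"

lemma trunc_facts:
  assumes k: "k \<ge> 1"
  shows "(trunc k has_real_derivative trunc' k s) (at s)" "continuous_on UNIV (trunc' k)"
    and "\<bar>trunc k s\<bar> \<le> k" "\<bar>trunc k s\<bar> \<le> \<bar>s\<bar>" "\<bar>trunc' k s\<bar> \<le> 1"
proof -
  have pos: "k + t\<^sup>2 > 0" for t using k by (simp add: add_pos_nonneg)
  have nz: "k + t\<^sup>2 \<noteq> 0" for t using pos[of t] by linarith
  show "(trunc k has_real_derivative trunc' k s) (at s)"
    unfolding trunc_def[abs_def] trunc'_def
    by (rule derivative_eq_intros refl nz)+ (simp add: power2_eq_square algebra_simps)
  show "continuous_on UNIV (trunc' k)"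
    unfolding trunc'_def using nz by (intro continuous_intros) auto
  have eq: "\<bar>trunc k s\<bar> = k * \<bar>s\<bar> / (k + s\<^sup>2)"
    using k pos[of s] by (simp add: trunc_def abs_mult)
  have "\<bar>s\<bar> \<le> k + s\<^sup>2"
    using sum_squares_bound[of "\<bar>s\<bar>" 1] k by (simp; linarith)
  then have "k * \<bar>s\<bar> \<le> k * (k + s\<^sup>2)" using k by (intro mult_left_mono) auto
  then show "\<bar>trunc k s\<bar> \<le> k" unfolding eq using pos[of s] by (simp add: divide_le_eq)
  have "k * \<bar>s\<bar> \<le> (k + s\<^sup>2) * \<bar>s\<bar>" by (intro mult_right_mono) auto
  then show "\<bar>trunc k s\<bar> \<le> \<bar>s\<bar>" unfolding eq using pos[of s] by (simp add: divide_le_eq mult.commute)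
  have "\<bar>k - s\<^sup>2\<bar> \<le> k + s\<^sup>2" using k zero_le_power2[of s] by linarith
  then have "k * \<bar>k - s\<^sup>2\<bar> \<le> (k + s\<^sup>2) * (k + s\<^sup>2)"
    using k by (intro mult_mono) auto
  then show "\<bar>trunc' k s\<bar> \<le> 1"
    using k pos[of s] by (simp add: trunc'_def abs_mult power2_eq_square)
qed

lemma trunc_tendsto:
  "(\<lambda>n. trunc (real (Suc n)) s) \<longlonglongrightarrow> s" "(\<lambda>n. trunc' (real (Suc n)) s) \<longlonglongrightarrow> 1"
proof -
  have inv: "(\<lambda>n. inverse (real (Suc n))) \<longlonglongrightarrow> 0" by (rule LIMSEQ_inverse_real_of_nat)
  have e: "1 + inverse (real (Suc n)) * s\<^sup>2 = (real (Suc n) + s\<^sup>2) / real (Suc n)" for n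
    by (simp add: field_simps)
  have "(\<lambda>n. s / (1 + inverse (real (Suc n)) * s\<^sup>2)) \<longlonglongrightarrow> s / (1 + 0 * s\<^sup>2)"
    by (intro tendsto_intros inv) simp
  then show "(\<lambda>n. trunc (real (Suc n)) s) \<longlonglongrightarrow> s"
    unfolding e by (simp add: trunc_def mult.commute)
  have "(\<lambda>n. (1 - inverse (real (Suc n)) * s\<^sup>2) / (1 + inverse (real (Suc n)) * s\<^sup>2)\<^sup>2) \<longlonglongrightarrow> (1 - 0 * s\<^sup>2) / (1 + 0 * s\<^sup>2)\<^sup>2"
    by (intro tendsto_intros inv) simp
  moreover have "(1 - inverse k * s\<^sup>2) / ((k + s\<^sup>2) / k)\<^sup>2 = trunc' k s" if "k > 0" for k
  proof -
    have "1 - inverse k * s\<^sup>2 = (k - s\<^sup>2) / k" using that by (simp add: field_simps)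
    then show ?thesis using that by (simp add: trunc'_def power_divide power2_eq_square)
  qed
  ultimately show "(\<lambda>n. trunc' (real (Suc n)) s) \<longlonglongrightarrow> 1"
    unfolding e by simp
qed

lemma damp_tendsto:
  "(\<lambda>n. damp (inverse (real (Suc n))) t) \<longlonglongrightarrow> (if t = 0 then 0 else 1)"
  "(\<lambda>n. t * damp' (inverse (real (Suc n))) t) \<longlonglongrightarrow> 0"
proof -
  have inv: "(\<lambda>n. inverse (real (Suc n))) \<longlonglongrightarrow> 0" by (rule LIMSEQ_inverse_real_of_nat)
  show "(\<lambda>n. damp (inverse (real (Suc n))) t) \<longlonglongrightarrow> (if t = 0 then 0 else 1)"
  proof (cases "t = 0")
    case False
    have "(\<lambda>n. t\<^sup>2 / (inverse (real (Suc n)) + t\<^sup>2)) \<longlonglongrightarrow> t\<^sup>2 / (0 + t\<^sup>2)"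
      using False by (intro tendsto_intros inv) simp
    then show ?thesis using False by (simp add: damp_def)
  qed (simp add: damp_def)
  show "(\<lambda>n. t * damp' (inverse (real (Suc n))) t) \<longlonglongrightarrow> 0"
  proof (cases "t = 0")
    case False
    have "(\<lambda>n. t * (2 * inverse (real (Suc n)) * t / (inverse (real (Suc n)) + t\<^sup>2)\<^sup>2)) \<longlonglongrightarrow> t * (2 * 0 * t / (0 + t\<^sup>2)\<^sup>2)"
      using False by (intro tendsto_intros inv) simp
    then show ?thesis by (simp add: damp'_def)
  qed simp
qed

section \<open>The weighted Hardy inequality\<close>

context weight
begin

text \<open>Where \<open>\<mu> = w\<^sup>2 > 0\<close>, the left-hand side is \<open>\<mu> U\<^sub>\<mu>\<close>.\<close>

definition potential_bound :: "real \<Rightarrow> real \<Rightarrow> bool" where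
  "potential_bound c C \<longleftrightarrow> (AE x in lebesgue. w x > 0 \<longrightarrow> x \<noteq> 0 \<longrightarrow>
     (norm (g x))\<^sup>2 - l x / 2 \<le> (w x)\<^sup>2 * ((((real DIM('a) - 2) / 2)\<^sup>2 - c) / (norm x)\<^sup>2 + C))"

end

context truncation
begin

text \<open>The right side \<open>K\<close> of the truncated inequality does not involve \<delta>,
  so Fatou makes the singular integral finite. Only then is the pointwise bound on the potential
  integrated: its singular coefficient a^2 - c may have either sign, and the a^2 parts are cancelled
  by subtraction.\<close>

lemma Hardy_truncated:
  assumes dim: "DIM('a) \<ge> 3" and c: "c > 0" and pot: "potential_bound c C" and k: "k > 0"
  shows "(\<integral>\<^sup>+x. ennreal ((\<Phi> k x)\<^sup>2 * (w x)\<^sup>2 * (c / (norm x)\<^sup>2)) \<partial>lebesgue)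
    \<le> ennreal ((\<integral>x. (w x)\<^sup>2 * (norm (D\<Phi> k x))\<^sup>2 \<partial>lebesgue) + C * (\<integral>x. (\<Phi> k x)\<^sup>2 * (w x)\<^sup>2 \<partial>lebesgue))"
proof -
  define a where "a = (real DIM('a) - 2) / 2"
  have a: "a > 0" "2 * a = real DIM('a) - 2" using dim by (simp_all add: a_def)
  let ?S = "\<lambda>x. (norm (g x))\<^sup>2 - l x / 2"
  let ?dv = "\<lambda>\<delta> x. (\<Sum>i\<in>Basis. hardy_field_grad a \<delta> i x \<bullet> i) - (norm (hardy_field a \<delta> x))\<^sup>2"
  define K where "K = (\<integral>x. (w x)\<^sup>2 * (norm (D\<Phi> k x))\<^sup>2 \<partial>lebesgue) + (\<integral>x. (\<Phi> k x)\<^sup>2 * ?S x \<partial>lebesgue)"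
  have tr: "integrable lebesgue (\<lambda>x. (w x)\<^sup>2 * (norm (D\<Phi> k x))\<^sup>2)"
    "integrable lebesgue (\<lambda>x. (\<Phi> k x)\<^sup>2 * ?S x)"
    "integrable lebesgue (\<lambda>x. (\<Phi> k x)\<^sup>2 * (w x)\<^sup>2)"
    "integrable lebesgue (\<lambda>x. (\<Phi> k x)\<^sup>2 * (w x)\<^sup>2 * ?dv \<delta> x)"
    "(\<integral>x. (\<Phi> k x)\<^sup>2 * (w x)\<^sup>2 * ?dv \<delta> x \<partial>lebesgue) \<le> K" if \<delta>: "\<delta> > 0" for \<delta>
    unfolding K_def
    by (rule truncated_inequality[OF hardy_field(1,2,3,4)[OF a(1) \<delta>] k])+
  \<comment> \<open>These three statements do not involve \<delta>; any positive value produces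
    them.\<close>
  have I1: "integrable lebesgue (\<lambda>x. (w x)\<^sup>2 * (norm (D\<Phi> k x))\<^sup>2)"
    and I2: "integrable lebesgue (\<lambda>x. (\<Phi> k x)\<^sup>2 * ?S x)"
    and I3: "integrable lebesgue (\<lambda>x. (\<Phi> k x)\<^sup>2 * (w x)\<^sup>2)"
    by (rule tr[of 1]; simp)+
  note [measurable] = borel_measurable_integrable[OF I3]
  have [measurable]: "(\<lambda>x::'a. norm x) \<in> borel_measurable lebesgue"
    by (rule lebesgue_measurable_continuous) (intro continuous_intros)
  define f where "f x = (\<Phi> k x)\<^sup>2 * (w x)\<^sup>2 / (norm x)\<^sup>2" for x
  define h where "h n x = (\<Phi> k x)\<^sup>2 * (w x)\<^sup>2 * (a\<^sup>2 / ((norm x)\<^sup>2 + inverse (real (Suc n))))" for n x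
  have [measurable]: "f \<in> borel_measurable lebesgue" "h n \<in> borel_measurable lebesgue" for n
    unfolding f_def h_def by measurable
  have h_nonneg: "h n x \<ge> 0" for n x
    unfolding h_def by (intro mult_nonneg_nonneg divide_nonneg_nonneg add_nonneg_nonneg) auto
  have h: "integrable lebesgue (h n)" "(\<integral>x. h n x \<partial>lebesgue) \<le> K" for n
  proof -
    define \<delta> where "\<delta> = inverse (real (Suc n))"
    have \<delta>: "\<delta> > 0" by (simp add: \<delta>_def)
    have le: "h n x \<le> (\<Phi> k x)\<^sup>2 * (w x)\<^sup>2 * ?dv \<delta> x" for x
      unfolding h_def \<delta>_def[symmetric] by (intro mult_left_mono hardy_field(5)[OF a(1) \<delta> a(2)]) auto
    show hi: "integrable lebesgue (h n)"
    proof -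
      have "integrable lebesgue (\<lambda>x. ((\<Phi> k x)\<^sup>2 * (w x)\<^sup>2) *\<^sub>R (a\<^sup>2 / ((norm x)\<^sup>2 + \<delta>)))"
      proof (rule integrable_times_bounded[OF I3])
        fix x :: 'a
        have "a\<^sup>2 / ((norm x)\<^sup>2 + \<delta>) \<le> a\<^sup>2 / \<delta>"
          using \<delta> by (intro divide_left_mono mult_pos_pos add_nonneg_pos) auto
        then show "norm (a\<^sup>2 / ((norm x)\<^sup>2 + \<delta>)) \<le> a\<^sup>2 / \<delta>"
          using \<delta> by simp
      qed measurable
      then show ?thesis by (simp add: h_def[abs_def] \<delta>_def)
    qed
    have "(\<integral>x. h n x \<partial>lebesgue) \<le> (\<integral>x. (\<Phi> k x)\<^sup>2 * (w x)\<^sup>2 * ?dv \<delta> x \<partial>lebesgue)"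
    proof (rule integral_mono[OF hi _ le])
      show "integrable lebesgue (\<lambda>x. (\<Phi> k x)\<^sup>2 * (w x)\<^sup>2 * ?dv \<delta> x)"
        by (rule tr(4)[OF \<delta>])
    qed
    also have "\<dots> \<le> K" by (rule tr(5)[OF \<delta>])
    finally show "(\<integral>x. h n x \<partial>lebesgue) \<le> K" .
  qed
  \<comment> \<open>Nonnegativity of \<open>K\<close> is needed to return from
    \<open>ennreal K\<close> to the real inequality, since \<open>ennreal\<close> sends negative
    numbers to 0.\<close>
  have "(\<integral>x. h 0 x \<partial>lebesgue) \<ge> 0" by (intro Bochner_Integration.integral_nonneg h_nonneg)
  then have K: "K \<ge> 0" using h(2)[of 0] by linarith
  have "(\<integral>\<^sup>+x. ennreal (a\<^sup>2 * f x) \<partial>lebesgue) \<le> (\<integral>\<^sup>+x. liminf (\<lambda>n. ennreal (h n x)) \<partial>lebesgue)"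
  proof (rule nn_integral_mono)
    fix x :: 'a
    show "ennreal (a\<^sup>2 * f x) \<le> liminf (\<lambda>n. ennreal (h n x))"
    proof (cases "x = 0")
      case False
      have "(\<lambda>n. h n x) \<longlonglongrightarrow> (\<Phi> k x)\<^sup>2 * (w x)\<^sup>2 * (a\<^sup>2 / ((norm x)\<^sup>2 + 0))"
        unfolding h_def using False by (intro tendsto_intros LIMSEQ_inverse_real_of_nat) simp
      then have "(\<lambda>n. h n x) \<longlonglongrightarrow> a\<^sup>2 * f x" by (simp add: f_def mult_ac)
      then have "(\<lambda>n. ennreal (h n x)) \<longlonglongrightarrow> ennreal (a\<^sup>2 * f x)" by (rule tendsto_ennrealI)
      then show ?thesis by (simp add: lim_imp_Liminf)
    qed (simp add: f_def)
  qed
  also have "\<dots> \<le> liminf (\<lambda>n. \<integral>\<^sup>+x. ennreal (h n x) \<partial>lebesgue)"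
    by (rule nn_integral_liminf) measurable
  also have "\<dots> \<le> ennreal K"
  proof -
    have "(\<integral>\<^sup>+x. ennreal (h n x) \<partial>lebesgue) \<le> ennreal K" for n
      using h h_nonneg by (subst nn_integral_eq_integral) (auto intro: ennreal_leI)
    then have "liminf (\<lambda>n. \<integral>\<^sup>+x. ennreal (h n x) \<partial>lebesgue) \<le> liminf (\<lambda>n. ennreal K)"
      by (intro Liminf_mono always_eventually) auto
    then show ?thesis by (simp add: Liminf_const)
  qed
  finally have F: "(\<integral>\<^sup>+x. ennreal (a\<^sup>2 * f x) \<partial>lebesgue) \<le> ennreal K" .
  have f_nonneg: "f x \<ge> 0" for x by (simp add: f_def)
  have "integrable lebesgue (\<lambda>x. a\<^sup>2 * f x)"
    using F f_nonneg by (intro integrableI_nonneg) (auto simp: le_less_trans[OF F])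
  then have fi: "integrable lebesgue f" using a(1) by simp
  have "ennreal (\<integral>x. a\<^sup>2 * f x \<partial>lebesgue) \<le> ennreal K"
    using F fi f_nonneg by (subst nn_integral_eq_integral[symmetric]) auto
  then have fK: "a\<^sup>2 * (\<integral>x. f x \<partial>lebesgue) \<le> K" using K by simp
  have nz: "AE x in lebesgue. x \<noteq> (0::'a)"
    using AE_not_in[of "{0::'a}" lebesgue] by (simp add: negligible_iff_null_sets[symmetric])
  have "(\<integral>x. (\<Phi> k x)\<^sup>2 * ?S x \<partial>lebesgue) \<le> (\<integral>x. (a\<^sup>2 - c) * f x + C * ((\<Phi> k x)\<^sup>2 * (w x)\<^sup>2) \<partial>lebesgue)"
  proof (rule integral_mono_AE[OF I2])
    show "integrable lebesgue (\<lambda>x. (a\<^sup>2 - c) * f x + C * ((\<Phi> k x)\<^sup>2 * (w x)\<^sup>2))"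
      using fi I3 by (intro Bochner_Integration.integrable_add integrable_mult_right)
    show "AE x in lebesgue. (\<Phi> k x)\<^sup>2 * ?S x \<le> (a\<^sup>2 - c) * f x + C * ((\<Phi> k x)\<^sup>2 * (w x)\<^sup>2)"
      using pot[unfolded potential_bound_def] nz
    proof eventually_elim
      case (elim x)
      show ?case
      proof (cases "w x = 0")
        \<comment> \<open>The potential bound says nothing where \<open>w\<close> vanishes, but
          there the damping makes both sides 0.\<close>
        case True
        then show ?thesis by (simp add: \<Phi>_def f_def damp_def)
      next
        case False
        then have "w x > 0" using w_nonneg[of x] by linarith
        then have "?S x \<le> (w x)\<^sup>2 * ((a\<^sup>2 - c) / (norm x)\<^sup>2 + C)"
          using elim by (simp add: a_def)
        then have "(\<Phi> k x)\<^sup>2 * ?S x \<le> (\<Phi> k x)\<^sup>2 * ((w x)\<^sup>2 * ((a\<^sup>2 - c) / (norm x)\<^sup>2 + C))"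
          by (rule mult_left_mono) simp
        also have "\<dots> = (a\<^sup>2 - c) * f x + C * ((\<Phi> k x)\<^sup>2 * (w x)\<^sup>2)"
          by (simp add: f_def distrib_left mult_ac)
        finally show ?thesis .
      qed
    qed
  qed
  also have "\<dots> = (a\<^sup>2 - c) * (\<integral>x. f x \<partial>lebesgue) + C * (\<integral>x. (\<Phi> k x)\<^sup>2 * (w x)\<^sup>2 \<partial>lebesgue)"
    using fi I3 by simp
  finally have "c * (\<integral>x. f x \<partial>lebesgue) \<le> (\<integral>x. (w x)\<^sup>2 * (norm (D\<Phi> k x))\<^sup>2 \<partial>lebesgue) + C * (\<integral>x. (\<Phi> k x)\<^sup>2 * (w x)\<^sup>2 \<partial>lebesgue)"
    using fK unfolding K_def left_diff_distrib by linarith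
  moreover have "(\<integral>\<^sup>+x. ennreal ((\<Phi> k x)\<^sup>2 * (w x)\<^sup>2 * (c / (norm x)\<^sup>2)) \<partial>lebesgue) = ennreal (c * (\<integral>x. f x \<partial>lebesgue))"
  proof -
    have "(\<lambda>x. (\<Phi> k x)\<^sup>2 * (w x)\<^sup>2 * (c / (norm x)\<^sup>2)) = (\<lambda>x. c * f x)"
      by (simp add: f_def fun_eq_iff mult_ac)
    then have "(\<integral>\<^sup>+x. ennreal ((\<Phi> k x)\<^sup>2 * (w x)\<^sup>2 * (c / (norm x)\<^sup>2)) \<partial>lebesgue) = (\<integral>\<^sup>+x. ennreal (c * f x) \<partial>lebesgue)"
      by (simp add: fun_eq_iff)
    also have "\<dots> = ennreal (\<integral>x. c * f x \<partial>lebesgue)"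
      using fi f_nonneg c by (intro nn_integral_eq_integral) auto
    finally show ?thesis by simp
  qed
  ultimately show ?thesis by (simp add: ennreal_leI)
qed

text \<open>The damping tends to the indicator of w \<noteq> 0, which the factor w^2 cannot
  distinguish from 1. The extra gradient term carries w times \<open>damp'\<close>, which tends to
  0, so grad w disappears from the energy.\<close>

lemma Hardy_cutoff:
  assumes dim: "DIM('a) \<ge> 3" and c: "c > 0" and pot: "potential_bound c C"
  defines "\<Psi> \<equiv> \<lambda>x. \<kappa> x * T (u x)" and "D\<Psi> \<equiv> \<lambda>x. T (u x) *\<^sub>R \<kappa>' x + (\<kappa> x * T' (u x)) *\<^sub>R P x"
  shows "(\<integral>\<^sup>+x. ennreal ((\<Psi> x)\<^sup>2 * (w x)\<^sup>2 * (c / (norm x)\<^sup>2)) \<partial>lebesgue)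
    \<le> ennreal ((\<integral>x. (w x)\<^sup>2 * (norm (D\<Psi> x))\<^sup>2 \<partial>lebesgue) + C * (\<integral>x. (\<Psi> x)\<^sup>2 * (w x)\<^sup>2 \<partial>lebesgue))"
proof -
  have [measurable]: "(\<lambda>x::'a. norm x) \<in> borel_measurable lebesgue"
    by (rule lebesgue_measurable_continuous) (intro continuous_intros)
  define k where "k n = inverse (real (Suc n))" for n
  have k: "k n > 0" for n by (simp add: k_def)
  note [measurable] = \<Phi>_measurable[OF k]
  have [measurable]: "\<Psi> \<in> borel_measurable lebesgue" "D\<Psi> \<in> borel_measurable lebesgue"
    unfolding \<Psi>_def D\<Psi>_def by measurable
  obtain B Z where B: "B > 0" "\<And>x. norm (\<kappa>' x) \<le> B" and Z: "Z > 0" "\<And>x. \<bar>\<kappa> x\<bar> \<le> Z"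
    and \<Phi>2: "\<And>n x. (\<Phi> (k n) x)\<^sup>2 \<le> (Z * A)\<^sup>2"
    and D\<Phi>2: "\<And>n x. (w x)\<^sup>2 * (norm (D\<Phi> (k n) x))\<^sup>2 \<le>
      2 * (2 * (A\<^sup>2 * (B\<^sup>2 * (w x)\<^sup>2)) + 2 * ((Z * A)\<^sup>2 * ((w x)\<^sup>2 * (norm (P x))\<^sup>2)))
        + 2 * ((Z * A)\<^sup>2 * (norm (g x))\<^sup>2)"
    using cutoff_bounds k by metis
  define wa where "wa x = 2 * (2 * (A\<^sup>2 * (B\<^sup>2 * (w x)\<^sup>2)) + 2 * ((Z * A)\<^sup>2 * ((w x)\<^sup>2 * (norm (P x))\<^sup>2)))
        + 2 * ((Z * A)\<^sup>2 * (norm (g x))\<^sup>2)" for x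
  define wb where "wb x = (Z * A)\<^sup>2 * (w x)\<^sup>2" for x
  have "wa \<in> L1_loc" "wb \<in> L1_loc"
    unfolding wa_def wb_def by (intro L1_loc_add L1_loc_cmult loc wP)+
  then have wi: "integrable lebesgue (\<lambda>x. indicator (cball 0 R) x * wa x)" "integrable lebesgue (\<lambda>x. indicator (cball 0 R) x * wb x)"
    by (auto intro: L1_loc_integrable_cball)
  have "(\<integral>\<^sup>+x. ennreal ((\<lambda>x. (\<Psi> x)\<^sup>2 * (w x)\<^sup>2) x * (c / (norm x)\<^sup>2)) \<partial>lebesgue)
    \<le> ennreal ((\<integral>x. (w x)\<^sup>2 * (norm (D\<Psi> x))\<^sup>2 \<partial>lebesgue) + C * (\<integral>x. (\<lambda>x. (\<Psi> x)\<^sup>2 * (w x)\<^sup>2) x \<partial>lebesgue))"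
  proof (rule ennreal_weighted_limit[where a="\<lambda>n x. (w x)\<^sup>2 * (norm (D\<Phi> (k n) x))\<^sup>2" and b="\<lambda>n x. (\<Phi> (k n) x)\<^sup>2 * (w x)\<^sup>2", OF _ _ _ _ _ _ _ wi(1) _ _ wi(2)])
    show "(\<integral>\<^sup>+x. ennreal ((\<Phi> (k n) x)\<^sup>2 * (w x)\<^sup>2 * (c / (norm x)\<^sup>2)) \<partial>lebesgue)
      \<le> ennreal ((\<integral>x. (w x)\<^sup>2 * (norm (D\<Phi> (k n) x))\<^sup>2 \<partial>lebesgue) + C * (\<integral>x. (\<Phi> (k n) x)\<^sup>2 * (w x)\<^sup>2 \<partial>lebesgue))" for n
      by (rule Hardy_truncated[OF dim c pot k])
    show "AE x in lebesgue. norm ((w x)\<^sup>2 * (norm (D\<Phi> (k n) x))\<^sup>2) \<le> indicator (cball 0 R) x * wa x" for n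
    proof (rule AE_I2)
      fix x
      have "(w x)\<^sup>2 * (norm (D\<Phi> (k n) x))\<^sup>2 \<le> wa x"
        unfolding wa_def by (rule D\<Phi>2)
      then show "norm ((w x)\<^sup>2 * (norm (D\<Phi> (k n) x))\<^sup>2) \<le> indicator (cball 0 R) x * wa x"
        using \<kappa>(3,4)[of x] by (cases "norm x \<le> R") (auto simp: D\<Phi>_def)
    qed
    show "AE x in lebesgue. norm ((\<Phi> (k n) x)\<^sup>2 * (w x)\<^sup>2) \<le> indicator (cball 0 R) x * wb x" for n
    proof (rule AE_I2)
      fix x
      have "(\<Phi> (k n) x)\<^sup>2 * (w x)\<^sup>2 \<le> wb x" unfolding wb_def using \<Phi>2 by (rule mult_right_mono) simp
      then show "norm ((\<Phi> (k n) x)\<^sup>2 * (w x)\<^sup>2) \<le> indicator (cball 0 R) x * wb x"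
        using \<kappa>(3)[of x] by (cases "norm x \<le> R") (auto simp: \<Phi>_def)
    qed
    have d: "(\<lambda>n. damp (k n) t) \<longlonglongrightarrow> (if t = 0 then 0 else 1)" "(\<lambda>n. t * damp' (k n) t) \<longlonglongrightarrow> 0" for t
      unfolding k_def by (rule damp_tendsto)+
    show "AE x in lebesgue. (\<lambda>n. (\<Phi> (k n) x)\<^sup>2 * (w x)\<^sup>2) \<longlonglongrightarrow> (\<Psi> x)\<^sup>2 * (w x)\<^sup>2"
    proof (rule AE_I2)
      fix x
      have "(\<lambda>n. (\<Phi> (k n) x)\<^sup>2 * (w x)\<^sup>2) \<longlonglongrightarrow> (\<kappa> x * T (u x) * (if w x = 0 then 0 else 1))\<^sup>2 * (w x)\<^sup>2"
        unfolding \<Phi>_def by (intro tendsto_intros d)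
      then show "(\<lambda>n. (\<Phi> (k n) x)\<^sup>2 * (w x)\<^sup>2) \<longlonglongrightarrow> (\<Psi> x)\<^sup>2 * (w x)\<^sup>2"
        by (simp add: \<Psi>_def split: if_splits)
    qed
    show "AE x in lebesgue. (\<lambda>n. (w x)\<^sup>2 * (norm (D\<Phi> (k n) x))\<^sup>2) \<longlonglongrightarrow> (w x)\<^sup>2 * (norm (D\<Psi> x))\<^sup>2"
    proof (rule AE_I2)
      fix x
      let ?e = "if w x = 0 then 0 else (1::real)"
      have sq: "(w x)\<^sup>2 * (norm v)\<^sup>2 = (norm (w x *\<^sub>R v))\<^sup>2" for v :: 'a
        by (simp add: power_mult_distrib)
      have "w x *\<^sub>R D\<Phi> (k n) x = (T (u x) * damp (k n) (w x)) *\<^sub>R (w x *\<^sub>R \<kappa>' x)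
          + (\<kappa> x * T' (u x) * damp (k n) (w x)) *\<^sub>R (w x *\<^sub>R P x)
          + (\<kappa> x * T (u x) * (w x * damp' (k n) (w x))) *\<^sub>R g x" for n
        by (simp add: D\<Phi>_def algebra_simps)
      moreover have "(\<lambda>n. (T (u x) * damp (k n) (w x)) *\<^sub>R (w x *\<^sub>R \<kappa>' x)
          + (\<kappa> x * T' (u x) * damp (k n) (w x)) *\<^sub>R (w x *\<^sub>R P x)
          + (\<kappa> x * T (u x) * (w x * damp' (k n) (w x))) *\<^sub>R g x)
        \<longlonglongrightarrow> (T (u x) * ?e) *\<^sub>R (w x *\<^sub>R \<kappa>' x) + (\<kappa> x * T' (u x) * ?e) *\<^sub>R (w x *\<^sub>R P x)
          + (\<kappa> x * T (u x) * 0) *\<^sub>R g x"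
        by (intro tendsto_intros d)
      moreover have "(T (u x) * ?e) *\<^sub>R (w x *\<^sub>R \<kappa>' x) + (\<kappa> x * T' (u x) * ?e) *\<^sub>R (w x *\<^sub>R P x)
          + (\<kappa> x * T (u x) * 0) *\<^sub>R g x = w x *\<^sub>R D\<Psi> x"
        by (simp add: D\<Psi>_def algebra_simps)
      ultimately have "(\<lambda>n. w x *\<^sub>R D\<Phi> (k n) x) \<longlonglongrightarrow> w x *\<^sub>R D\<Psi> x" by (simp only:)
      then show "(\<lambda>n. (w x)\<^sup>2 * (norm (D\<Phi> (k n) x))\<^sup>2) \<longlonglongrightarrow> (w x)\<^sup>2 * (norm (D\<Psi> x))\<^sup>2"
        unfolding sq by (rule tendsto_power[OF tendsto_norm])
    qed
  qed measurable
  then show ?thesis by simp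
qed

end

context weight
begin

text \<open>A single parameter n + 1 serves as truncation level, as bound for the truncation and its
  derivative, and as cut-off radius. The cut-off gradient is at most 4, whence the 16 in the
  majorant of the energies.\<close>

lemma Hardy_inequality:
  assumes dim: "DIM('a) \<ge> 3" and c: "c > 0" and pot: "potential_bound c C"
    and u: "has_weak_gradient u P"
    and I: "integrable lebesgue (\<lambda>x. (w x)\<^sup>2 * (u x)\<^sup>2)" "integrable lebesgue (\<lambda>x. (w x)\<^sup>2 * (norm (P x))\<^sup>2)"
  shows "(\<integral>\<^sup>+x. ennreal ((u x)\<^sup>2 * (w x)\<^sup>2 * (c / (norm x)\<^sup>2)) \<partial>lebesgue)
    \<le> ennreal ((\<integral>x. (w x)\<^sup>2 * (norm (P x))\<^sup>2 \<partial>lebesgue) + C * (\<integral>x. (u x)\<^sup>2 * (w x)\<^sup>2 \<partial>lebesgue))"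
proof -
  have uL: "u \<in> L1_loc" "P \<in> L1_loc" using u by (auto simp: has_weak_gradient_def)
  have [measurable]: "u \<in> borel_measurable lebesgue" "P \<in> borel_measurable lebesgue"
    by (auto intro: L1_loc_measurable uL)
  have [measurable]: "(\<lambda>x::'a. norm x) \<in> borel_measurable lebesgue"
    by (rule lebesgue_measurable_continuous) (intro continuous_intros)
  define k where "k n = real (Suc n)" for n
  have k: "k n \<ge> 1" for n by (simp add: k_def)
  note tr = trunc_facts[OF k] and cu = cutoff_facts[OF k, where ?'a='a]
  define \<Phi>n where "\<Phi>n n x = cutoff (k n) x * trunc (k n) (u x)" for n x
  define Pn where "Pn n x = trunc (k n) (u x) *\<^sub>R cutoff_grad (k n) x + (cutoff (k n) x * trunc' (k n) (u x)) *\<^sub>R P x" for n x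
  have [measurable]: "cutoff (k n) \<in> borel_measurable (lebesgue :: 'a measure)"
     "cutoff_grad (k n) \<in> borel_measurable (lebesgue :: 'a measure)" for n
    using GDERIV_continuous[OF cu(1)] cu(2) by (auto intro: lebesgue_measurable_continuous)
  have "continuous_on UNIV (trunc (k n))" for n
    using tr(1) by (meson DERIV_continuous_on has_field_derivative_at_within)
  then have [measurable]: "trunc (k n) \<in> borel_measurable borel" "trunc' (k n) \<in> borel_measurable borel" for n
    using tr(2) by (auto intro: borel_measurable_continuous_onI)
  have [measurable]: "\<Phi>n n \<in> borel_measurable lebesgue" "Pn n \<in> borel_measurable lebesgue" for n
    unfolding \<Phi>n_def Pn_def by measurable
  have wi: "integrable lebesgue (\<lambda>x. 2 * (16 * ((w x)\<^sup>2 * (u x)\<^sup>2)) + 2 * ((w x)\<^sup>2 * (norm (P x))\<^sup>2))"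
    using I by simp
  have "(\<integral>\<^sup>+x. ennreal ((\<lambda>x. (u x)\<^sup>2 * (w x)\<^sup>2) x * (c / (norm x)\<^sup>2)) \<partial>lebesgue)
    \<le> ennreal ((\<integral>x. (w x)\<^sup>2 * (norm (P x))\<^sup>2 \<partial>lebesgue) + C * (\<integral>x. (\<lambda>x. (u x)\<^sup>2 * (w x)\<^sup>2) x \<partial>lebesgue))"
  proof (rule ennreal_weighted_limit[where a="\<lambda>n x. (w x)\<^sup>2 * (norm (Pn n x))\<^sup>2" and b="\<lambda>n x. (\<Phi>n n x)\<^sup>2 * (w x)\<^sup>2", OF _ _ _ _ _ _ _ wi _ _ I(1)])
    show "(\<integral>\<^sup>+x. ennreal ((\<Phi>n n x)\<^sup>2 * (w x)\<^sup>2 * (c / (norm x)\<^sup>2)) \<partial>lebesgue)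
      \<le> ennreal ((\<integral>x. (w x)\<^sup>2 * (norm (Pn n x))\<^sup>2 \<partial>lebesgue) + C * (\<integral>x. (\<Phi>n n x)\<^sup>2 * (w x)\<^sup>2 \<partial>lebesgue))" for n
    proof -
      interpret truncation w l g D u "cutoff (k n)" P "cutoff_grad (k n)" "trunc (k n)" "trunc' (k n)" "k n" "k n"
        by unfold_locales
          (rule u integrable_imp_L1_loc[OF I(2)] tr(1,2,3) order_trans[OF tr(5) k] cu(1,2,3,4); assumption)+
      show ?thesis
        unfolding \<Phi>n_def Pn_def by (rule Hardy_cutoff[OF dim c pot])
    qed
    have P4: "norm (cutoff_grad (k n) x) \<le> 4" for n and x :: 'a
      using k[of n] by (intro order_trans[OF cu(6)]) (simp add: divide_le_eq)
    show "AE x in lebesgue. norm ((w x)\<^sup>2 * (norm (Pn n x))\<^sup>2) \<le> 2 * (16 * ((w x)\<^sup>2 * (u x)\<^sup>2)) + 2 * ((w x)\<^sup>2 * (norm (P x))\<^sup>2)" for n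
    proof (rule AE_I2)
      fix x
      have "\<bar>cutoff (k n) x\<bar> * \<bar>trunc' (k n) (u x)\<bar> \<le> 1 * 1"
        using cu tr by (intro mult_mono) auto
      then have 2: "(norm ((cutoff (k n) x * trunc' (k n) (u x)) *\<^sub>R P x))\<^sup>2 \<le> 1\<^sup>2 * (norm (P x))\<^sup>2"
        by (intro norm_scaleR_square_le) (simp add: abs_mult)
      have "(norm (trunc (k n) (u x) *\<^sub>R cutoff_grad (k n) x))\<^sup>2 \<le> \<bar>u x\<bar>\<^sup>2 * (norm (cutoff_grad (k n) x))\<^sup>2"
        by (intro norm_scaleR_square_le tr)
      also have "\<dots> \<le> \<bar>u x\<bar>\<^sup>2 * 4\<^sup>2"
        by (intro mult_left_mono power_mono P4) auto
      finally have 1: "(norm (trunc (k n) (u x) *\<^sub>R cutoff_grad (k n) x))\<^sup>2 \<le> 16 * (u x)\<^sup>2" by simp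
      have "(w x)\<^sup>2 * (norm (Pn n x))\<^sup>2 \<le> (w x)\<^sup>2 * (2 * (16 * (u x)\<^sup>2) + 2 * (1\<^sup>2 * (norm (P x))\<^sup>2))"
        unfolding Pn_def by (intro mult_left_mono norm_add_square_bound 1 2) simp
      then show "norm ((w x)\<^sup>2 * (norm (Pn n x))\<^sup>2) \<le> 2 * (16 * ((w x)\<^sup>2 * (u x)\<^sup>2)) + 2 * ((w x)\<^sup>2 * (norm (P x))\<^sup>2)"
        by (simp add: algebra_simps)
    qed
    show "AE x in lebesgue. norm ((\<Phi>n n x)\<^sup>2 * (w x)\<^sup>2) \<le> (w x)\<^sup>2 * (u x)\<^sup>2" for n
    proof (rule AE_I2)
      fix x
      have "\<bar>cutoff (k n) x\<bar> * \<bar>trunc (k n) (u x)\<bar> \<le> 1 * \<bar>u x\<bar>"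
        using cu tr by (intro mult_mono) auto
      then have "\<bar>\<Phi>n n x\<bar> \<le> \<bar>u x\<bar>" by (simp add: \<Phi>n_def abs_mult)
      then have "(\<Phi>n n x)\<^sup>2 \<le> (u x)\<^sup>2" by (simp only: abs_le_square_iff)
      then have "(w x)\<^sup>2 * (\<Phi>n n x)\<^sup>2 \<le> (w x)\<^sup>2 * (u x)\<^sup>2" by (rule mult_left_mono) simp
      then show "norm ((\<Phi>n n x)\<^sup>2 * (w x)\<^sup>2) \<le> (w x)\<^sup>2 * (u x)\<^sup>2"
        by (simp add: mult.commute)
    qed
    note lims = cutoff_tendsto cutoff_grad_tendsto trunc_tendsto
    show "AE x in lebesgue. (\<lambda>n. (\<Phi>n n x)\<^sup>2 * (w x)\<^sup>2) \<longlonglongrightarrow> (u x)\<^sup>2 * (w x)\<^sup>2"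
    proof (rule AE_I2)
      fix x
      have "(\<lambda>n. (\<Phi>n n x)\<^sup>2 * (w x)\<^sup>2) \<longlonglongrightarrow> (1 * u x)\<^sup>2 * (w x)\<^sup>2"
        unfolding \<Phi>n_def k_def by (intro tendsto_intros lims)
      then show "(\<lambda>n. (\<Phi>n n x)\<^sup>2 * (w x)\<^sup>2) \<longlonglongrightarrow> (u x)\<^sup>2 * (w x)\<^sup>2" by simp
    qed
    show "AE x in lebesgue. (\<lambda>n. (w x)\<^sup>2 * (norm (Pn n x))\<^sup>2) \<longlonglongrightarrow> (w x)\<^sup>2 * (norm (P x))\<^sup>2"
    proof (rule AE_I2)
      fix x
      have "(\<lambda>n. (w x)\<^sup>2 * (norm (Pn n x))\<^sup>2) \<longlonglongrightarrow> (w x)\<^sup>2 * (norm (u x *\<^sub>R 0 + (1 * 1) *\<^sub>R P x))\<^sup>2"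
        unfolding Pn_def k_def by (intro tendsto_intros lims)
      then show "(\<lambda>n. (w x)\<^sup>2 * (norm (Pn n x))\<^sup>2) \<longlonglongrightarrow> (w x)\<^sup>2 * (norm (P x))\<^sup>2" by simp
    qed
  qed measurable
  then show ?thesis by simp
qed

end


theorem theorem3p3:
  fixes \<mu> :: "'a::euclidean_space \<Rightarrow> real" and D\<mu> :: "'a \<Rightarrow> 'a" and \<Delta>\<mu> :: "'a \<Rightarrow> real"
  assumes dim: "DIM('a) \<ge> 3"
    and nonneg: "\<And>x. \<mu> x \<ge> 0"
    and sqrt_H1: "(\<lambda>x. sqrt (\<mu> x)) \<in> H1_loc"
    and grad: "has_weak_gradient \<mu> D\<mu>"
    and lap: "has_weak_Laplacian \<mu> \<Delta>\<mu>"
    and fin: "\<bar>c0_weighted \<mu> D\<mu> \<Delta>\<mu>\<bar> \<noteq> \<infinity>"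
    and bdd: "\<And>R. R > 0 \<Longrightarrow>
      \<exists>B::real. AE x in weighted \<mu>. x \<in> - ball 0 R \<longrightarrow> U_rem \<mu> D\<mu> \<Delta>\<mu> x \<le> ereal B"
  shows "\<forall>c::real. ereal c < c0_weighted \<mu> D\<mu> \<Delta>\<mu> \<longrightarrow>
    (\<exists>C::real. \<forall>\<phi>\<in>H1 (weighted \<mu>). \<forall>D\<phi>. has_weak_gradient \<phi> D\<phi> \<longrightarrow>
      ereal c * enn2ereal (\<integral>\<^sup>+x. ennreal ((\<phi> x)\<^sup>2 / (norm x)\<^sup>2) \<partial>weighted \<mu>)
        \<le> ereal ((\<integral>x. (norm (D\<phi> x))\<^sup>2 \<partial>weighted \<mu>) + C * (\<integral>x. (\<phi> x)\<^sup>2 \<partial>weighted \<mu>)))"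
proof (intro allI impI)
  fix c :: real assume c_less: "ereal c < c0_weighted \<mu> D\<mu> \<Delta>\<mu>"
  obtain g where g: "g \<in> L2_loc" "has_weak_gradient (\<lambda>x. sqrt (\<mu> x)) g" and w: "(\<lambda>x. sqrt (\<mu> x)) \<in> L2_loc"
    using sqrt_H1 by (auto simp: H1_loc_def)
  have sq: "(\<lambda>x. (sqrt (\<mu> x))\<^sup>2) = \<mu>" using nonneg by simp
  interpret weight "\<lambda>x. sqrt (\<mu> x)" \<Delta>\<mu> g D\<mu>
    by unfold_locales (use nonneg w g grad lap in \<open>simp_all\<close>)
  have \<mu>_meas[measurable]: "\<mu> \<in> borel_measurable lebesgue"
    using L1_loc_measurable[OF loc(1)] by (simp only: sq)
  have norm_meas[measurable]: "(\<lambda>x::'a. norm x) \<in> borel_measurable lebesgue"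
    by (rule lebesgue_measurable_continuous) (intro continuous_intros)
  let ?U = "U_pot \<mu> D\<mu> \<Delta>\<mu>" and ?M = "weighted \<mu>" and ?c0 = "c0 TYPE('a)"
  have AE_w: "(AE x in ?M. Q x) \<longleftrightarrow> (AE x in lebesgue. 0 < \<mu> x \<longrightarrow> Q x)" for Q
    unfolding weighted_def by (subst AE_density) simp_all
  show "\<exists>C::real. \<forall>\<phi>\<in>H1 ?M. \<forall>D\<phi>. has_weak_gradient \<phi> D\<phi> \<longrightarrow>
      ereal c * enn2ereal (\<integral>\<^sup>+x. ennreal ((\<phi> x)\<^sup>2 / (norm x)\<^sup>2) \<partial>?M)
        \<le> ereal ((\<integral>x. (norm (D\<phi> x))\<^sup>2 \<partial>?M) + C * (\<integral>x. (\<phi> x)\<^sup>2 \<partial>?M))"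
  proof (cases "c > 0")
    \<comment> \<open>For c \<le> 0 the left side is at most 0 even if the singular integral is
      infinite, so the constant 0 works.\<close>
    case False
    show ?thesis
    proof (intro exI[of _ 0] ballI allI impI)
      fix \<phi> :: "'a \<Rightarrow> real" and D\<phi> :: "'a \<Rightarrow> 'a"
      have "ereal c * enn2ereal (\<integral>\<^sup>+x. ennreal ((\<phi> x)\<^sup>2 / (norm x)\<^sup>2) \<partial>?M) \<le> 0"
        using False by (auto simp: ereal_mult_le_0_iff)
      also have "0 \<le> ereal ((\<integral>x. (norm (D\<phi> x))\<^sup>2 \<partial>?M) + 0 * (\<integral>x. (\<phi> x)\<^sup>2 \<partial>?M))"
        by (simp add: Bochner_Integration.integral_nonneg)
      finally show "ereal c * enn2ereal (\<integral>\<^sup>+x. ennreal ((\<phi> x)\<^sup>2 / (norm x)\<^sup>2) \<partial>?M)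
        \<le> ereal ((\<integral>x. (norm (D\<phi> x))\<^sup>2 \<partial>?M) + 0 * (\<integral>x. (\<phi> x)\<^sup>2 \<partial>?M))" .
    qed
  next
    case True
    have ev: "\<forall>\<^sub>F x in ess_at_0 ?M. ereal c < ereal (?c0 - (norm x)\<^sup>2 * ?U x)"
      using c_less unfolding c0_weighted_def by (rule less_LiminfD)
    \<comment> \<open>Replaces the limsup inside \<open>U_rem\<close> by the explicit number c_0(N)
      - c, so that the assumption away from the origin produces the same singular term as the
      estimate near it.\<close>
    then have L: "Limsup (ess_at_0 ?M) (\<lambda>y. ereal ((norm y)\<^sup>2 * ?U y)) \<le> ereal (?c0 - c)"
      by (intro Limsup_bounded) (auto elim!: eventually_mono)
    obtain d where d: "d > 0" and near: "AE x in ?M. x \<noteq> 0 \<longrightarrow> norm x < d \<longrightarrow> c < ?c0 - (norm x)\<^sup>2 * ?U x"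
    proof -
      obtain Q1 Q2 where Q: "eventually Q1 (at (0::'a))" "eventually Q2 (ae_filter ?M)"
        "\<And>x. Q1 x \<and> Q2 x \<Longrightarrow> ereal c < ereal (?c0 - (norm x)\<^sup>2 * ?U x)"
        using ev unfolding ess_at_0_def eventually_inf by blast
      from Q(1) obtain d where "d > 0" "\<And>x. x \<noteq> 0 \<Longrightarrow> norm x < d \<Longrightarrow> Q1 x"
        unfolding eventually_at by (auto simp: dist_norm)
      then show ?thesis
        using Q(2,3) by (intro that[of d]) (auto elim!: eventually_mono)
    qed
    \<comment> \<open>The radius is the one up to which the estimate near the origin
      reaches.\<close>
    obtain B where far: "AE x in ?M. x \<in> - ball 0 d \<longrightarrow> U_rem \<mu> D\<mu> \<Delta>\<mu> x \<le> ereal B"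
      using bdd[OF d] by blast
    \<comment> \<open>Near the origin the additive constant 0 suffices. Nonnegativity of
      \<open>C\<close> also makes the final right side nonnegative, so that it survives the passage
      through \<open>ennreal\<close>.\<close>
    define C where "C = max B 0"
    have U_le: "AE x in ?M. x \<noteq> 0 \<longrightarrow> ?U x \<le> (?c0 - c) / (norm x)\<^sup>2 + C"
      using near far
    proof eventually_elim
      case (elim x)
      show ?case
      proof
        assume x: "x \<noteq> 0"
        show "?U x \<le> (?c0 - c) / (norm x)\<^sup>2 + C"
        proof (cases "norm x < d")
          case True
          then have "?U x * (norm x)\<^sup>2 \<le> ?c0 - c" using elim x by (simp add: mult.commute)
          then have "?U x \<le> (?c0 - c) / (norm x)\<^sup>2" using x by (simp add: pos_le_divide_eq)
          then show ?thesis by (simp add: C_def)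
        next
          case False
          then have "U_rem \<mu> D\<mu> \<Delta>\<mu> x \<le> ereal B" using elim by simp
          moreover have "ereal (?U x) - ereal (1 / (norm x)\<^sup>2) * ereal (?c0 - c) \<le> U_rem \<mu> D\<mu> \<Delta>\<mu> x"
            unfolding U_rem_def by (intro ereal_minus_mono order_refl ereal_mult_left_mono L) simp
          ultimately have "ereal (?U x) - ereal (1 / (norm x)\<^sup>2) * ereal (?c0 - c) \<le> ereal B"
            by (rule order_trans[rotated])
          then show ?thesis by (simp add: C_def)
        qed
      qed
    qed
    have pot: "potential_bound c C"
      unfolding potential_bound_def
      using U_le[unfolded AE_w] D_eq
    proof eventually_elim
      case (elim x)
      show ?case
      proof (intro impI)
        assume pos: "sqrt (\<mu> x) > 0" and x: "x \<noteq> 0"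
        then have \<mu>: "\<mu> x > 0" by simp
        \<comment> \<open>By grad \<mu> = 2 w grad w, a quarter of |grad \<mu> / \<mu>|^2 is |grad
          w|^2 / \<mu>; this links the potential to the division-free expression in
          \<open>potential_bound\<close>.\<close>
        have "norm (D\<mu> x /\<^sub>R \<mu> x) = 2 * sqrt (\<mu> x) * norm (g x) / \<mu> x"
          using elim(2) \<mu> by (simp add: divide_inverse mult_ac)
        then have "?U x = (norm (g x))\<^sup>2 / \<mu> x - \<Delta>\<mu> x / 2 / \<mu> x"
          using \<mu> by (simp add: U_pot_def power_mult_distrib power_divide power2_eq_square[of "\<mu> x"])
        then have "(norm (g x))\<^sup>2 - \<Delta>\<mu> x / 2 = \<mu> x * ?U x"
          using \<mu> by (simp add: right_diff_distrib)
        also have "\<dots> \<le> \<mu> x * ((?c0 - c) / (norm x)\<^sup>2 + C)"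
          using elim(1) \<mu> x by (intro mult_left_mono) auto
        finally show "(norm (g x))\<^sup>2 - \<Delta>\<mu> x / 2 \<le> (sqrt (\<mu> x))\<^sup>2 * ((((real DIM('a) - 2) / 2)\<^sup>2 - c) / (norm x)\<^sup>2 + C)"
          using \<mu> by (simp add: c0_def)
      qed
    qed
    show ?thesis
    proof (intro exI[of _ C] ballI allI impI)
      fix \<phi> D\<phi> assume \<phi>: "\<phi> \<in> H1 ?M" and D\<phi>: "has_weak_gradient \<phi> D\<phi>"
      obtain P where P: "P \<in> L2 ?M" "has_weak_gradient \<phi> P" and \<phi>2: "\<phi> \<in> L2 ?M"
        using \<phi> by (auto simp: H1_def)
      \<comment> \<open>No integrability of \<open>D\<phi>\<close> against \<mu> is given; it is
        inherited from the gradient \<open>P\<close> in weighted L2.\<close>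
      have eq: "AE x in lebesgue. D\<phi> x = P x" by (rule weak_gradient_unique[OF D\<phi> P(2)])
      have [measurable]: "\<phi> \<in> borel_measurable lebesgue" "P \<in> borel_measurable lebesgue" "D\<phi> \<in> borel_measurable lebesgue"
        using P(2) D\<phi> by (auto simp: has_weak_gradient_def intro: L1_loc_measurable)
      have I: "integrable lebesgue (\<lambda>x. \<mu> x * (\<phi> x)\<^sup>2)" "integrable lebesgue (\<lambda>x. \<mu> x * (norm (P x))\<^sup>2)"
        using P(1) \<phi>2 nonneg by (simp_all add: L2_def weighted_def integrable_density)
      have "integrable lebesgue (\<lambda>x. (sqrt (\<mu> x))\<^sup>2 * (\<phi> x)\<^sup>2)" "integrable lebesgue (\<lambda>x. (sqrt (\<mu> x))\<^sup>2 * (norm (P x))\<^sup>2)"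
        using I nonneg by simp_all
      from Hardy_inequality[OF dim True pot P(2) this]
      have H: "(\<integral>\<^sup>+x. ennreal ((\<phi> x)\<^sup>2 * \<mu> x * (c / (norm x)\<^sup>2)) \<partial>lebesgue)
        \<le> ennreal ((\<integral>x. \<mu> x * (norm (P x))\<^sup>2 \<partial>lebesgue) + C * (\<integral>x. (\<phi> x)\<^sup>2 * \<mu> x \<partial>lebesgue))"
        using nonneg by simp
      have 1: "(\<integral>x. (norm (D\<phi> x))\<^sup>2 \<partial>?M) = (\<integral>x. \<mu> x * (norm (P x))\<^sup>2 \<partial>lebesgue)"
        unfolding weighted_def using nonneg eq
        by (subst integral_density) (auto intro!: integral_cong_AE)
      have 2: "(\<integral>x. (\<phi> x)\<^sup>2 \<partial>?M) = (\<integral>x. (\<phi> x)\<^sup>2 * \<mu> x \<partial>lebesgue)"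
        unfolding weighted_def using nonneg
        by (subst integral_density) (auto simp: mult.commute)
      let ?X = "\<integral>\<^sup>+x. ennreal ((\<phi> x)\<^sup>2 / (norm x)\<^sup>2) \<partial>?M"
      let ?K = "(\<integral>x. (norm (D\<phi> x))\<^sup>2 \<partial>?M) + C * (\<integral>x. (\<phi> x)\<^sup>2 \<partial>?M)"
      have K: "?K \<ge> 0"
        by (intro add_nonneg_nonneg mult_nonneg_nonneg Bochner_Integration.integral_nonneg) (auto simp: C_def)
      have "ennreal c * ?X = (\<integral>\<^sup>+x. ennreal c * (ennreal (\<mu> x) * ennreal ((\<phi> x)\<^sup>2 / (norm x)\<^sup>2)) \<partial>lebesgue)"
        unfolding weighted_def by (subst nn_integral_density) (auto simp: nn_integral_cmult)
      also have "\<dots> = (\<integral>\<^sup>+x. ennreal ((\<phi> x)\<^sup>2 * \<mu> x * (c / (norm x)\<^sup>2)) \<partial>lebesgue)"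
        using True nonneg by (intro nn_integral_cong) (simp add: ennreal_mult[symmetric] mult_ac)
      also have "\<dots> \<le> ennreal ?K" unfolding 1 2 by (rule H)
      finally have "enn2ereal (ennreal c * ?X) \<le> enn2ereal (ennreal ?K)"
        by (simp add: less_eq_ennreal.rep_eq)
      then show "ereal c * enn2ereal ?X \<le> ereal ?K"
        using True K by (simp add: times_ennreal.rep_eq enn2ereal_ennreal)
    qed
  qed
qed

end
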